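(* Let $p$ be a prime. There is a computable formally $p$-adic field which does not embed into a computable $p$-adic closure.
   Context: A valued field is a field $K$ with a surjective map $v\colon K\to\Gamma\cup\{\infty\}$, $\Gamma$ an ordered abelian group (the value group), such that $v(x)=\infty$ iff $x=0$, $v(xy)=v(x)+v(y)$, and $v(x+y)\ge\min(v(x),v(y))$. A computable valued field is a field whose domain is a computable subset of $\omega$, with computable addition and multiplication, and with a computable valuation, i.e. $\Gamma$ is a computable ordered group and $v$ is a computable function (equivalently, the relation $v(a)\le v(b)$ on $K$ is computable). A valued field $(K,v)$ extending $\mathbb{Q}$ is formally $p$-adic if $v$ extends the $p$-adic valuation on $\mathbb{Q}$, the residue field is $\mathbb{F}_p$, and $v(p)$ is the least positive element of the value group. It is $p$-adically closed if in addition it is Henselian and its value group is elementarily equivalent to $\mathbb{Z}$ as an ordered group (i.e. is a model of Presburger arithmetic). A $p$-adic closure of a formally $p$-adic field $(K,v)$ is an algebraic valued field extension of $(K,v)$ which is $p$-adically closed; it is computable if it is a computable valued field. Embeddings are embeddings of valued fields. *)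

theory Defs
  imports "HOL-Algebra.Algebra" "HOL-Computational_Algebra.Primes"
begin

section \<open>Computable functions on the natural numbers\<close>

text \<open>The usual \<open>\<mu>\<close>-recursive functions. In \<open>PrimRec f g\<close> the recursion is on the
  first argument; \<open>Mu f\<close> searches for the least value of the first argument of \<open>f\<close> at which
  \<open>f\<close> returns \<open>0\<close>, all smaller values being required to converge.\<close>

datatype recf = Zr | Sc | Proj nat | Comp recf "recf list" | PrimRec recf recf | Mu recf

inductive reval :: "recf \<Rightarrow> nat list \<Rightarrow> nat \<Rightarrow> bool" where
  Zr: "reval Zr xs 0"
| Sc: "reval Sc [x] (Suc x)"
| Proj: "i < length xs \<Longrightarrow> reval (Proj i) xs (xs ! i)"
| Comp: "list_all2 (\<lambda>g y. reval g xs y) gs ys \<Longrightarrow> reval f ys z \<Longrightarrow> reval (Comp f gs) xs z"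
| PrimRec0: "reval f xs y \<Longrightarrow> reval (PrimRec f g) (0 # xs) y"
| PrimRecS: "reval (PrimRec f g) (n # xs) y \<Longrightarrow> reval g (n # y # xs) z
    \<Longrightarrow> reval (PrimRec f g) (Suc n # xs) z"
| Mu: "reval f (n # xs) 0 \<Longrightarrow> (\<forall>m<n. \<exists>y. reval f (m # xs) (Suc y)) \<Longrightarrow> reval (Mu f) xs n"

definition computable_set :: "nat set \<Rightarrow> bool" where
  "computable_set A \<longleftrightarrow> (\<exists>r. \<forall>x. reval r [x] (if x \<in> A then 1 else 0))"

definition computable_fun :: "nat set \<Rightarrow> (nat \<Rightarrow> nat) \<Rightarrow> bool" where
  "computable_fun A f \<longleftrightarrow> (\<exists>r. \<forall>x\<in>A. reval r [x] (f x))"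

definition computable_op :: "nat set \<Rightarrow> (nat \<Rightarrow> nat \<Rightarrow> nat) \<Rightarrow> bool" where
  "computable_op A f \<longleftrightarrow> (\<exists>r. \<forall>x\<in>A. \<forall>y\<in>A. reval r [x, y] (f x y))"

definition computable_rel :: "nat set \<Rightarrow> (nat \<Rightarrow> nat \<Rightarrow> bool) \<Rightarrow> bool" where
  "computable_rel A R \<longleftrightarrow> computable_op A (\<lambda>x y. if R x y then 1 else 0)"


section \<open>Ordered abelian groups\<close>

text \<open>HOL-Algebra writes groups multiplicatively, so the sum of two values is
  \<open>a \<otimes> b\<close> and the value \<open>0\<close> is \<open>\<one>\<close>.\<close>

record 'a ogroup = "'a monoid" +
  ole :: "'a \<Rightarrow> 'a \<Rightarrow> bool"

locale ordered_abelian_group = comm_group G for G :: "('a, 'm) ogroup_scheme" (structure) +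
  assumes ole_refl: "a \<in> carrier G \<Longrightarrow> ole G a a"
    and ole_antisym:
      "\<lbrakk> a \<in> carrier G; b \<in> carrier G; ole G a b; ole G b a \<rbrakk> \<Longrightarrow> a = b"
    and ole_trans:
      "\<lbrakk> a \<in> carrier G; b \<in> carrier G; c \<in> carrier G; ole G a b; ole G b c \<rbrakk> \<Longrightarrow> ole G a c"
    and ole_total: "\<lbrakk> a \<in> carrier G; b \<in> carrier G \<rbrakk> \<Longrightarrow> ole G a b \<or> ole G b a"
    and ole_mult:
      "\<lbrakk> a \<in> carrier G; b \<in> carrier G; c \<in> carrier G; ole G a b \<rbrakk> \<Longrightarrow> ole G (a \<otimes> c) (b \<otimes> c)"

definition oless :: "('a, 'm) ogroup_scheme \<Rightarrow> 'a \<Rightarrow> 'a \<Rightarrow> bool" where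
  "oless G a b \<longleftrightarrow> ole G a b \<and> a \<noteq> b"

definition int_ogroup :: "int ogroup" where
  "int_ogroup = \<lparr> carrier = UNIV, monoid.mult = (+), one = 0, ole = (\<le>) \<rparr>"

definition computable_ogroup :: "nat ogroup \<Rightarrow> bool" where
  "computable_ogroup G \<longleftrightarrow> ordered_abelian_group G \<and> computable_set (carrier G) \<and>
     computable_op (carrier G) (monoid.mult G) \<and> computable_rel (carrier G) (ole G)"


subsection \<open>Elementary equivalence in the first-order language of ordered groups\<close>

datatype ogterm = TVar nat | TZero | TPlus ogterm ogterm | TNeg ogterm

datatype ogform = FEq ogterm ogterm | FLe ogterm ogterm | FNot ogform
  | FAnd ogform ogform | FAll nat ogform

primrec tvars :: "ogterm \<Rightarrow> nat set" where
  "tvars (TVar i) = {i}"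
| "tvars TZero = {}"
| "tvars (TPlus s t) = tvars s \<union> tvars t"
| "tvars (TNeg t) = tvars t"

primrec ffree :: "ogform \<Rightarrow> nat set" where
  "ffree (FEq s t) = tvars s \<union> tvars t"
| "ffree (FLe s t) = tvars s \<union> tvars t"
| "ffree (FNot \<phi>) = ffree \<phi>"
| "ffree (FAnd \<phi> \<psi>) = ffree \<phi> \<union> ffree \<psi>"
| "ffree (FAll i \<phi>) = ffree \<phi> - {i}"

primrec tval :: "('a, 'm) ogroup_scheme \<Rightarrow> (nat \<Rightarrow> 'a) \<Rightarrow> ogterm \<Rightarrow> 'a" where
  "tval G e (TVar i) = e i"
| "tval G e TZero = \<one>\<^bsub>G\<^esub>"
| "tval G e (TPlus s t) = tval G e s \<otimes>\<^bsub>G\<^esub> tval G e t"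
| "tval G e (TNeg t) = inv\<^bsub>G\<^esub> (tval G e t)"

primrec fsat :: "('a, 'm) ogroup_scheme \<Rightarrow> (nat \<Rightarrow> 'a) \<Rightarrow> ogform \<Rightarrow> bool" where
  "fsat G e (FEq s t) \<longleftrightarrow> tval G e s = tval G e t"
| "fsat G e (FLe s t) \<longleftrightarrow> ole G (tval G e s) (tval G e t)"
| "fsat G e (FNot \<phi>) \<longleftrightarrow> \<not> fsat G e \<phi>"
| "fsat G e (FAnd \<phi> \<psi>) \<longleftrightarrow> fsat G e \<phi> \<and> fsat G e \<psi>"
| "fsat G e (FAll i \<phi>) \<longleftrightarrow> (\<forall>a\<in>carrier G. fsat G (e(i := a)) \<phi>)"

text \<open>The truth of a sentence does not depend on the assignment; the constant one is used.\<close>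

definition elem_equiv :: "('a, 'm) ogroup_scheme \<Rightarrow> ('b, 'n) ogroup_scheme \<Rightarrow> bool" where
  "elem_equiv G H \<longleftrightarrow>
     (\<forall>\<phi>. ffree \<phi> = {} \<longrightarrow> (fsat G (\<lambda>_. \<one>\<^bsub>G\<^esub>) \<phi> \<longleftrightarrow> fsat H (\<lambda>_. \<one>\<^bsub>H\<^esub>) \<phi>))"


section \<open>Valued fields\<close>

text \<open>The set \<open>\<Gamma> \<union> {\<infinity>}\<close> is modelled by the option type, with \<open>None\<close> as \<open>\<infinity>\<close>.\<close>

fun vplus :: "('g, 'm) ogroup_scheme \<Rightarrow> 'g option \<Rightarrow> 'g option \<Rightarrow> 'g option" where
  "vplus G (Some a) (Some b) = Some (a \<otimes>\<^bsub>G\<^esub> b)"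
| "vplus G _ _ = None"

fun vle :: "('g, 'm) ogroup_scheme \<Rightarrow> 'g option \<Rightarrow> 'g option \<Rightarrow> bool" where
  "vle G _ None \<longleftrightarrow> True"
| "vle G None (Some b) \<longleftrightarrow> False"
| "vle G (Some a) (Some b) \<longleftrightarrow> ole G a b"

definition vless :: "('g, 'm) ogroup_scheme \<Rightarrow> 'g option \<Rightarrow> 'g option \<Rightarrow> bool" where
  "vless G a b \<longleftrightarrow> vle G a b \<and> a \<noteq> b"

definition vmin :: "('g, 'm) ogroup_scheme \<Rightarrow> 'g option \<Rightarrow> 'g option \<Rightarrow> 'g option" where
  "vmin G a b = (if vle G a b then a else b)"

locale valued_field = K: field K + G: ordered_abelian_group \<Gamma>
  for K :: "('a, 'k) ring_scheme" and \<Gamma> :: "('g, 'm) ogroup_scheme" +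
  fixes v :: "'a \<Rightarrow> 'g option"
  assumes v_surj: "v ` carrier K = insert None (Some ` carrier \<Gamma>)"
    and v_infinity: "x \<in> carrier K \<Longrightarrow> v x = None \<longleftrightarrow> x = \<zero>\<^bsub>K\<^esub>"
    and v_mult:
      "\<lbrakk> x \<in> carrier K; y \<in> carrier K \<rbrakk> \<Longrightarrow> v (x \<otimes>\<^bsub>K\<^esub> y) = vplus \<Gamma> (v x) (v y)"
    and v_add:
      "\<lbrakk> x \<in> carrier K; y \<in> carrier K \<rbrakk> \<Longrightarrow> vle \<Gamma> (vmin \<Gamma> (v x) (v y)) (v (x \<oplus>\<^bsub>K\<^esub> y))"

text \<open>The valuation as a function into the natural numbers: \<open>\<infinity>\<close> is coded by \<open>0\<close> and the
  value \<open>g\<close> by \<open>g + 1\<close>.\<close>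

definition code_value :: "nat option \<Rightarrow> nat" where
  "code_value a = (case a of None \<Rightarrow> 0 | Some g \<Rightarrow> Suc g)"

definition computable_valued_field :: "nat ring \<Rightarrow> nat ogroup \<Rightarrow> (nat \<Rightarrow> nat option) \<Rightarrow> bool" where
  "computable_valued_field K \<Gamma> v \<longleftrightarrow> valued_field K \<Gamma> v \<and>
     computable_set (carrier K) \<and> computable_op (carrier K) (add K) \<and>
     computable_op (carrier K) (monoid.mult K) \<and> computable_ogroup \<Gamma> \<and>
     computable_fun (carrier K) (\<lambda>x. code_value (v x))"

definition vf_embedding ::
  "('a, 'k) ring_scheme \<Rightarrow> ('g, 'm) ogroup_scheme \<Rightarrow> ('a \<Rightarrow> 'g option) \<Rightarrow>
   ('b, 'l) ring_scheme \<Rightarrow> ('h, 'n) ogroup_scheme \<Rightarrow> ('b \<Rightarrow> 'h option) \<Rightarrow> ('a \<Rightarrow> 'b) \<Rightarrow> bool" where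
  "vf_embedding K \<Gamma> v L \<Delta> w f \<longleftrightarrow> f \<in> ring_hom K L \<and>
     (\<exists>g\<in>hom \<Gamma> \<Delta>. (\<forall>a\<in>carrier \<Gamma>. \<forall>b\<in>carrier \<Gamma>. ole \<Gamma> a b \<longleftrightarrow> ole \<Delta> (g a) (g b)) \<and>
        (\<forall>x\<in>carrier K. w (f x) = map_option g (v x)))"

definition valuation_ring ::
  "('a, 'k) ring_scheme \<Rightarrow> ('g, 'm) ogroup_scheme \<Rightarrow> ('a \<Rightarrow> 'g option) \<Rightarrow> ('a, 'k) ring_scheme" where
  "valuation_ring K \<Gamma> v = K \<lparr> carrier := {x \<in> carrier K. vle \<Gamma> (Some \<one>\<^bsub>\<Gamma>\<^esub>) (v x)} \<rparr>"

definition valuation_ideal ::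
  "('a, 'k) ring_scheme \<Rightarrow> ('g, 'm) ogroup_scheme \<Rightarrow> ('a \<Rightarrow> 'g option) \<Rightarrow> 'a set" where
  "valuation_ideal K \<Gamma> v = {x \<in> carrier K. vless \<Gamma> (Some \<one>\<^bsub>\<Gamma>\<^esub>) (v x)}"

definition residue_field ::
  "('a, 'k) ring_scheme \<Rightarrow> ('g, 'm) ogroup_scheme \<Rightarrow> ('a \<Rightarrow> 'g option) \<Rightarrow> 'a set ring" where
  "residue_field K \<Gamma> v = valuation_ring K \<Gamma> v Quot valuation_ideal K \<Gamma> v"

text \<open>Formal derivative of a polynomial given, as in HOL-Algebra, by its list of coefficients
  with the leading one first. The result need not be normalised, which is irrelevant for
  evaluation.\<close>

fun poly_deriv :: "('a, 'k) ring_scheme \<Rightarrow> 'a list \<Rightarrow> 'a list" where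
  "poly_deriv R [] = []"
| "poly_deriv R [a] = []"
| "poly_deriv R (a # b # q) = ([length (b # q)] \<cdot>\<^bsub>R\<^esub> a) # poly_deriv R (b # q)"

definition henselian ::
  "('a, 'k) ring_scheme \<Rightarrow> ('g, 'm) ogroup_scheme \<Rightarrow> ('a \<Rightarrow> 'g option) \<Rightarrow> bool" where
  "henselian K \<Gamma> v \<longleftrightarrow>
     (\<forall>q \<in> carrier (poly_ring (valuation_ring K \<Gamma> v)). \<forall>a \<in> carrier (valuation_ring K \<Gamma> v).
        vless \<Gamma> (Some \<one>\<^bsub>\<Gamma>\<^esub>) (v (ring.eval K q a)) \<and>
        v (ring.eval K (poly_deriv K q) a) = Some \<one>\<^bsub>\<Gamma>\<^esub> \<longrightarrow>
        (\<exists>b \<in> carrier (valuation_ring K \<Gamma> v). ring.eval K q b = \<zero>\<^bsub>K\<^esub> \<and>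
           vless \<Gamma> (Some \<one>\<^bsub>\<Gamma>\<^esub>) (v (b \<ominus>\<^bsub>K\<^esub> a))))"


section \<open>Formally \<open>p\<close>-adic fields and \<open>p\<close>-adic closures\<close>

definition rat_field :: "rat ring" where
  "rat_field = \<lparr> carrier = UNIV, monoid.mult = (*), one = 1, ring.zero = 0, ring.add = (+) \<rparr>"

definition padic_val :: "nat \<Rightarrow> rat \<Rightarrow> int option" where
  "padic_val p x = (if x = 0 then None else
     Some (int (multiplicity (int p) (fst (quotient_of x))) -
           int (multiplicity (int p) (snd (quotient_of x)))))"

definition formally_padic ::
  "nat \<Rightarrow> ('a, 'k) ring_scheme \<Rightarrow> ('g, 'm) ogroup_scheme \<Rightarrow> ('a \<Rightarrow> 'g option) \<Rightarrow> bool" where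
  "formally_padic p K \<Gamma> v \<longleftrightarrow> valued_field K \<Gamma> v \<and>
     (\<exists>i. vf_embedding rat_field int_ogroup (padic_val p) K \<Gamma> v i) \<and>
     residue_field K \<Gamma> v \<simeq> ZFact (int p) \<and>
     (\<exists>g\<in>carrier \<Gamma>. v ([p] \<cdot>\<^bsub>K\<^esub> \<one>\<^bsub>K\<^esub>) = Some g \<and> oless \<Gamma> \<one>\<^bsub>\<Gamma>\<^esub> g \<and>
        (\<forall>h\<in>carrier \<Gamma>. oless \<Gamma> \<one>\<^bsub>\<Gamma>\<^esub> h \<longrightarrow> ole \<Gamma> g h))"

definition padically_closed ::
  "nat \<Rightarrow> ('a, 'k) ring_scheme \<Rightarrow> ('g, 'm) ogroup_scheme \<Rightarrow> ('a \<Rightarrow> 'g option) \<Rightarrow> bool" where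
  "padically_closed p K \<Gamma> v \<longleftrightarrow>
     formally_padic p K \<Gamma> v \<and> henselian K \<Gamma> v \<and> elem_equiv \<Gamma> int_ogroup"

text \<open>\<open>(L, w)\<close> is a \<open>p\<close>-adic closure of \<open>(K, v)\<close> via the embedding \<open>f\<close>.\<close>

definition padic_closure ::
  "nat \<Rightarrow> ('a, 'k) ring_scheme \<Rightarrow> ('g, 'm) ogroup_scheme \<Rightarrow> ('a \<Rightarrow> 'g option) \<Rightarrow>
   ('b, 'l) ring_scheme \<Rightarrow> ('h, 'n) ogroup_scheme \<Rightarrow> ('b \<Rightarrow> 'h option) \<Rightarrow> ('a \<Rightarrow> 'b) \<Rightarrow> bool" where
  "padic_closure p K \<Gamma> v L \<Delta> w f \<longleftrightarrow>
     padically_closed p L \<Delta> w \<and> vf_embedding K \<Gamma> v L \<Delta> w f \<and>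
     (\<forall>x\<in>carrier L. ring.algebraic L (f ` carrier K) x)"

end

theory Submission
  imports Defs "HOL-Library.Nat_Bijection" "HOL-Number_Theory.Cong"
    "HOL-Computational_Algebra.Polynomial"
begin

text \<open>
  The obstruction lives in the value group. In a \<open>\<int>\<close>-group with least positive element \<open>\<pi>\<close> every
  value \<open>\<gamma>\<close> is congruent modulo \<open>n\<close> to exactly one of \<open>0, \<pi>, \<dots>, (n - 1) \<pi>\<close>, and if the group is
  computable, this residue is found by search, uniformly in \<open>n\<close>. So it suffices to find a computable
  formally \<open>p\<close>-adic field with an element \<open>t\<close> of infinite value whose residues modulo pairwise coprime
  numbers \<open>n\<^sub>0, n\<^sub>1, \<dots>\<close> are not all free: whenever the \<open>e\<close>-th program converges on \<open>e\<close>, a root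
  \<open>(t / p\<^sup>r)\<^bsup>1/n\<^sub>e\<^esup>\<close> is adjoined with \<open>r \<in> {0, 1}\<close> different from the output. A computable
  \<open>p\<close>-adic closure, under whatever embedding, would compute a function that differs from every
  total computable function.

  The field is realised inside the sequences of rational numbers modulo eventual equality. The element
  \<open>t\<close> is the sequence of powers \<open>p\<^sup>m\<close>, where the exponents \<open>m\<close> grow very fast and satisfy more and
  more of the required congruences, so that the roots are again sequences of powers of \<open>p\<close>. Field
  axioms, the ultrametric inequality and the residue field are then inherited from \<open>\<rat>\<close>, and the fast
  growth makes the eventual comparison of \<open>p\<close>-adic orders decidable.
\<close>

section \<open>Recursive functions\<close>

text \<open>Requirements are indexed by halting derivations \<open>d\<close> rather than by
  programs, because \<open>V d\<close> is decidable while halting is not. So every index names a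
  generator from the outset: the required root if \<open>V d\<close> holds, the constant sequence 1
  otherwise. The moduli are Fermat numbers, a computable pairwise coprime family, so the Chinese
  remainder theorem meets all requirements found so far at once; they exceed 2, so 0 and 1 are
  distinct residues. The obstacle is that equality and comparison of values must be decidable
  although later requirements keep shaping the exponents of \<open>t\<close>. Past stage
  \<open>n\<close>, every tree with code at most \<open>n\<close> is a quotient of two fixed integer
  polynomials evaluated at one power \<open>p ^ k\<close>, \<open>k = scale_exp n j\<close>. Once
  \<open>p ^ k\<close> exceeds the \<open>l1_norm\<close> of a nonzero polynomial, the order of its
  value is \<open>i * k + m\<close> with \<open>m < k\<close>, where \<open>i\<close> is the degree
  of its lowest nonzero term and \<open>m\<close> the order of the coefficient there. Comparison is
  then lexicographic in \<open>(i, m)\<close>, hence the same at all later stages, and a single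
  stage decides it.\<close>

text \<open>The arguments \<open>x\<^sub>0, x\<^sub>1, \<dots>\<close> of a function are written \<open>hd e\<close>, \<open>hd (tl e)\<close>, \<dots> of one list
  \<open>e\<close>. Bounded quantifiers and \<open>LEAST\<close> push the bound variable onto this list, so that the rules
  \<open>rec_intro\<close> prove computability by following the syntax.\<close>

definition rec_fun :: "nat \<Rightarrow> (nat list \<Rightarrow> nat) \<Rightarrow> bool" where
  "rec_fun n F \<longleftrightarrow> (\<exists>r. \<forall>xs. length xs = n \<longrightarrow> reval r xs (F xs))"

definition rec_pred :: "nat \<Rightarrow> (nat list \<Rightarrow> bool) \<Rightarrow> bool" where
  "rec_pred n P \<longleftrightarrow> rec_fun n (\<lambda>e. if P e then 1 else 0)"

named_theorems rec_intro

lemma rec_cong: "(\<And>e. length e = n \<Longrightarrow> F e = G e) \<Longrightarrow> rec_fun n F \<longleftrightarrow> rec_fun n G"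
  unfolding rec_fun_def by (metis (full_types))

lemma rec_transfer: "rec_fun n F \<Longrightarrow> (\<And>e. length e = n \<Longrightarrow> F e = G e) \<Longrightarrow> rec_fun n G"
  using rec_cong[of n F G] by metis

lemma rec_nth: "i < n \<Longrightarrow> rec_fun n (\<lambda>e. e ! i)"
  unfolding rec_fun_def by (rule exI[of _ "Proj i"]) (auto intro: reval.Proj)

lemma rec_hd_drop: "i < n \<Longrightarrow> rec_fun n (\<lambda>e. hd (drop i e))"
  by (subst rec_cong[where G = "\<lambda>e. e ! i"]) (auto simp: hd_drop_conv_nth intro: rec_nth)

lemma rec_var [rec_intro]:
  "0 < n \<Longrightarrow> rec_fun n (\<lambda>e. hd e)"
  "1 < n \<Longrightarrow> rec_fun n (\<lambda>e. hd (tl e))"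
  "2 < n \<Longrightarrow> rec_fun n (\<lambda>e. hd (tl (tl e)))"
  "3 < n \<Longrightarrow> rec_fun n (\<lambda>e. hd (tl (tl (tl e))))"
  "4 < n \<Longrightarrow> rec_fun n (\<lambda>e. hd (tl (tl (tl (tl e)))))"
  "5 < n \<Longrightarrow> rec_fun n (\<lambda>e. hd (tl (tl (tl (tl (tl e))))))"
  using rec_hd_drop[of 0 n] rec_hd_drop[of 1 n] rec_hd_drop[of 2 n] rec_hd_drop[of 3 n]
    rec_hd_drop[of 4 n] rec_hd_drop[of 5 n]
  by (simp_all add: drop_Suc eval_nat_numeral)

lemma rec_comp:
  assumes "rec_fun k F" "length Gs = k" "\<And>G. G \<in> set Gs \<Longrightarrow> rec_fun n G"
  shows "rec_fun n (\<lambda>e. F (map (\<lambda>G. G e) Gs))"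
proof -
  obtain r where r: "\<And>xs. length xs = k \<Longrightarrow> reval r xs (F xs)"
    using assms(1) unfolding rec_fun_def by blast
  have "\<exists>g. \<forall>G\<in>set Gs. \<forall>xs. length xs = n \<longrightarrow> reval (g G) xs (G xs)"
    using assms(3) unfolding rec_fun_def by metis
  then obtain g where g: "\<And>G xs. G \<in> set Gs \<Longrightarrow> length xs = n \<Longrightarrow> reval (g G) xs (G xs)"
    by blast
  have "reval (Comp r (map g Gs)) xs (F (map (\<lambda>G. G xs) Gs))" if "length xs = n" for xs
    using that assms(2)
    by (intro reval.Comp[where ys = "map (\<lambda>G. G xs) Gs"] r)
       (auto simp: list_all2_conv_all_nth intro: g)
  then show ?thesis unfolding rec_fun_def by blast
qed

lemma rec_lift1:
  assumes "rec_fun 1 (\<lambda>e. f (hd e))" "rec_fun n A" shows "rec_fun n (\<lambda>e. f (A e))"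
  using rec_comp[OF assms(1), of "[A]" n] assms by auto

lemma rec_lift2:
  assumes "rec_fun 2 (\<lambda>e. f (hd e) (hd (tl e)))" "rec_fun n A" "rec_fun n B"
    shows "rec_fun n (\<lambda>e. f (A e) (B e))"
  using rec_comp[OF assms(1), of "[A, B]" n] assms by auto

lemma rec_lift3:
  assumes "rec_fun 3 (\<lambda>e. f (hd e) (hd (tl e)) (hd (tl (tl e))))" "rec_fun n A" "rec_fun n B"
    "rec_fun n C"
  shows "rec_fun n (\<lambda>e. f (A e) (B e) (C e))"
  using rec_comp[OF assms(1), of "[A, B, C]" n] assms by auto

lemma rec_pred_lift1:
  assumes "rec_pred 1 (\<lambda>e. f (hd e))" "rec_fun n A" shows "rec_pred n (\<lambda>e. f (A e))"
  using assms unfolding rec_pred_def by (rule rec_lift1)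

lemma rec_pred_lift2:
  assumes "rec_pred 2 (\<lambda>e. f (hd e) (hd (tl e)))" "rec_fun n A" "rec_fun n B"
    shows "rec_pred n (\<lambda>e. f (A e) (B e))"
  using assms unfolding rec_pred_def by (rule rec_lift2)

lemma rec_pred_lift3:
  assumes "rec_pred 3 (\<lambda>e. f (hd e) (hd (tl e)) (hd (tl (tl e))))" "rec_fun n A" "rec_fun n B"
    "rec_fun n C"
  shows "rec_pred n (\<lambda>e. f (A e) (B e) (C e))"
  using assms unfolding rec_pred_def by (rule rec_lift3)

lemma rec_Suc [rec_intro]: assumes "rec_fun n A" shows "rec_fun n (\<lambda>e. Suc (A e))"
proof (rule rec_lift1[where f = "Suc", OF _ assms])
  have "reval Sc xs (Suc (hd xs))" if "length xs = 1" for xs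
    using that by (cases xs) (auto intro: reval.Sc)
  then show "rec_fun 1 (\<lambda>e. Suc (hd e))" unfolding rec_fun_def by blast
qed

lemma rec_const [rec_intro]: "rec_fun n (\<lambda>e. c)"
proof (induction c)
  case 0
  show ?case unfolding rec_fun_def using reval.Zr by blast
next
  case (Suc c)
  then show ?case by (rule rec_Suc)
qed

lemma rec_primrec:
  assumes F: "rec_fun n F" and G: "rec_fun (Suc (Suc n)) (\<lambda>e. G (hd e) (hd (tl e)) (tl (tl e)))"
    and f0: "\<And>xs. length xs = n \<Longrightarrow> f 0 xs = F xs"
    and fS: "\<And>k xs. length xs = n \<Longrightarrow> f (Suc k) xs = G k (f k xs) xs"
  shows "rec_fun (Suc n) (\<lambda>e. f (hd e) (tl e))"
proof -
  obtain r s where r: "\<And>xs. length xs = n \<Longrightarrow> reval r xs (F xs)"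
    and s: "\<And>xs. length xs = Suc (Suc n) \<Longrightarrow> reval s xs (G (hd xs) (hd (tl xs)) (tl (tl xs)))"
    using F G unfolding rec_fun_def by blast
  have main: "reval (PrimRec r s) (k # xs) (f k xs)" if "length xs = n" for k xs
  proof (induction k)
    case 0
    then show ?case using that by (auto simp: f0 intro: reval.PrimRec0 r)
  next
    case (Suc k)
    then show ?case using that s[of "k # f k xs # xs"]
      by (auto simp: fS intro: reval.PrimRecS)
  qed
  have "reval (PrimRec r s) xs (f (hd xs) (tl xs))" if "length xs = Suc n" for xs
    using that main[of "tl xs" "hd xs"] by (cases xs) auto
  then show ?thesis unfolding rec_fun_def by blast
qed

lemma rec_pred: "rec_fun 1 (\<lambda>e. hd e - 1)"
  using rec_primrec[of 0 "\<lambda>_. 0" "\<lambda>k y xs. k" "\<lambda>k xs. k - 1"] by (auto intro!: rec_intro)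

lemma rec_add [rec_intro]: assumes "rec_fun n A" "rec_fun n B" shows "rec_fun n (\<lambda>e. A e + B e)"
proof (rule rec_lift2[where f = "(+)"])
  have "rec_fun (Suc 1) (\<lambda>e. hd e + hd (tl e))"
    by (rule rec_primrec[where F = hd and G = "\<lambda>k y xs. Suc y" and f = "\<lambda>k xs. k + hd xs"])
       (auto intro!: rec_intro)
  then show "rec_fun 2 (\<lambda>e. hd e + hd (tl e))" by (simp add: numeral_2_eq_2)
qed (use assms in auto)

lemma rec_diff [rec_intro]: assumes "rec_fun n A" "rec_fun n B" shows "rec_fun n (\<lambda>e. A e - B e)"
proof (rule rec_lift2[where f = "\<lambda>b a. a - b"])
  have "rec_fun (Suc 1) (\<lambda>e. hd (tl e) - hd e)"
    by (rule rec_primrec[where F = hd and G = "\<lambda>k y xs. y - 1" and f = "\<lambda>k xs. hd xs - k"])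
       (auto intro!: rec_intro rec_lift1[OF rec_pred, simplified])
  then show "rec_fun 2 (\<lambda>e. hd (tl e) - hd e)" by (simp add: numeral_2_eq_2)
qed (use assms in auto)

lemma rec_mult [rec_intro]: assumes "rec_fun n A" "rec_fun n B" shows "rec_fun n (\<lambda>e. A e * B e)"
proof (rule rec_lift2[where f = "(*)"])
  have "rec_fun (Suc 1) (\<lambda>e. hd e * hd (tl e))"
    by (rule rec_primrec[where F = "\<lambda>_. 0" and G = "\<lambda>k y xs. hd xs + y" and f = "\<lambda>k xs. k * hd xs"])
       (auto intro!: rec_intro)
  then show "rec_fun 2 (\<lambda>e. hd e * hd (tl e))" by (simp add: numeral_2_eq_2)
qed (use assms in auto)

lemma rec_power [rec_intro]: assumes "rec_fun n A" "rec_fun n B" shows "rec_fun n (\<lambda>e. A e ^ B e)"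
proof (rule rec_lift2[where f = "\<lambda>b a. a ^ b"])
  have "rec_fun (Suc 1) (\<lambda>e. hd (tl e) ^ hd e)"
    by (rule rec_primrec[where F = "\<lambda>_. 1" and G = "\<lambda>k y xs. hd xs * y" and f = "\<lambda>k xs. hd xs ^ k"])
       (auto intro!: rec_intro)
  then show "rec_fun 2 (\<lambda>e. hd (tl e) ^ hd e)" by (simp add: numeral_2_eq_2)
qed (use assms in auto)

lemma rec_pred_le [rec_intro]: assumes "rec_fun n A" "rec_fun n B"
  shows "rec_pred n (\<lambda>e. A e \<le> B e)"
proof -
  have "rec_fun n (\<lambda>e. 1 - (A e - B e))" using assms by (auto intro!: rec_intro)
  then show ?thesis unfolding rec_pred_def by (rule back_subst[of "rec_fun n"]) auto
qed

lemma rec_pred_not [rec_intro]: assumes "rec_pred n P" shows "rec_pred n (\<lambda>e. \<not> P e)"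
proof -
  have "rec_fun n (\<lambda>e. 1 - (if P e then 1 else 0))"
    using assms unfolding rec_pred_def by (intro rec_intro)
  then show ?thesis unfolding rec_pred_def by (rule back_subst[of "rec_fun n"]) auto
qed

lemma rec_pred_and [rec_intro]: assumes "rec_pred n P" "rec_pred n Q"
  shows "rec_pred n (\<lambda>e. P e \<and> Q e)"
proof -
  have "rec_fun n (\<lambda>e. (if P e then 1 else 0) * (if Q e then 1 else 0))"
    using assms unfolding rec_pred_def by (intro rec_intro)
  then show ?thesis unfolding rec_pred_def by (rule back_subst[of "rec_fun n"]) auto
qed

lemma rec_pred_or [rec_intro]:
  assumes "rec_pred n P" "rec_pred n Q" shows "rec_pred n (\<lambda>e. P e \<or> Q e)"
proof -
  have "rec_pred n (\<lambda>e. \<not> (\<not> P e \<and> \<not> Q e))" using assms by (intro rec_pred_not rec_pred_and)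
  then show ?thesis by simp
qed

lemma rec_pred_imp [rec_intro]:
  assumes "rec_pred n P" "rec_pred n Q" shows "rec_pred n (\<lambda>e. P e \<longrightarrow> Q e)"
proof -
  have "rec_pred n (\<lambda>e. \<not> P e \<or> Q e)" using assms by (intro rec_pred_not rec_pred_or)
  then show ?thesis by simp
qed

lemma rec_pred_less [rec_intro]:
  assumes "rec_fun n A" "rec_fun n B" shows "rec_pred n (\<lambda>e. A e < B e)"
proof -
  have "rec_pred n (\<lambda>e. \<not> B e \<le> A e)" using assms by (intro rec_pred_not rec_pred_le)
  then show ?thesis by (simp add: not_le)
qed

lemma rec_pred_eq [rec_intro]:
  assumes "rec_fun n A" "rec_fun n B" shows "rec_pred n (\<lambda>e. A e = B e)"
proof -
  have "rec_pred n (\<lambda>e. A e \<le> B e \<and> B e \<le> A e)" using assms by (intro rec_pred_and rec_pred_le)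
  then show ?thesis by (simp add: order_eq_iff)
qed

lemma rec_pred_iff [rec_intro]:
  assumes "rec_pred n P" "rec_pred n Q" shows "rec_pred n (\<lambda>e. P e \<longleftrightarrow> Q e)"
proof -
  have "rec_pred n (\<lambda>e. (P e \<longrightarrow> Q e) \<and> (Q e \<longrightarrow> P e))" using assms by (intro rec_pred_and rec_pred_imp)
  then show ?thesis by (simp only: iff_conv_conj_imp)
qed

lemma rec_if [rec_intro]:
  assumes "rec_pred n P" "rec_fun n A" "rec_fun n B"
    shows "rec_fun n (\<lambda>e. if P e then A e else B e)"
proof -
  have "rec_fun n (\<lambda>e. (if P e then 1 else 0) * A e + (1 - (if P e then 1 else 0)) * B e)"
    using assms unfolding rec_pred_def by (intro rec_intro)
  then show ?thesis by (rule back_subst[of "rec_fun n"]) auto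
qed

text \<open>Substitutes a term for the innermost bound variable: the argument list is rebuilt from
  that term and all projections, and composition applies.\<close>

lemma rec_Cons:
  assumes "rec_fun (Suc n) F" "rec_fun n B" shows "rec_fun n (\<lambda>e. F (B e # e))"
proof -
  have "rec_fun n (\<lambda>e. F (map (\<lambda>G. G e) (B # map (\<lambda>i e. e ! i) [0..<n])))"
    using assms by (intro rec_comp[of "Suc n" F]) (auto intro: rec_nth)
  moreover have "F (map (\<lambda>G. G e) (B # map (\<lambda>i e. e ! i) [0..<n])) = F (B e # e)"
    if "length e = n" for e
    using that map_nth[of e] by (simp add: comp_def)
  ultimately show ?thesis by (rule rec_transfer)
qed

text \<open>In \<open>rec_primrec\<close> the accumulator sits between the counter and the
  parameters; a part of the body that ignores it must skip the second entry.\<close>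

lemma rec_tl_tl:
  assumes "rec_fun (Suc n) (\<lambda>e. F (hd e) (tl e))"
  shows "rec_fun (Suc (Suc n)) (\<lambda>e. F (hd e) (tl (tl e)))"
proof -
  define H where "H = (\<lambda>e. F (hd e) (tl e))"
  define Gs :: "(nat list \<Rightarrow> nat) list"
    where "Gs = map (\<lambda>i e. e ! i) (0 # map (\<lambda>i. Suc (Suc i)) [0..<n])"
  have "rec_fun (Suc (Suc n)) (\<lambda>e. H (map (\<lambda>G. G e) Gs))"
    using assms by (intro rec_comp[of "Suc n" H]) (auto intro!: rec_nth simp: H_def Gs_def)
  moreover have "H (map (\<lambda>G. G e) Gs) = F (hd e) (tl (tl e))" if "length e = Suc (Suc n)" for e
  proof -
    obtain a b f where e: "e = a # b # f" "length f = n"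
      using \<open>length e = Suc (Suc n)\<close> by (metis length_Suc_conv)
    then show ?thesis using map_nth[of f] by (simp add: comp_def H_def Gs_def)
  qed
  ultimately show ?thesis by (rule rec_transfer)
qed

lemma rec_pred_ex_less [rec_intro]:
  assumes P: "rec_pred (Suc n) (\<lambda>e. P (hd e) (tl e))" and B: "rec_fun n B"
  shows "rec_pred n (\<lambda>e. \<exists>i<B e. P i e)"
proof -
  have "rec_fun (Suc n) (\<lambda>e. if \<exists>i<hd e. P i (tl e) then 1 else 0)"
  proof (rule rec_primrec[where F = "\<lambda>_. 0" and G = "\<lambda>k y xs. if P k xs then 1 else y"
        and f = "\<lambda>k xs. if \<exists>i<k. P i xs then 1 else 0"])
    show "rec_fun (Suc (Suc n)) (\<lambda>e. if P (hd e) (tl (tl e)) then 1 else hd (tl e))"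
      using rec_tl_tl[where F = "\<lambda>i e. if P i e then 1 else 0"] P
      by (intro rec_intro) (auto simp: rec_pred_def)
  qed (auto simp: less_Suc_eq intro: rec_const)
  from rec_Cons[OF this B] show ?thesis by (simp add: rec_pred_def)
qed

lemma rec_pred_all_less [rec_intro]:
  assumes "rec_pred (Suc n) (\<lambda>e. P (hd e) (tl e))" "rec_fun n B"
  shows "rec_pred n (\<lambda>e. \<forall>i<B e. P i e)"
proof -
  have "rec_pred n (\<lambda>e. \<not> (\<exists>i<B e. \<not> P i e))" using assms by (intro rec_pred_not rec_pred_ex_less)
  then show ?thesis by simp
qed

lemma rec_pred_ex_le [rec_intro]:
  assumes "rec_pred (Suc n) (\<lambda>e. P (hd e) (tl e))" "rec_fun n B"
  shows "rec_pred n (\<lambda>e. \<exists>i\<le>B e. P i e)"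
  using rec_pred_ex_less[OF assms(1) rec_Suc[OF assms(2)]] by (simp add: less_Suc_eq_le)

lemma rec_Least [rec_intro]:
  assumes P: "rec_pred (Suc n) (\<lambda>e. P (hd e) (tl e))" and ex: "\<And>e. length e = n \<Longrightarrow> \<exists>i. P i e"
  shows "rec_fun n (\<lambda>e. LEAST i. P i e)"
proof -
  \<comment> \<open>\<open>Mu\<close> searches for the value 0, hence the negated characteristic
    function.\<close>
  have "rec_fun (Suc n) (\<lambda>e. if \<not> P (hd e) (tl e) then 1 else 0)"
    using rec_pred_not[OF P] by (simp add: rec_pred_def)
  then obtain r where r: "\<And>xs. length xs = Suc n \<Longrightarrow>
    reval r xs (if \<not> P (hd xs) (tl xs) then 1 else 0)"
    unfolding rec_fun_def by blast
  have "reval (Mu r) xs (LEAST i. P i xs)" if "length xs = n" for xs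
  proof (rule reval.Mu)
    show "reval r ((LEAST i. P i xs) # xs) 0"
      using r[of "(LEAST i. P i xs) # xs"] LeastI_ex[OF ex[OF that]] that by simp
    show "\<forall>m<(LEAST i. P i xs). \<exists>y. reval r (m # xs) (Suc y)"
    proof (intro allI impI)
      fix m assume "m < (LEAST i. P i xs)"
      then have "\<not> P m xs" using not_less_Least by blast
      then have "reval r (m # xs) (Suc 0)" using r[of "m # xs"] that by simp
      then show "\<exists>y. reval r (m # xs) (Suc y)" by blast
    qed
  qed
  then show ?thesis unfolding rec_fun_def by blast
qed

lemma rec_div [rec_intro]: assumes "rec_fun n A" "rec_fun n B" shows "rec_fun n (\<lambda>e. A e div B e)"
proof (rule rec_lift2[where f = "(div)"])
  \<comment> \<open>The first disjunct gives 0 for a zero divisor, in agreement with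
    \<open>div\<close>, and keeps the search total.\<close>
  have "rec_fun 2 (\<lambda>e. LEAST q. hd (tl e) = 0 \<and> q = 0 \<or> hd e < Suc q * hd (tl e))"
  proof (intro rec_intro)
    fix e :: "nat list"
    show "\<exists>q. hd (tl e) = 0 \<and> q = 0 \<or> hd e < Suc q * hd (tl e)"
    proof (cases "hd (tl e) = 0")
      case False
      then have "hd e < Suc (hd e) * hd (tl e)"
        using mult_le_mono2[of 1 "hd (tl e)" "Suc (hd e)"] by simp
      then show ?thesis by blast
    qed simp
  qed auto
  moreover have "(LEAST q. b = 0 \<and> q = 0 \<or> a < Suc q * b) = a div b" for a b :: nat
  proof (rule Least_equality)
    show "b = 0 \<and> a div b = 0 \<or> a < Suc (a div b) * b"
      using dividend_less_div_times[of b a] by (cases "b = 0") (auto simp: mult.commute)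
    show "a div b \<le> q" if "b = 0 \<and> q = 0 \<or> a < Suc q * b" for q
    proof (cases "b = 0")
      case False
      then have "a < Suc q * b" using that by blast
      then have "a div b < Suc q" by (rule less_mult_imp_div_less)
      then show ?thesis by simp
    qed simp
  qed
  ultimately show "rec_fun 2 (\<lambda>e. hd e div hd (tl e))" by simp
qed (use assms in auto)

lemma rec_mod [rec_intro]:
  assumes "rec_fun n A" "rec_fun n B" shows "rec_fun n (\<lambda>e. A e mod B e)"
proof -
  have "rec_fun n (\<lambda>e. A e - A e div B e * B e)" using assms by (intro rec_intro)
  then show ?thesis by (simp add: minus_div_mult_eq_mod)
qed

lemma rec_pred_dvd [rec_intro]:
  assumes "rec_fun n A" "rec_fun n B" shows "rec_pred n (\<lambda>e. A e dvd B e)"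
proof -
  have "rec_pred n (\<lambda>e. B e mod A e = 0)" using assms by (intro rec_intro)
  then show ?thesis by (simp add: dvd_eq_mod_eq_0)
qed

section \<open>Pairing and coded sequences\<close>

abbreviation pair :: "nat \<Rightarrow> nat \<Rightarrow> nat" where "pair a b \<equiv> prod_encode (a, b)"
abbreviation pfst :: "nat \<Rightarrow> nat" where "pfst z \<equiv> fst (prod_decode z)"
abbreviation psnd :: "nat \<Rightarrow> nat" where "psnd z \<equiv> snd (prod_decode z)"

lemma rec_pr [rec_intro]: assumes "rec_fun n A" "rec_fun n B"
  shows "rec_fun n (\<lambda>e. pair (A e) (B e))"
proof -
  have "rec_fun n (\<lambda>e. (A e + B e) * Suc (A e + B e) div 2 + A e)"
    using assms by (intro rec_intro)
  then show ?thesis by (simp add: prod_encode_def triangle_def)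
qed

lemma pfst_psnd_le: "pfst z \<le> z" "psnd z \<le> z"
  using le_prod_encode_1[of "pfst z" "psnd z"] le_prod_encode_2[of "psnd z" "pfst z"] by simp_all

lemma rec_p1 [rec_intro]: assumes "rec_fun n A" shows "rec_fun n (\<lambda>e. pfst (A e))"
proof (rule rec_lift1[where f = "pfst", OF _ assms])
  have ex: "\<exists>b\<le>z. pair (pfst z) b = z" for z
    using pfst_psnd_le(2) by (intro exI[of _ "psnd z"]) simp
  have "rec_fun 1 (\<lambda>e. LEAST a. \<exists>b\<le>hd e. pair a b = hd e)"
    by (intro rec_intro) (use ex in \<open>blast | simp\<close>)+
  moreover have "(LEAST a. \<exists>b\<le>z. pair a b = z) = pfst z" for z
    using ex by (intro Least_equality) auto
  ultimately show "rec_fun 1 (\<lambda>e. pfst (hd e))" by simp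
qed

lemma rec_p2 [rec_intro]: assumes "rec_fun n A" shows "rec_fun n (\<lambda>e. psnd (A e))"
proof (rule rec_lift1[where f = "psnd", OF _ assms])
  have ex: "\<exists>a\<le>z. pair a (psnd z) = z" for z
    using pfst_psnd_le(1) by (intro exI[of _ "pfst z"]) simp
  have "rec_fun 1 (\<lambda>e. LEAST b. \<exists>a\<le>hd e. pair a b = hd e)"
    by (intro rec_intro) (use ex in \<open>blast | simp\<close>)+
  moreover have "(LEAST b. \<exists>a\<le>z. pair a b = z) = psnd z" for z
    using ex by (intro Least_equality) auto
  ultimately show "rec_fun 1 (\<lambda>e. psnd (hd e))" by simp
qed

text \<open>Only finitely many entries of such a sequence matter, so its length is not stored.\<close>

definition seq_nth :: "nat \<Rightarrow> nat \<Rightarrow> nat" where "seq_nth i S = pfst ((psnd ^^ i) S)"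

lemma seq_nth_simps: "seq_nth 0 S = pfst S" "seq_nth (Suc i) S = seq_nth i (psnd S)"
  by (simp_all add: seq_nth_def funpow_Suc_right del: funpow.simps)

lemma rec_sq [rec_intro]: assumes "rec_fun n A" "rec_fun n B"
  shows "rec_fun n (\<lambda>e. seq_nth (A e) (B e))"
proof (rule rec_lift2[where f = "seq_nth", OF _ assms])
  have "rec_fun (Suc 1) (\<lambda>e. (psnd ^^ hd e) (hd (tl e)))"
    by (rule rec_primrec[where F = hd and G = "\<lambda>k y xs. psnd y"
      and f = "\<lambda>k xs. (psnd ^^ k) (hd xs)"])
       (auto intro!: rec_intro)
  then show "rec_fun 2 (\<lambda>e. seq_nth (hd e) (hd (tl e)))"
    unfolding seq_nth_def by (intro rec_p1) (simp add: numeral_2_eq_2)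
qed

lemma seq_nth_exists: "\<exists>S. \<forall>i<length xs. seq_nth i S = xs ! i"
proof (induction xs)
  case (Cons x xs)
  then obtain S where "\<forall>i<length xs. seq_nth i S = xs ! i" by blast
  then show ?case by (intro exI[of _ "pair x S"]) (auto simp: less_Suc_eq_0_disj seq_nth_simps)
qed simp

text \<open>The history \<open>h\<close> lists the values at \<open>c - 1, \<dots>, 0\<close> in this order, so that it is extended at
  the front.\<close>

lemma rec_course_of_values:
  assumes G: "rec_fun 3 (\<lambda>e. G (hd e) (hd (tl e)) (hd (tl (tl e))))"
    and F: "\<And>c j h. (\<And>i. i < c \<Longrightarrow> seq_nth (c - 1 - i) h = F i j) \<Longrightarrow> F c j = G c h j"
  shows "rec_fun 2 (\<lambda>e. F (hd e) (hd (tl e)))"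
proof -
  define H where "H = (\<lambda>c j. rec_nat 0 (\<lambda>i h. pair (F i j) h) c)"
  have H: "H 0 j = 0" "H (Suc c) j = pair (F c j) (H c j)" for c j by (simp_all add: H_def)
  have sqH: "seq_nth (c - 1 - i) (H c j) = F i j" if "i < c" for i c j
    using that
  proof (induction c)
    case (Suc c)
    show ?case
    proof (cases "i = c")
      case False
      then have "c - i = Suc (c - 1 - i)" using Suc.prems by simp
      then show ?thesis using False Suc by (simp add: H seq_nth_simps)
    qed (simp add: H seq_nth_simps)
  qed simp
  have "rec_fun (Suc 1) (\<lambda>e. H (hd e) (hd (tl e)))"
  proof (rule rec_primrec[where F = "\<lambda>_. 0" and G = "\<lambda>k y xs. pair (G k y (hd xs)) y"
        and f = "\<lambda>k xs. H k (hd xs)"])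
    show "H (Suc k) (hd xs) = pair (G k (H k (hd xs)) (hd xs)) (H k (hd xs))" for k xs
      using F[of k "H k (hd xs)" "hd xs"] sqH by (simp add: H)
  qed (auto intro!: rec_intro rec_lift3[where f = G] G simp: H)
  then have "rec_fun 2 (\<lambda>e. H (hd e) (hd (tl e)))" by (simp add: numeral_2_eq_2)
  from rec_p1[OF rec_lift2[OF this rec_Suc], of 2 hd "\<lambda>e. hd (tl e)"]
  show ?thesis by (simp add: H rec_var)
qed

section \<open>Recursively inseparable requirements\<close>

fun rcode :: "recf \<Rightarrow> nat" where
  "rcode Zr = pair 0 0"
| "rcode Sc = pair 1 0"
| "rcode (Proj i) = pair 2 i"
| "rcode (Comp f gs) = pair 3 (pair (rcode f) (list_encode (map rcode gs)))"
| "rcode (PrimRec f g) = pair 4 (pair (rcode f) (rcode g))"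
| "rcode (Mu f) = pair 5 (rcode f)"

inductive_cases reval_ZrE: "reval Zr xs y"
  and reval_ScE: "reval Sc xs y"
  and reval_ProjE: "reval (Proj i) xs y"
  and reval_CompE: "reval (Comp f gs) xs y"
  and reval_PrimRec0E: "reval (PrimRec f g) (0 # xs) y"
  and reval_PrimRecSE: "reval (PrimRec f g) (Suc n # xs) y"
  and reval_MuE: "reval (Mu f) xs y"

lemma reval_deterministic: "reval r xs y \<Longrightarrow> reval r xs z \<Longrightarrow> y = z"
proof (induction arbitrary: z rule: reval.induct)
  case (Comp xs gs ys f y)
  from Comp.prems obtain ys' where ys': "list_all2 (\<lambda>g y. reval g xs y) gs ys'" "reval f ys' z"
    by (rule reval_CompE)
  have "ys = ys'"
    using Comp.hyps(1) Comp.IH ys'(1) by (auto simp: list_all2_conv_all_nth list_eq_iff_nth_eq)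
  then show ?case using Comp.IH ys'(2) by blast
next
  case (PrimRecS f g n xs y w)
  from PrimRecS.prems show ?case
    by (rule reval_PrimRecSE) (use PrimRecS.IH in blast)
next
  case (Mu f n xs)
  from Mu.prems have z: "reval f (z # xs) 0" "\<forall>m<z. \<exists>y. reval f (m # xs) (Suc y)"
    by (auto elim: reval_MuE)
  show ?case
  \<comment> \<open>The larger candidate would force \<open>f\<close> to return a successor at the
    smaller one, where it returns 0.\<close>
  proof (rule linorder_cases[of n z])
    assume "n < z"
    then show ?thesis using z(2) Mu.IH(1) by fastforce
  next
    assume "z < n"
    then show ?thesis using z(1) Mu.IH(2) by fastforce
  qed
next
  case (Zr xs)
  then show ?case by (rule reval_ZrE) simp
next
  case (Sc x)
  then show ?case by (rule reval_ScE) simp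
next
  case (Proj i xs)
  from Proj.prems show ?case by (rule reval_ProjE) simp
next
  case (PrimRec0 f xs y g)
  from PrimRec0.prems show ?case by (rule reval_PrimRec0E) (use PrimRec0.IH in blast)
qed

section \<open>Codes of lists and checkable derivations\<close>

definition list_drop :: "nat \<Rightarrow> nat \<Rightarrow> nat" where "list_drop i l = ((\<lambda>l. psnd (l - 1)) ^^ i) l"
definition list_entry :: "nat \<Rightarrow> nat \<Rightarrow> nat" where "list_entry i l = pfst (list_drop i l - 1)"

text \<open>A nonempty list is coded by the successor of a pair, so \<open>psnd (l - 1)\<close> is
  its tail; at the code 0 of the empty list the same formula stays at 0.\<close>

lemma list_drop_list_encode: "list_drop i (list_encode xs) = list_encode (drop i xs)"
proof (induction i arbitrary: xs)
  case (Suc i)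
  have "psnd (list_encode xs - 1) = list_encode (tl xs)"
    using pfst_psnd_le(2)[of 0] by (cases xs) auto
  then show ?case
    using Suc[of "tl xs"] by (simp add: list_drop_def funpow_Suc_right drop_Suc del: funpow.simps)
qed (simp add: list_drop_def)

lemma list_encode_eq_0: "list_encode xs = 0 \<longleftrightarrow> xs = []"
  by (cases xs) auto

lemma list_drop_eq_0: "list_drop i (list_encode xs) = 0 \<longleftrightarrow> length xs \<le> i"
  by (simp add: list_drop_list_encode list_encode_eq_0)

lemma list_entry_list_encode: "i < length xs \<Longrightarrow> list_entry i (list_encode xs) = xs ! i"
  by (simp add: list_entry_def list_drop_list_encode Cons_nth_drop_Suc[symmetric])

lemma length_le_list_encode: "length xs \<le> list_encode xs"
proof (induction xs)
  case (Cons x xs)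
  then show ?case using le_prod_encode_2[of "list_encode xs" x] by simp
qed simp

lemma rec_dr [rec_intro]: assumes "rec_fun n A" "rec_fun n B"
  shows "rec_fun n (\<lambda>e. list_drop (A e) (B e))"
proof (rule rec_lift2[where f = list_drop, OF _ assms])
  have "rec_fun (Suc 1) (\<lambda>e. list_drop (hd e) (hd (tl e)))"
    by (rule rec_primrec[where F = hd and G = "\<lambda>k y xs. psnd (y - 1)"
      and f = "\<lambda>k xs. list_drop k (hd xs)"])
       (auto intro!: rec_intro simp: list_drop_def)
  then show "rec_fun 2 (\<lambda>e. list_drop (hd e) (hd (tl e)))" by (simp add: numeral_2_eq_2)
qed

lemma rec_ent [rec_intro]: assumes "rec_fun n A" "rec_fun n B"
  shows "rec_fun n (\<lambda>e. list_entry (A e) (B e))"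
  using assms unfolding list_entry_def by (intro rec_intro)

text \<open>\<open>judgement r l y\<close> says that the program with code \<open>r\<close>, applied to the list with code \<open>l\<close>,
  returns \<open>y\<close>, and \<open>just J j\<close> that \<open>j\<close> follows from members of \<open>J\<close> by one rule for \<open>reval\<close>. All
  quantifiers are bounded once \<open>J\<close> is a finite list, which makes derivations checkable.\<close>

definition judgement :: "nat \<Rightarrow> nat \<Rightarrow> nat \<Rightarrow> nat"
  where "judgement a b c = prod_encode (a, prod_encode (b, c))"

text \<open>The code of a list is at least its length, so the bound on \<open>i\<close> reaches
  every position of both lists and, if their lengths differ, the place where the shorter one
  ends.\<close>

definition just_comp :: "nat set \<Rightarrow> nat \<Rightarrow> nat \<Rightarrow> nat \<Rightarrow> bool" where
  "just_comp J a l y \<longleftrightarrow> (\<exists>j\<in>J. pfst j = pfst a \<and> psnd (psnd j) = y \<and>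
     (\<forall>i<psnd a + pfst (psnd j). (list_drop i (psnd a) = 0 \<longleftrightarrow> list_drop i (pfst (psnd j)) = 0) \<and>
        (list_drop i (psnd a) \<noteq> 0 \<longrightarrow> judgement (list_entry i (psnd a)) l (list_entry i (pfst
          (psnd j))) \<in> J)))"

text \<open>\<open>Suc (pair x l)\<close> codes the list with head \<open>x\<close> and tail code
  \<open>l\<close>. The result of the preceding recursion step is read off a member of
  \<open>J\<close>, which avoids an unbounded quantifier over it.\<close>

definition just_rec :: "nat set \<Rightarrow> nat \<Rightarrow> nat \<Rightarrow> nat \<Rightarrow> nat \<Rightarrow> bool" where
  "just_rec J r a l y \<longleftrightarrow> l \<noteq> 0 \<and>
     (list_entry 0 l = 0 \<and> judgement (pfst a) (list_drop 1 l) y \<in> J \<or>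
      list_entry 0 l \<noteq> 0 \<and> (\<exists>j\<in>J. pfst j = r \<and> pfst (psnd j) = Suc (pair (list_entry 0 l - 1)
        (list_drop 1 l)) \<and>
        judgement (psnd a) (Suc (pair (list_entry 0 l - 1) (Suc (pair (psnd (psnd j))
          (list_drop 1 l))))) y \<in> J))"

definition just_mu :: "nat set \<Rightarrow> nat \<Rightarrow> nat \<Rightarrow> nat \<Rightarrow> bool" where
  "just_mu J a l y \<longleftrightarrow> judgement a (Suc (pair y l)) 0 \<in> J \<and>
     (\<forall>m<y. \<exists>j\<in>J. pfst j = a \<and> pfst (psnd j) = Suc (pair m l) \<and> psnd (psnd j) \<noteq> 0)"

definition just_eval :: "nat set \<Rightarrow> nat \<Rightarrow> nat \<Rightarrow> nat \<Rightarrow> bool" where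
  "just_eval J r l y \<longleftrightarrow>
     pfst r = 0 \<and> y = 0 \<or>
     pfst r = 1 \<and> l \<noteq> 0 \<and> list_drop 1 l = 0 \<and> y = Suc (list_entry 0 l) \<or>
     pfst r = 2 \<and> list_drop (psnd r) l \<noteq> 0 \<and> y = list_entry (psnd r) l \<or>
     pfst r = 3 \<and> just_comp J (psnd r) l y \<or>
     pfst r = 4 \<and> just_rec J r (psnd r) l y \<or>
     pfst r = 5 \<and> just_mu J (psnd r) l y"

definition just :: "nat set \<Rightarrow> nat \<Rightarrow> bool" where
  "just J j \<longleftrightarrow> just_eval J (pfst j) (pfst (psnd j)) (psnd (psnd j))"

lemma just_judgement: "just J (judgement r l y) \<longleftrightarrow> just_eval J r l y"
  by (simp add: just_def judgement_def)

lemma judgement_sel: "pfst (judgement r l y) = r" "pfst (psnd (judgement r l y)) = l"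
  "psnd (psnd (judgement r l y)) = y"
  by (simp_all add: judgement_def)

text \<open>\<open>J\<close> occurs only positively in the rules; this lets derivations be
  concatenated and extended.\<close>

lemma just_mono: "just J j \<Longrightarrow> J \<subseteq> Y \<Longrightarrow> just Y j"
  unfolding just_def just_eval_def just_comp_def just_rec_def just_mu_def
  by (elim disj_forward conj_forward; blast)

definition valid :: "nat list \<Rightarrow> bool" where
  "valid ds \<longleftrightarrow> (\<forall>i<length ds. just (set (take i ds)) (ds ! i))"

lemma valid_append:
  assumes "valid ds" "valid ds'" shows "valid (ds @ ds')"
  unfolding valid_def
proof (intro allI impI)
  fix i assume i: "i < length (ds @ ds')"
  show "just (set (take i (ds @ ds'))) ((ds @ ds') ! i)"
  proof (cases "i < length ds")
    case False
    then have "just (set (take (i - length ds) ds')) (ds' ! (i - length ds))"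
      using assms(2) i by (auto simp: valid_def)
    then show ?thesis using False by (auto simp: nth_append intro: just_mono)
  qed (use assms(1) in \<open>auto simp: valid_def nth_append\<close>)
qed

lemma valid_snoc: "valid ds \<Longrightarrow> just (set ds) j \<Longrightarrow> valid (ds @ [j])"
  by (auto simp: valid_def nth_append less_Suc_eq)

definition derivable :: "nat \<Rightarrow> bool" where "derivable j \<longleftrightarrow> (\<exists>ds. valid ds \<and> j \<in> set ds)"

lemma derivable_finite:
  assumes "finite J" "\<And>j. j \<in> J \<Longrightarrow> derivable j"
  shows "\<exists>ds. valid ds \<and> J \<subseteq> set ds"
  using assms
proof (induction J)
  case empty
  then show ?case by (auto simp: valid_def intro: exI[of _ "[]"])
next
  case (insert x J)
  then obtain ds ds' where "valid ds" "J \<subseteq> set ds" "valid ds'" "x \<in> set ds'"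
    unfolding derivable_def by blast
  then show ?case by (intro exI[of _ "ds @ ds'"]) (auto intro: valid_append)
qed

lemma derivableI:
  assumes "finite J" "\<And>j. j \<in> J \<Longrightarrow> derivable j" "just J j"
  shows "derivable j"
proof -
  obtain ds where "valid ds" "J \<subseteq> set ds" using derivable_finite assms by blast
  then have "valid (ds @ [j])" using assms(3) by (auto intro: valid_snoc just_mono)
  then show ?thesis unfolding derivable_def by (intro exI[of _ "ds @ [j]"]) auto
qed

definition eval_code :: "recf \<Rightarrow> nat list \<Rightarrow> nat \<Rightarrow> nat" where
  "eval_code r xs y = judgement (rcode r) (list_encode xs) y"

lemma reval_derivable: "reval r xs y \<Longrightarrow> derivable (eval_code r xs y)"
proof (induction rule: reval.induct)
  case (Zr xs)
  show ?case by (rule derivableI[of "{}"]) (auto simp: eval_code_def just_judgement just_eval_def)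
next
  case (Sc x)
  show ?case
    by (rule derivableI[of "{}"])
       (use list_drop_eq_0[of 1 "[x]"] list_entry_list_encode[of 0
         "[x]"] in \<open>auto simp: eval_code_def just_judgement just_eval_def\<close>)
next
  case (Proj i xs)
  show ?case
    by (rule derivableI[of "{}"])
       (use Proj in \<open>auto simp: eval_code_def just_judgement just_eval_def list_drop_eq_0
         list_entry_list_encode\<close>)
next
  case (Comp xs gs ys f z)
  have len: "length gs = length ys" using Comp.IH(1) by (rule list_all2_lengthD)
  let ?J = "insert (eval_code f ys z) ((\<lambda>i. eval_code (gs ! i) xs (ys ! i)) ` {..<length gs})"
  show ?case
  proof (rule derivableI[of ?J])
    show "just ?J (eval_code (Comp f gs) xs z)"
      by (auto simp: eval_code_def just_judgement just_eval_def just_comp_def judgement_sel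
        list_drop_eq_0 list_entry_list_encode len)
  qed (use Comp in \<open>auto simp: list_all2_conv_all_nth\<close>)
next
  case (PrimRec0 f xs y g)
  show ?case
    by (rule derivableI[of "{eval_code f xs y}"])
       (use PrimRec0 list_entry_list_encode[of 0 "0 # xs"] list_drop_list_encode[of 1 "0 # xs"] in
        \<open>auto simp: eval_code_def just_judgement just_eval_def just_rec_def\<close>)
next
  case (PrimRecS f g n xs y z)
  show ?case
    by (rule derivableI[of "{eval_code (PrimRec f g) (n # xs) y, eval_code g (n # y # xs) z}"])
       (use PrimRecS list_entry_list_encode[of 0 "Suc n # xs"] list_drop_list_encode[of 1
         "Suc n # xs"] in
        \<open>auto simp: eval_code_def just_judgement just_eval_def just_rec_def judgement_sel\<close>)
next
  case (Mu f n xs)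
  from Mu.IH(2) obtain y where y: "\<And>m. m < n \<Longrightarrow> derivable (eval_code f (m # xs) (Suc (y m)))"
    by metis
  let ?J = "insert (eval_code f (n # xs) 0) ((\<lambda>m. eval_code f (m # xs) (Suc (y m))) ` {..<n})"
  show ?case
    by (rule derivableI[of ?J])
       (use Mu.IH(1) y in \<open>auto simp: eval_code_def just_judgement just_eval_def just_mu_def
         judgement_sel\<close>)
qed

lemma eq_eval_codeI: "pfst j = rcode r \<Longrightarrow> pfst (psnd j) = list_encode xs \<Longrightarrow> psnd (psnd j) = y \<Longrightarrow> j =
  eval_code r xs y"
  unfolding eval_code_def judgement_def by (metis prod.collapse prod_decode_inverse)

text \<open>It is enough to trust judgements about genuine programs: a rule that concludes something
  about \<open>r\<close> has premises only about \<open>r\<close> and its subprograms, even if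
  \<open>J\<close> also contains numbers that code no program.\<close>

lemma just_sound:
  assumes J: "\<And>r xs y. eval_code r xs y \<in> J \<Longrightarrow> reval r xs y" and j: "just J (eval_code r xs y)"
  shows "reval r xs y"
proof (cases r)
  case Zr
  then show ?thesis using j
    by (auto simp: eval_code_def just_judgement just_eval_def intro: reval.Zr)
next
  case Sc
  then have "xs \<noteq> []" "length xs \<le> 1" "y = Suc (list_entry 0 (list_encode xs))"
    using j by (auto simp: eval_code_def just_judgement just_eval_def list_drop_eq_0
      list_encode_eq_0)
  then obtain x where "xs = [x]" by (cases xs) auto
  with \<open>y = _\<close> show ?thesis using Sc list_entry_list_encode[of 0 "[x]"] by (auto intro: reval.Sc)
next
  case (Proj i)
  then show ?thesis using j
    by (auto simp: eval_code_def just_judgement just_eval_def list_drop_eq_0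
      list_entry_list_encode intro: reval.Proj)
next
  case (Comp f gs)
  then obtain j where "j \<in> J" and 1: "pfst j = rcode f" "psnd (psnd j) = y"
    and 2: "\<And>i. i < list_encode (map rcode gs) + pfst (psnd j) \<Longrightarrow>
      (list_drop i (list_encode (map rcode gs)) = 0 \<longleftrightarrow> list_drop i (pfst (psnd j)) = 0) \<and>
      (list_drop i (list_encode (map rcode gs)) \<noteq> 0 \<longrightarrow>
        judgement (list_entry i (list_encode (map rcode gs))) (list_encode xs) (list_entry i (pfst
          (psnd j))) \<in> J)"
    using j by (auto simp: eval_code_def just_judgement just_eval_def just_comp_def)
  obtain ys where ys: "pfst (psnd j) = list_encode ys" by (metis list_decode_inverse)
  have le: "length gs \<le> list_encode (map rcode gs)" "length ys \<le> list_encode ys"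
    using length_le_list_encode[of "map rcode gs"] length_le_list_encode[of ys] by auto
  have len: "length gs = length ys"
  proof (rule linorder_cases[of "length gs" "length ys"])
    assume "length gs < length ys"
    then show ?thesis using 2[of "length gs"] le by (auto simp: ys list_drop_eq_0)
  next
    assume "length ys < length gs"
    then show ?thesis using 2[of "length ys"] le by (auto simp: ys list_drop_eq_0)
  qed
  have "reval f ys y" using \<open>j \<in> J\<close> eq_eval_codeI[OF 1(1) ys 1(2)] J by blast
  moreover have "list_all2 (\<lambda>g y. reval g xs y) gs ys"
    unfolding list_all2_conv_all_nth
  proof (intro conjI allI impI len)
    fix i assume "i < length gs"
    then have "eval_code (gs ! i) xs (ys ! i) \<in> J"
      using 2[of i] le len by (auto simp: ys list_drop_eq_0 list_entry_list_encode eval_code_def)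
    then show "reval (gs ! i) xs (ys ! i)" by (rule J)
  qed
  ultimately show ?thesis using Comp by (auto intro: reval.Comp)
next
  case (PrimRec f g)
  then have rec: "just_rec J (rcode r) (pair (rcode f) (rcode g)) (list_encode xs) y"
    using j by (auto simp: eval_code_def just_judgement just_eval_def)
  then obtain n zs where xs: "xs = n # zs" by (cases xs) (auto simp: just_rec_def)
  have e: "list_entry 0 (list_encode xs) = n" "list_drop 1 (list_encode xs) = list_encode zs"
    using list_entry_list_encode[of 0 xs] list_drop_list_encode[of 1 xs] by (auto simp: xs)
  show ?thesis
  proof (cases n)
    case 0
    then have "eval_code f zs y \<in> J" using rec
      by (auto simp: just_rec_def e[unfolded One_nat_def] eval_code_def)
    then show ?thesis using J PrimRec 0 xs by (auto intro: reval.PrimRec0)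
  next
    case (Suc m)
    then obtain j where "j \<in> J"
      and 1: "pfst j = rcode r" "pfst (psnd j) = Suc (pair m (list_encode zs))"
      and 2: "judgement (rcode g) (Suc (pair m (Suc (pair (psnd (psnd j)) (list_encode zs))))) y \<in>
        J"
      using rec by (auto simp: just_rec_def e[unfolded One_nat_def])
    have "j = eval_code r (m # zs) (psnd (psnd j))" using 1 by (intro eq_eval_codeI) auto
    then have "reval r (m # zs) (psnd (psnd j))" using J \<open>j \<in> J\<close> by metis
    moreover have "reval g (m # psnd (psnd j) # zs) y" using J 2 by (auto simp: eval_code_def)
    ultimately show ?thesis using PrimRec Suc xs by (auto intro: reval.PrimRecS)
  qed
next
  case (Mu f)
  then have mu: "just_mu J (rcode f) (list_encode xs) y"
    using j by (auto simp: eval_code_def just_judgement just_eval_def)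
  have "eval_code f (y # xs) 0 \<in> J" using mu by (auto simp: just_mu_def eval_code_def)
  then have "reval f (y # xs) 0" by (rule J)
  moreover have "\<exists>z. reval f (m # xs) (Suc z)" if "m < y" for m
  proof -
    obtain j where "j \<in> J" "pfst j = rcode f" "pfst (psnd j) = Suc (pair m (list_encode xs))"
      "psnd (psnd j) \<noteq> 0"
      using mu \<open>m < y\<close> by (auto simp: just_mu_def)
    moreover from this obtain z where "psnd (psnd j) = Suc z" using not0_implies_Suc by blast
    ultimately have "j = eval_code f (m # xs) (Suc z)" by (intro eq_eval_codeI) auto
    then show ?thesis using J \<open>j \<in> J\<close> by blast
  qed
  ultimately show ?thesis using Mu by (auto intro: reval.Mu)
qed

lemma valid_sound: "valid ds \<Longrightarrow> eval_code r xs y \<in> set ds \<Longrightarrow> reval r xs y"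
proof -
  assume v: "valid ds" and m: "eval_code r xs y \<in> set ds"
  have "ds ! i = eval_code r xs y \<Longrightarrow> i < length ds \<Longrightarrow> reval r xs y" for i r xs y
  proof (induction i arbitrary: r xs y rule: less_induct)
    case (less i)
    have "just (set (take i ds)) (eval_code r xs y)"
      using v less.prems by (auto simp: valid_def)
    then show ?case
      by (rule just_sound[rotated]) (use less in \<open>auto simp: in_set_conv_nth\<close>)
  qed
  then show ?thesis using m by (auto simp: in_set_conv_nth)
qed

section \<open>A decidable halting predicate\<close>

definition entries :: "nat \<Rightarrow> nat \<Rightarrow> nat set" where "entries S i = (\<lambda>k. seq_nth k S) ` {..<i}"

lemma Bex_entries: "(\<exists>j\<in>entries S i. P j) \<longleftrightarrow> (\<exists>k<i. P (seq_nth k S))"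
  and mem_entries: "x \<in> entries S i \<longleftrightarrow> (\<exists>k<i. seq_nth k S = x)"
  by (auto simp: entries_def)

lemma rec_pred_just: "rec_pred 3 (\<lambda>e. just (entries (hd e) (hd (tl e))) (hd (tl (tl e))))"
  unfolding just_def just_eval_def just_comp_def just_rec_def just_mu_def Bex_entries mem_entries
    judgement_def
  by (intro rec_intro; simp)

text \<open>\<open>halts_self d\<close>: the derivation coded by \<open>d\<close> shows that program \<open>pfst (psnd d)\<close>, applied to
  its own code, returns \<open>psnd (psnd d)\<close>.\<close>

definition halts_self :: "nat \<Rightarrow> bool" where
  "halts_self d \<longleftrightarrow>
     (let S = pfst (pfst d); n = psnd (pfst d); e = pfst (psnd d); y = psnd (psnd d) in
       (\<forall>i<n. just (entries S i) (seq_nth i S)) \<and>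
       (\<exists>i<n. seq_nth i S = judgement e (Suc (pair e 0)) y))"

lemma rec_pred_T: "rec_pred 1 (\<lambda>e. halts_self (hd e))"
  unfolding halts_self_def Let_def judgement_def
  by (intro rec_intro rec_pred_lift3[OF rec_pred_just]; simp)

lemma halts_self_sound: assumes "halts_self d" "pfst (psnd d) = rcode r"
  shows "reval r [rcode r] (psnd (psnd d))"
proof -
  let ?S = "pfst (pfst d)" and ?n = "psnd (pfst d)"
  let ?ds = "map (\<lambda>i. seq_nth i ?S) [0..<?n]"
  have "entries ?S i = set (take i ?ds)" if "i < ?n" for i
    using that by (auto simp: entries_def take_map)
  then have "valid ?ds" using assms(1) by (auto simp: valid_def halts_self_def Let_def)
  moreover have "eval_code r [rcode r] (psnd (psnd d)) \<in> set ?ds"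
    using assms by (force simp: halts_self_def Let_def eval_code_def)
  ultimately show ?thesis by (rule valid_sound)
qed

lemma halts_self_complete: assumes "reval r [rcode r] y"
  shows "\<exists>d. halts_self d \<and> pfst (psnd d) = rcode r \<and> psnd (psnd d) = y"
proof -
  obtain ds where ds: "valid ds" "eval_code r [rcode r] y \<in> set ds"
    using reval_derivable[OF assms] unfolding derivable_def by blast
  obtain S where S: "\<forall>i<length ds. seq_nth i S = ds ! i" using seq_nth_exists by blast
  have "entries S i = set (take i ds)" if "i < length ds" for i
    using that S by (force simp: entries_def in_set_conv_nth)
  then have "halts_self (pair (pair S (length ds)) (pair (rcode r) y))"
    using ds S by (auto simp: halts_self_def Let_def valid_def in_set_conv_nth eval_code_def)
  then show ?thesis by (intro exI[of _ "pair (pair S (length ds)) (pair (rcode r) y)"]) auto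
qed

text \<open>A recursively inseparable pair: \<open>d\<close> forces the value \<open>b d\<close> at the argument \<open>a d\<close>. Keeping
  only the first derivation for each argument makes the forced value unique.\<close>

lemma diagonal_requirements:
  obtains V :: "nat \<Rightarrow> bool" and a b :: "nat \<Rightarrow> nat"
  where "rec_pred 1 (\<lambda>e. V (hd e))" "rec_fun 1 (\<lambda>e. a (hd e))" "rec_fun 1 (\<lambda>e. b (hd e))"
    "\<And>d. b d \<le> 1" "inj_on a {d. V d}"
    "\<And>h. rec_fun 1 (\<lambda>e. h (hd e)) \<Longrightarrow> \<exists>d. V d \<and> b d \<noteq> h (a d)"
proof -
  define a where "a = (\<lambda>d. pfst (psnd d))"
  define V where "V = (\<lambda>d. halts_self d \<and> (\<forall>d'<d. \<not> (halts_self d' \<and> a d' = a d)))"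
  define b where "b = (\<lambda>d. if psnd (psnd d) = 0 then 1 else 0::nat)"
  show thesis
  proof (rule that[of V a b])
    show "rec_pred 1 (\<lambda>e. V (hd e))" unfolding V_def a_def
      by (intro rec_intro rec_pred_lift1[where f = halts_self, OF rec_pred_T]; simp)
    show "rec_fun 1 (\<lambda>e. a (hd e))" "rec_fun 1 (\<lambda>e. b (hd e))" unfolding a_def b_def
      by (intro rec_intro; simp)+
    show "inj_on a {d. V d}"
    proof (rule inj_onI)
      fix d d' assume "d \<in> {d. V d}" "d' \<in> {d. V d}" "a d = a d'"
      then show "d = d'" by (cases d d' rule: linorder_cases) (auto simp: V_def)
    qed
    \<comment> \<open>A total program halts on its own code, so its first derivation there is a
      requirement, and \<open>b\<close> is chosen to differ from the output.\<close>
    show "\<exists>d. V d \<and> b d \<noteq> h (a d)" if h: "rec_fun 1 (\<lambda>e. h (hd e))" for h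
    proof -
      obtain r where "\<And>xs. length xs = 1 \<Longrightarrow> reval r xs (h (hd xs))"
        using h unfolding rec_fun_def by blast
      from this[of "[x]" for x] have r: "reval r [x] (h x)" for x by simp
      define d where "d = (LEAST d. halts_self d \<and> a d = rcode r)"
      have "\<exists>d. halts_self d \<and> a d = rcode r" using halts_self_complete[OF r] by (auto simp: a_def)
      then have "halts_self d \<and> a d = rcode r" unfolding d_def by (rule LeastI_ex)
      then have d: "halts_self d" "a d = rcode r" by simp_all
      have "V d" using d not_less_Least[of _ "\<lambda>d. halts_self d \<and> a d = rcode r"]
        by (auto simp: V_def d_def[symmetric])
      moreover have "psnd (psnd d) = h (a d)"
        using reval_deterministic[OF halts_self_sound[OF d(1)] r] d(2) by (simp add: a_def)
      ultimately show ?thesis by (intro exI[of _ d]) (auto simp: b_def)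
    qed
  qed (auto simp: b_def)
qed

section \<open>The p-adic order of rational numbers\<close>

definition padic_order :: "nat \<Rightarrow> rat \<Rightarrow> int" where
  "padic_order p x = int (multiplicity (int p) (fst (quotient_of x))) -
            int (multiplicity (int p) (snd (quotient_of x)))"

definition val_le :: "nat \<Rightarrow> rat \<Rightarrow> rat \<Rightarrow> bool" where
  "val_le p x y \<longleftrightarrow> y = 0 \<or> x \<noteq> 0 \<and> padic_order p x \<le> padic_order p y"

lemma padic_val_pv: "padic_val p x = (if x = 0 then None else Some (padic_order p x))"
  by (simp add: padic_val_def padic_order_def)

locale prime_valuation =
  fixes p :: nat
  assumes prime_p: "Factorial_Ring.prime p"
begin

lemma prime_int_p: "Factorial_Ring.prime (int p)"
  using prime_p by simp

lemma mult_mult: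
  "a \<noteq> 0 \<Longrightarrow> b \<noteq> 0 \<Longrightarrow>
    multiplicity (int p) (a * b) = multiplicity (int p) a + multiplicity (int p) b"
  using prime_elem_multiplicity_mult_distrib[of "int p" a b] prime_int_p by simp

lemma padic_order_frac:
  assumes "a \<noteq> 0" "b \<noteq> 0"
  shows "padic_order p (of_int a / of_int b) =
    int (multiplicity (int p) a) - int (multiplicity (int p) b)"
proof -
  define x :: rat where "x = of_int a / of_int b"
  obtain n d where nd: "quotient_of x = (n, d)" by (cases "quotient_of x")
  have "d > 0" using quotient_of_denom_pos[OF nd] .
  have x: "x = of_int n / of_int d" using quotient_of_div[OF nd] .
  have "(of_int (a * d) :: rat) = of_int (n * b)"
    using x x_def assms \<open>d > 0\<close> by (simp add: field_simps)
  then have eq: "a * d = n * b" by (simp only: of_int_eq_iff)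
  then have "n \<noteq> 0" using assms \<open>d > 0\<close> by auto
  then have "multiplicity (int p) a + multiplicity (int p) d =
      multiplicity (int p) n + multiplicity (int p) b"
    using mult_mult[of a d] mult_mult[of n b] assms \<open>d > 0\<close> eq by simp
  then show ?thesis unfolding x_def[symmetric] padic_order_def nd by simp
qed

lemma rat_fracE:
  fixes x :: rat
  assumes "x \<noteq> 0"
  obtains a b where "a \<noteq> 0" "b > 0" "x = of_int a / of_int b" "coprime a b"
proof -
  obtain n d where nd: "quotient_of x = (n, d)" by (cases "quotient_of x")
  show thesis
    using that[of n d] quotient_of_denom_pos[OF nd] quotient_of_div[OF nd] quotient_of_coprime[OF
      nd] assms
    by auto
qed

lemma padic_order_mult: assumes "x \<noteq> 0" "y \<noteq> 0"
  shows "padic_order p (x * y) = padic_order p x + padic_order p y"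
proof -
  obtain a b where x: "a \<noteq> 0" "b > 0" "x = of_int a / of_int b" using rat_fracE[OF assms(1)] .
  obtain c d where y: "c \<noteq> 0" "d > 0" "y = of_int c / of_int d" using rat_fracE[OF assms(2)] .
  have "x * y = of_int (a * c) / of_int (b * d)" using x y by simp
  then show ?thesis using x y padic_order_frac[of "a * c"
    "b * d"] padic_order_frac[of a b] padic_order_frac[of c d]
    by (simp add: mult_mult)
qed

lemma padic_order_of_int: "n \<noteq> 0 \<Longrightarrow> padic_order p (of_int n) = int (multiplicity (int p) n)"
  using padic_order_frac[of n 1] by simp

lemma padic_order_1: "padic_order p 1 = 0" using padic_order_of_int[of 1] by simp

lemma padic_order_minus_1: "padic_order p (- 1) = 0" using padic_order_mult[of "-1" "-1"]
  by (simp add: padic_order_1)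

lemma p_neq_0: "of_nat p \<noteq> (0 :: rat)" using prime_p by (simp add: prime_gt_0_nat)

lemma padic_order_p: "padic_order p (of_nat p) = 1"
  using padic_order_of_int[of "int p"] prime_p
    by (simp add: prime_gt_0_nat multiplicity_self prime_int_p)

lemma padic_order_inverse: "x \<noteq> 0 \<Longrightarrow> padic_order p (inverse x) = - padic_order p x"
  using padic_order_mult[of x "inverse x"] by (simp add: padic_order_1)

lemma padic_order_power: "x \<noteq> 0 \<Longrightarrow> padic_order p (x ^ n) = int n * padic_order p x"
  by (induction n) (simp_all add: padic_order_1 padic_order_mult algebra_simps)

lemma padic_order_p_powi: "padic_order p (of_nat p powi n) = n"
  using p_neq_0 by (cases n) (auto simp: power_int_def padic_order_power padic_order_p
    padic_order_inverse)

lemma mult_add_ge: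
  "a + b \<noteq> 0 \<Longrightarrow> k \<le> multiplicity (int p) a \<Longrightarrow> k \<le> multiplicity (int p) b
    \<Longrightarrow> k \<le> multiplicity (int p) (a + b)"
  using prime_gt_1_nat[OF prime_p]
  by (intro multiplicity_geI) (auto intro: dvd_add multiplicity_dvd')

lemma padic_order_add:
  assumes "x \<noteq> 0" "y \<noteq> 0" "x + y \<noteq> 0" "padic_order p x \<le> padic_order p y"
    shows "padic_order p x \<le> padic_order p (x + y)"
proof -
  obtain a b where x: "a \<noteq> 0" "b > 0" "x = of_int a / of_int b" using rat_fracE[OF assms(1)] .
  obtain c d where y: "c \<noteq> 0" "d > 0" "y = of_int c / of_int d" using rat_fracE[OF assms(2)] .
  have xy: "x + y = of_int (a * d + c * b) / of_int (b * d)" using x y by (simp add: field_simps)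
  then have nz: "a * d + c * b \<noteq> 0" using assms(3) by (metis div_0 of_int_0)
  have "multiplicity (int p) (a * d) \<le> multiplicity (int p) (c * b)"
    using assms(4) x y padic_order_frac[of a b] padic_order_frac[of c d] by (simp add: mult_mult)
  then have "multiplicity (int p) (a * d) \<le> multiplicity (int p) (a * d + c * b)"
    by (intro mult_add_ge nz) auto
  moreover have "padic_order p (x + y) =
    int (multiplicity (int p) (a * d + c * b)) - int (multiplicity (int p) (b * d))"
    unfolding xy using x y nz by (intro padic_order_frac) auto
  moreover have "padic_order p x = int (multiplicity (int p) a) - int (multiplicity (int p) b)"
    unfolding x(3) using x by (intro padic_order_frac) auto
  ultimately show ?thesis using x y by (simp add: mult_mult)
qed

lemma val_le_refl: "val_le p x x" by (auto simp: val_le_def)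
lemma val_le_trans: "val_le p x y \<Longrightarrow> val_le p y z \<Longrightarrow> val_le p x z" by (auto simp: val_le_def)
lemma val_le_total: "val_le p x y \<or> val_le p y x" by (auto simp: val_le_def)
lemma val_le_0_iff: "val_le p 0 x \<longleftrightarrow> x = 0" by (auto simp: val_le_def)
lemma val_le_0: "val_le p x 0" by (auto simp: val_le_def)

lemma val_le_mult: "val_le p x y \<Longrightarrow> val_le p (x * z) (y * z)"
  by (auto simp: val_le_def padic_order_mult)

lemma val_le_mult_iff: "z \<noteq> 0 \<Longrightarrow> val_le p (x * z) (y * z) \<longleftrightarrow> val_le p x y"
  using val_le_mult[of "x * z" "y * z" "inverse z"] val_le_mult[of x y z] by (auto simp: mult.assoc)

lemma val_le_add: "val_le p z x \<Longrightarrow> val_le p z y \<Longrightarrow> val_le p z (x + y)"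
proof (cases "x = 0 \<or> y = 0 \<or> x + y = 0")
  case False
  then have "min (padic_order p x) (padic_order p y) \<le> padic_order p (x + y)"
    using padic_order_add[of x y] padic_order_add[of y x] by (auto simp: add.commute min_def)
  moreover assume "val_le p z x" "val_le p z y"
  ultimately show ?thesis using False by (auto simp: val_le_def)
qed (auto simp: val_le_def)

lemma val_le_minus: "val_le p z (- x) \<longleftrightarrow> val_le p z x" "val_le p (- x) z \<longleftrightarrow> val_le p x z"
  using padic_order_mult[of "-1" x] by (auto simp: val_le_def padic_order_minus_1)

text \<open>Orders are integers, so positive means at least 1. This passes to sequences and makes
  the value of \<open>p\<close> the least positive one.\<close>

lemma val_le_1_iff: "\<not> val_le p x 1 \<longleftrightarrow> val_le p (of_nat p) x"
  using p_neq_0 by (auto simp: val_le_def padic_order_1 padic_order_p)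

lemma val_le_p_of_int: "val_le p (of_nat p) (of_int n) \<longleftrightarrow> int p dvd n"
proof (cases "n = 0")
  case False
  have "1 \<le> multiplicity (int p) n \<longleftrightarrow> int p dvd n"
    using False power_dvd_iff_le_multiplicity[of n "int p" 1] prime_int_p not_prime_unit by auto
  then show ?thesis using False p_neq_0 by (auto simp: val_le_def padic_order_p padic_order_of_int)
qed (simp add: val_le_def)

lemma val_le_1_of_int: "val_le p 1 (of_int n)"
  by (cases "n = 0") (auto simp: val_le_def padic_order_1 padic_order_of_int)

text \<open>In lowest terms an integral fraction has a denominator prime to \<open>p\<close>; the
  digit is the numerator times the inverse of the denominator modulo \<open>p\<close>.\<close>

lemma residue_digit:
  assumes "val_le p 1 x" shows "\<exists>d<p. val_le p (of_nat p) (x - of_nat d)"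
proof (cases "x = 0")
  case True
  then show ?thesis using prime_p by (auto intro!: exI[of _ 0] simp: val_le_def prime_gt_0_nat)
next
  case False
  obtain a b where x: "a \<noteq> 0" "b > 0" "x = of_int a / of_int b" "coprime a b"
    using rat_fracE[OF False] .
  have pb: "\<not> int p dvd b"
  proof
    assume pb: "int p dvd b"
    then have "multiplicity (int p) b > 0"
      using x(2) prime_int_p by (simp add: prime_multiplicity_gt_zero_iff)
    moreover have "\<not> int p dvd a"
      using pb x(4) prime_int_p by (meson coprime_common_divisor not_prime_unit)
    then have "multiplicity (int p) a = 0" by (rule not_dvd_imp_multiplicity_0)
    ultimately show False using assms x padic_order_frac[of a b]
      by (auto simp: val_le_def padic_order_1)
  qed
  have "coprime b (int p)"
    using pb prime_int_p by (metis coprime_commute prime_imp_coprime)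
  then obtain c where c: "[b * c = 1] (mod int p)" using cong_solve_coprime_int by blast
  define d where "d = nat ((a * c) mod int p)"
  have "p > 0" using prime_p by (simp add: prime_gt_0_nat)
  then have d: "int d = (a * c) mod int p" "d < p"
    unfolding d_def by (auto simp: nat_less_iff)
  have "[b * int d = b * (a * c)] (mod int p)" unfolding d(1)
    by (intro cong_mult cong_refl) (simp add: cong_def)
  also have "b * (a * c) = a * (b * c)" by simp
  also have "[a * (b * c) = a * 1] (mod int p)" by (intro cong_mult cong_refl c)
  finally have "int p dvd a - b * int d" by (simp add: cong_iff_dvd_diff dvd_diff_commute)
  then have "val_le p (of_nat p) (of_int (a - b * int d))" by (simp only: val_le_p_of_int)
  moreover have "x - of_nat d = of_int (a - b * int d) * inverse (of_int b)"
    using x by (simp add: field_simps)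
  moreover have "val_le p 1 (inverse (of_int b))"
    using x(2) pb padic_order_of_int[of b] not_dvd_imp_multiplicity_0[OF pb]
    by (auto simp: val_le_def padic_order_1 padic_order_inverse)
  ultimately have "val_le p (of_nat p) (x - of_nat d)"
    using val_le_mult[of "of_nat p" "of_int (a - b * int d)" "inverse (of_int b)"]
      val_le_mult[of 1 "inverse (of_int b)" "of_nat p"] val_le_trans
    by (metis mult.commute mult_1)
  then show ?thesis using d by blast
qed

end

section \<open>Sequences of rationals modulo eventual equality\<close>

text \<open>Natural numbers code sequences of rationals; the least code of a class of eventually equal
  sequences (or of a class of sequences of eventually equal order) represents an element of the
  field (or of the value group).\<close>

locale limit_field = prime_valuation +
  fixes \<sigma> :: "nat \<Rightarrow> nat \<Rightarrow> rat"
    and cadd cmul :: "nat \<Rightarrow> nat \<Rightarrow> nat" and cinv :: "nat \<Rightarrow> nat" and cm1 :: nat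
  assumes \<sigma>_add: "\<sigma> (cadd a b) j = \<sigma> a j + \<sigma> b j"
    and \<sigma>_mul: "\<sigma> (cmul a b) j = \<sigma> a j * \<sigma> b j"
    and \<sigma>_inv: "\<sigma> (cinv a) j = inverse (\<sigma> a j)"
    and \<sigma>_m1: "\<sigma> cm1 j = - 1"
    and stable: "(\<forall>\<^sub>F j in sequentially. val_le p (\<sigma> a j) (\<sigma> b j)) \<or>
                 (\<forall>\<^sub>F j in sequentially. \<not> val_le p (\<sigma> a j) (\<sigma> b j))"
begin

definition c1 where "c1 = cmul cm1 cm1"
definition c0 where "c0 = cadd c1 cm1"

lemma \<sigma>_1: "\<sigma> c1 j = 1" and \<sigma>_0: "\<sigma> c0 j = 0"
  by (simp_all add: c1_def c0_def \<sigma>_add \<sigma>_mul \<sigma>_m1)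

lemmas \<sigma>_simps = \<sigma>_add \<sigma>_mul \<sigma>_inv \<sigma>_m1 \<sigma>_1 \<sigma>_0

definition ceq where "ceq a b \<longleftrightarrow> (\<forall>\<^sub>F j in sequentially. \<sigma> a j = \<sigma> b j)"
definition cle where "cle a b \<longleftrightarrow> (\<forall>\<^sub>F j in sequentially. val_le p (\<sigma> a j) (\<sigma> b j))"
definition norm_code where "norm_code a = (LEAST b. ceq b a)"
definition value_code where "value_code a = (LEAST b. cle b a \<and> cle a b)"

text \<open>\<open>stable\<close> upgrades the failure of an eventual comparison to failure at all
  late stages; totality of the order rests on this.\<close>

lemma not_cle: "\<not> cle a b \<longleftrightarrow> (\<forall>\<^sub>F j in sequentially. \<not> val_le p (\<sigma> a j) (\<sigma> b j))"
  using stable[of a b] eventually_elim2[of "\<lambda>j. val_le p (\<sigma> a j) (\<sigma> b j)" sequentially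
      "\<lambda>j. \<not> val_le p (\<sigma> a j) (\<sigma> b j)" "\<lambda>_. False"]
  by (auto simp: cle_def)

lemma ceq_refl: "ceq a a" by (simp add: ceq_def)
lemma ceq_sym: "ceq a b \<Longrightarrow> ceq b a" by (simp add: ceq_def eq_commute)
lemma ceq_trans: "ceq a b \<Longrightarrow> ceq b c \<Longrightarrow> ceq a c"
  unfolding ceq_def by (erule (1) eventually_elim2) simp

lemma ceq_0_iff: "ceq a c0 \<longleftrightarrow> cle c0 a"
  by (simp add: ceq_def cle_def \<sigma>_0 val_le_0_iff)

text \<open>A nonzero class is nonzero at all late stages, not just infinitely often, so pointwise
  inversion yields inverses and there are no zero divisors.\<close>

lemma not_ceq_0: "\<not> ceq a c0 \<longleftrightarrow> (\<forall>\<^sub>F j in sequentially. \<sigma> a j \<noteq> 0)"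
  unfolding ceq_0_iff not_cle by (simp add: \<sigma>_0 val_le_0_iff)

lemma ceq_nm: "ceq (norm_code a) a"
  unfolding norm_code_def by (rule LeastI[of _ a]) (rule ceq_refl)

lemma nm_cong: "ceq a b \<Longrightarrow> norm_code a = norm_code b"
  unfolding norm_code_def by (rule arg_cong[of _ _ Least]) (blast intro: ceq_trans ceq_sym)

lemma nm_eq_iff: "norm_code a = norm_code b \<longleftrightarrow> ceq a b"
  using nm_cong ceq_nm ceq_sym ceq_trans by metis

lemma nm_nm [simp]: "norm_code (norm_code a) = norm_code a" by (rule nm_cong[OF ceq_nm])

lemma cle_refl: "cle a a" by (simp add: cle_def val_le_refl)
lemma cle_trans: "cle a b \<Longrightarrow> cle b c \<Longrightarrow> cle a c"
  unfolding cle_def by (erule (1) eventually_elim2) (rule val_le_trans)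
lemma cle_total: "cle a b \<or> cle b a"
proof (rule disjCI)
  assume "\<not> cle b a"
  then have "\<forall>\<^sub>F j in sequentially. \<not> val_le p (\<sigma> b j) (\<sigma> a j)" by (simp only: not_cle)
  then show "cle a b" unfolding cle_def
    by (rule eventually_mono) (use val_le_total in blast)
qed

lemma ceq_cle: "ceq a b \<Longrightarrow> cle a b" and ceq_cle': "ceq a b \<Longrightarrow> cle b a"
  unfolding ceq_def cle_def by (auto elim!: eventually_mono simp: val_le_refl)

lemma cle_gn: "cle (value_code a) a" "cle a (value_code a)"
proof -
  have "cle (value_code a) a \<and> cle a (value_code a)" unfolding value_code_def
    by (rule LeastI[of _ a]) (simp add: cle_refl)
  then show "cle (value_code a) a" "cle a (value_code a)" by auto
qed

lemma gn_eq_iff: "value_code a = value_code b \<longleftrightarrow> cle a b \<and> cle b a"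
proof
  assume "cle a b \<and> cle b a"
  then show "value_code a = value_code b" unfolding value_code_def
    by (intro arg_cong[of _ _ Least]) (blast intro: cle_trans)
qed (metis cle_gn cle_trans)

lemma gn_gn [simp]: "value_code (value_code a) = value_code a"
  unfolding gn_eq_iff using cle_gn by blast

lemma ceq_add: "ceq a a' \<Longrightarrow> ceq b b' \<Longrightarrow> ceq (cadd a b) (cadd a' b')"
  and ceq_mul: "ceq a a' \<Longrightarrow> ceq b b' \<Longrightarrow> ceq (cmul a b) (cmul a' b')"
  unfolding ceq_def by (erule (1) eventually_elim2, simp add: \<sigma>_simps)+

lemma nm_absorb [simp]:
  "norm_code (cadd (norm_code a) b) = norm_code (cadd a b)" "norm_code (cadd a (norm_code b)) =
    norm_code (cadd a b)"
  "norm_code (cmul (norm_code a) b) = norm_code (cmul a b)" "norm_code (cmul a (norm_code b)) =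
    norm_code (cmul a b)"
  by (auto intro!: nm_cong ceq_add ceq_mul ceq_nm ceq_refl)

lemma ceq_nm_iff [simp]: "ceq (norm_code a) b \<longleftrightarrow> ceq a b" "ceq a (norm_code b) \<longleftrightarrow> ceq a b"
  by (metis nm_eq_iff nm_nm)+

lemma cle_nm_iff [simp]: "cle (norm_code a) b \<longleftrightarrow> cle a b" "cle a (norm_code b) \<longleftrightarrow> cle a b"
  using ceq_nm ceq_cle ceq_cle' cle_trans by meson+

lemma cle_gn_iff [simp]: "cle (value_code a) b \<longleftrightarrow> cle a b" "cle a (value_code b) \<longleftrightarrow> cle a b"
  using cle_gn cle_trans by meson+

lemma gn_nm [simp]: "value_code (norm_code a) = value_code a" by (simp add: gn_eq_iff cle_refl)

lemma ceq_gn_0 [simp]: "ceq (value_code a) c0 \<longleftrightarrow> ceq a c0"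
  by (simp add: ceq_0_iff)

lemma cle_mul: "cle a a' \<Longrightarrow> cle (cmul a b) (cmul a' b)"
  unfolding cle_def by (elim eventually_mono) (simp add: \<sigma>_simps val_le_mult)

lemma ceq_mul_commute: "ceq (cmul a b) (cmul b a)" by (simp add: ceq_def \<sigma>_simps)

lemma cle_mul': "cle a a' \<Longrightarrow> cle (cmul b a) (cmul b a')"
  using cle_mul[of a a' b] ceq_cle[OF ceq_mul_commute] cle_trans by meson

lemma gn_absorb [simp]: "value_code (cmul (value_code a) b) = value_code (cmul a b)"
  "value_code (cmul a (value_code b)) = value_code (cmul a b)"
  by (auto simp: gn_eq_iff intro: cle_mul cle_mul' cle_gn)

lemma gn_cong: "ceq a b \<Longrightarrow> value_code a = value_code b" by (simp add: gn_eq_iff ceq_cle ceq_cle')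

lemma ceq_mul_0: "ceq (cmul a b) c0 \<longleftrightarrow> ceq a c0 \<or> ceq b c0"
proof (cases "ceq a c0 \<or> ceq b c0")
  case True
  then show ?thesis unfolding ceq_def by (auto elim!: eventually_mono simp: \<sigma>_simps)
next
  case False
  then have "\<forall>\<^sub>F j in sequentially. \<sigma> a j \<noteq> 0" "\<forall>\<^sub>F j in sequentially. \<sigma> b j \<noteq> 0"
    by (simp_all add: not_ceq_0[symmetric])
  then have "\<forall>\<^sub>F j in sequentially. \<sigma> (cmul a b) j \<noteq> 0"
    by (rule eventually_elim2) (simp add: \<sigma>_simps)
  then show ?thesis using False not_ceq_0 by blast
qed

lemma not_ceq_1_0: "\<not> ceq c1 c0" unfolding not_ceq_0 by (simp add: \<sigma>_simps)

lemma ceq_inv_0: "\<not> ceq a c0 \<Longrightarrow> \<not> ceq (cinv a) c0"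
  unfolding not_ceq_0 by (elim eventually_mono) (simp add: \<sigma>_simps)

lemma ceq_mul_inv: "\<not> ceq a c0 \<Longrightarrow> ceq (cmul a (cinv a)) c1"
  unfolding not_ceq_0 unfolding ceq_def by (elim eventually_mono) (simp add: \<sigma>_simps)

section \<open>The limit field and its value group\<close>

definition limK :: "nat ring" where
  "limK = \<lparr> carrier = {c. norm_code c = c}, monoid.mult = \<lambda>a b. norm_code (cmul a b), one =
    norm_code c1,
     ring.zero = norm_code c0, ring.add = \<lambda>a b. norm_code (cadd a b) \<rparr>"

definition limG :: "nat ogroup" where
  "limG = \<lparr> carrier = {c. value_code c = c \<and> \<not> ceq c c0}, monoid.mult =
    \<lambda>a b. value_code (cmul a b), one = value_code c1,
     ole = cle \<rparr>"

definition limv :: "nat \<Rightarrow> nat option" where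
  "limv c = (if ceq c c0 then None else Some (value_code c))"

lemma limK_simps [simp]:
  "c \<in> carrier limK \<longleftrightarrow> norm_code c = c" "x \<otimes>\<^bsub>limK\<^esub> y = norm_code (cmul x y)"
    "x \<oplus>\<^bsub>limK\<^esub> y = norm_code (cadd x y)"
  "\<one>\<^bsub>limK\<^esub> = norm_code c1" "\<zero>\<^bsub>limK\<^esub> = norm_code c0"
  by (simp_all add: limK_def)

lemma limG_simps [simp]:
  "c \<in> carrier limG \<longleftrightarrow> value_code c = c \<and> \<not> ceq c c0" "x \<otimes>\<^bsub>limG\<^esub> y = value_code (cmul x y)"
    "\<one>\<^bsub>limG\<^esub> = value_code c1"
  "ole limG = cle"
  by (simp_all add: limG_def)

lemma nm_eqI: "norm_code a = a \<Longrightarrow> ceq b a \<Longrightarrow> norm_code b = a" using nm_cong by metis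

lemma limK_cring: "cring limK"
proof (rule cringI)
  show "abelian_group limK"
  proof (rule abelian_groupI)
    fix x assume "x \<in> carrier limK"
    show "\<exists>y\<in>carrier limK. y \<oplus>\<^bsub>limK\<^esub> x = \<zero>\<^bsub>limK\<^esub>"
      by (rule bexI[of _ "norm_code (cmul cm1 x)"]) (auto intro!: nm_cong simp: ceq_def \<sigma>_simps)
  qed (auto intro!: nm_cong intro: nm_eqI simp: ceq_def \<sigma>_simps algebra_simps)
  show "comm_monoid limK"
    by (rule comm_monoidI) (auto intro!: nm_cong intro: nm_eqI simp: ceq_def \<sigma>_simps algebra_simps)
qed (auto intro!: nm_cong simp: ceq_def \<sigma>_simps algebra_simps)

lemma limK_field: "field limK"
proof (rule cring.cring_fieldI[OF limK_cring])
  show "Units limK = carrier limK - {\<zero>\<^bsub>limK\<^esub>}"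
  proof (intro equalityI subsetI)
    fix x assume "x \<in> Units limK"
    then obtain y where "norm_code x = x" "norm_code (cmul y x) = norm_code c1"
      by (auto simp: Units_def)
    moreover from this have "\<not> ceq x c0" using not_ceq_1_0 ceq_mul_0 ceq_trans ceq_sym
      by (metis nm_eq_iff)
    ultimately show "x \<in> carrier limK - {\<zero>\<^bsub>limK\<^esub>}" using nm_eq_iff by auto
  next
    fix x assume "x \<in> carrier limK - {\<zero>\<^bsub>limK\<^esub>}"
    then have x: "norm_code x = x" "\<not> ceq x c0" using nm_cong by auto
    then have "norm_code (cmul x (cinv x)) = norm_code c1" "norm_code (cmul (cinv x) x) =
      norm_code c1"
      using nm_cong ceq_mul_inv ceq_trans ceq_mul_commute by metis+
    then show "x \<in> Units limK" using x
      by (auto simp: Units_def intro!: bexI[of _ "norm_code (cinv x)"])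
  qed
qed

lemma gn_eqI: "value_code a = a \<Longrightarrow> ceq b a \<Longrightarrow> value_code b = a" using gn_cong by metis

lemma limG_oag: "ordered_abelian_group limG"
proof -
  have "comm_group limG"
  proof (rule comm_groupI)
    fix x assume x: "x \<in> carrier limG"
    show "\<exists>y\<in>carrier limG. y \<otimes>\<^bsub>limG\<^esub> x = \<one>\<^bsub>limG\<^esub>"
      using x ceq_inv_0 gn_cong[OF ceq_trans[OF ceq_mul_commute ceq_mul_inv]]
      by (intro bexI[of _ "value_code (cinv x)"]) auto
  qed (auto intro!: gn_cong intro: gn_eqI simp: ceq_mul_0 not_ceq_1_0,
       (auto intro!: gn_cong intro: gn_eqI simp: ceq_def \<sigma>_simps algebra_simps)?)
  then show ?thesis
    unfolding ordered_abelian_group_def ordered_abelian_group_axioms_def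
    by (auto simp: cle_refl cle_total intro: cle_trans cle_mul) (metis gn_eq_iff)
qed

lemma vle_limv: "vle limG (limv x) (limv y) \<longleftrightarrow> cle x y"
proof (cases "ceq y c0")
  case True
  have "cle x c0" by (simp add: cle_def \<sigma>_0 val_le_0)
  then have "cle x y" using ceq_cle'[OF True] cle_trans by blast
  then show ?thesis using True by (simp add: limv_def)
next
  case False
  then have "\<not> cle x y" if "ceq x c0"
    using cle_trans[OF ceq_cle'[OF that]] ceq_0_iff by blast
  then show ?thesis using False by (cases "ceq x c0") (simp_all add: limv_def)
qed

lemma limK_valued_field: "valued_field limK limG limv"
proof -
  have "limv ` carrier limK = insert None (Some ` carrier limG)"
  proof (intro equalityI subsetI)
    fix g assume "g \<in> insert None (Some ` carrier limG)"
    then consider "g = None" | c where "g = Some c" "value_code c = c" "\<not> ceq c c0" by auto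
    then show "g \<in> limv ` carrier limK"
    proof cases
      case 1
      then show ?thesis by (intro image_eqI[of _ _ "norm_code c0"]) (auto simp: limv_def ceq_refl)
    next
      case 2
      then show ?thesis by (intro image_eqI[of _ _ "norm_code c"]) (auto simp: limv_def)
    qed
  qed (auto simp: limv_def)
  moreover have "limv x = None \<longleftrightarrow> x = \<zero>\<^bsub>limK\<^esub>" if "x \<in> carrier limK" for x
    using that nm_eq_iff[of x c0] by (auto simp: limv_def ceq_refl)
  moreover have "limv (x \<otimes>\<^bsub>limK\<^esub> y) = vplus limG (limv x) (limv y)" for x y
    by (auto simp: limv_def ceq_mul_0)
  moreover have "vle limG (vmin limG (limv x) (limv y)) (limv (x \<oplus>\<^bsub>limK\<^esub> y))" for x y
  proof -
    have *: "cle z (norm_code (cadd x y))" if "cle z x" "cle z y" for z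
      using that unfolding cle_nm_iff unfolding cle_def
      by (rule eventually_elim2) (simp add: \<sigma>_simps val_le_add)
    show ?thesis
      using *[of x] *[of y] cle_refl cle_total[of x y] by (auto simp: vmin_def vle_limv)
  qed
  ultimately show ?thesis
    using limK_field limG_oag by (simp add: valued_field_def valued_field_axioms_def)
qed

section \<open>Embedding of the rationals and the least positive value\<close>

lemma rat_code: "\<exists>c. \<forall>j. \<sigma> c j = x"
proof -
  have nat: "\<exists>c. \<forall>j. \<sigma> c j = of_nat n" for n
  proof (induction n)
    case (Suc n)
    then obtain c where "\<forall>j. \<sigma> c j = of_nat n" by blast
    then show ?case by (intro exI[of _ "cadd c c1"]) (simp add: \<sigma>_simps)
  qed (auto simp: \<sigma>_simps intro: exI[of _ c0])
  have int: "\<exists>c. \<forall>j. \<sigma> c j = of_int n" for n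
  proof (cases n)
    case (nonneg m)
    then show ?thesis using nat[of m] by simp
  next
    case (neg m)
    obtain c where "\<forall>j. \<sigma> c j = of_nat (Suc m)" using nat by blast
    then show ?thesis using neg by (intro exI[of _ "cmul cm1 c"]) (simp add: \<sigma>_simps)
  qed
  obtain a b where x: "x = of_int a / of_int b" using quotient_of_div by (metis surj_pair)
  obtain c d where "\<forall>j. \<sigma> c j = of_int a" "\<forall>j. \<sigma> d j = of_int b" using int by metis
  then show ?thesis by (intro exI[of _ "cmul c (cinv d)"]) (simp add: \<sigma>_simps x field_simps)
qed

definition rat_elem :: "rat \<Rightarrow> nat" where "rat_elem x = norm_code (SOME c. \<forall>j. \<sigma> c j = x)"

lemma \<sigma>_rc: "\<forall>\<^sub>F j in sequentially. \<sigma> (rat_elem x) j = x"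
proof -
  have "\<forall>j. \<sigma> (SOME c. \<forall>j. \<sigma> c j = x) j = x" by (rule someI_ex[OF rat_code])
  moreover have "ceq (rat_elem x) (SOME c. \<forall>j. \<sigma> c j = x)" unfolding rat_elem_def by (rule ceq_nm)
  ultimately show ?thesis by (simp add: ceq_def)
qed

lemma nm_rc [simp]: "norm_code (rat_elem x) = rat_elem x" by (simp add: rat_elem_def)

lemma nm_eq_rcI: assumes "\<forall>\<^sub>F j in sequentially. \<sigma> c j = x" shows "norm_code c = rat_elem x"
proof -
  have "ceq c (rat_elem x)" unfolding ceq_def by (rule eventually_elim2[OF assms \<sigma>_rc[of x]]) simp
  then show ?thesis using nm_cong by fastforce
qed

lemma nm_1: "norm_code c1 = rat_elem 1" and nm_0: "norm_code c0 = rat_elem 0"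
  by (rule nm_eq_rcI; simp add: \<sigma>_simps)+

lemma nm_add_rc: "norm_code (cadd (rat_elem x) (rat_elem y)) = rat_elem (x + y)"
  by (rule nm_eq_rcI, rule eventually_elim2[OF \<sigma>_rc[of x] \<sigma>_rc[of y]]) (simp add: \<sigma>_simps)

lemma nm_mul_rc: "norm_code (cmul (rat_elem x) (rat_elem y)) = rat_elem (x * y)"
  by (rule nm_eq_rcI, rule eventually_elim2[OF \<sigma>_rc[of x] \<sigma>_rc[of y]]) (simp add: \<sigma>_simps)

lemma cle_rc: "cle (rat_elem x) (rat_elem y) \<longleftrightarrow> val_le p x y"
proof -
  have *: "\<forall>\<^sub>F j in sequentially. (val_le p (\<sigma> (rat_elem x) j) (\<sigma> (rat_elem y) j) \<longleftrightarrow> val_le p x y)"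
    by (rule eventually_elim2[OF \<sigma>_rc[of x] \<sigma>_rc[of y]]) simp
  have "cle (rat_elem x) (rat_elem y) \<longleftrightarrow> (\<forall>\<^sub>F j::nat in sequentially. val_le p x y)"
    unfolding cle_def by (rule eventually_cong[OF *]) simp
  then show ?thesis by simp
qed

lemma ceq_rc_0: "ceq (rat_elem x) c0 \<longleftrightarrow> x = 0"
proof -
  have "ceq (rat_elem x) c0 \<longleftrightarrow> cle (rat_elem 0) (rat_elem x)" unfolding ceq_0_iff nm_0[symmetric]
    by simp
  then show ?thesis by (simp add: cle_rc val_le_0_iff)
qed

lemma cle_rc_iff: "cle (rat_elem x) c \<longleftrightarrow> (\<forall>\<^sub>F j in sequentially. val_le p x (\<sigma> c j))"
proof -
  have "\<forall>\<^sub>F j in sequentially. (val_le p (\<sigma> (rat_elem x) j) (\<sigma> c j) \<longleftrightarrow> val_le p x (\<sigma> c j))"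
    by (rule eventually_mono[OF \<sigma>_rc[of x]]) simp
  then show ?thesis unfolding cle_def by (rule eventually_cong) simp
qed

lemma cle_c1_iff: "cle c1 c \<longleftrightarrow> (\<forall>\<^sub>F j in sequentially. val_le p 1 (\<sigma> c j))"
  by (simp add: cle_def \<sigma>_simps)

lemma not_cle_c1_iff: "\<not> cle c c1 \<longleftrightarrow> cle (rat_elem (of_nat p)) c"
  by (simp add: not_cle cle_rc_iff \<sigma>_simps val_le_1_iff)

lemma limv_rc: "limv (rat_elem x) =
  map_option (\<lambda>n. value_code (rat_elem (of_nat p powi n))) (padic_val p x)"
proof (cases "x = 0")
  case False
  have "val_le p x (of_nat p powi padic_order p x)" "val_le p (of_nat p powi padic_order p x) x"
    using False p_neq_0 by (simp_all add: val_le_def padic_order_p_powi)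
  then show ?thesis using False by (simp add: limv_def ceq_rc_0 padic_val_pv gn_eq_iff cle_rc)
qed (simp add: limv_def ceq_rc_0 padic_val_pv)

lemma rat_embedding: "vf_embedding rat_field int_ogroup (padic_val p) limK limG limv rat_elem"
proof -
  have "rat_elem \<in> ring_hom rat_field limK"
    by (rule ring_hom_memI) (auto simp: rat_field_def nm_add_rc nm_mul_rc nm_1)
  moreover have "(\<lambda>n. value_code (rat_elem (of_nat p powi n))) \<in> hom int_ogroup limG"
  proof (rule homI)
    have "value_code (cmul (rat_elem x) (rat_elem y)) = value_code (rat_elem (x * y))" for x y
      unfolding nm_mul_rc[symmetric] by simp
    then show "value_code (rat_elem (of_nat p powi (x \<otimes>\<^bsub>int_ogroup\<^esub> y))) =
        value_code (rat_elem (of_nat p powi x)) \<otimes>\<^bsub>limG\<^esub> value_code (rat_elem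
          (of_nat p powi y))" for x y
      using p_neq_0 by (simp add: int_ogroup_def power_int_add)
    show "value_code (rat_elem (of_nat p powi x)) \<in> carrier limG" for x
      using power_int_not_zero[OF disjI1[OF p_neq_0]] by (simp add: ceq_rc_0)
  qed
  moreover have "a \<le> b \<longleftrightarrow> cle (value_code (rat_elem (of_nat p powi a))) (value_code (rat_elem
    (of_nat p powi b)))" for a b
    using p_neq_0 by (simp add: cle_rc val_le_def padic_order_p_powi)
  ultimately show ?thesis
    unfolding vf_embedding_def
    by (intro conjI bexI[of _ "\<lambda>n. value_code (rat_elem (of_nat p powi n))"])
       (auto simp: int_ogroup_def limv_rc)
qed

lemma add_pow_one: "add_pow limK n \<one>\<^bsub>limK\<^esub> = rat_elem (of_nat n)"
proof -
  interpret K: cring limK by (rule limK_cring)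
  show ?thesis
  proof (induction n)
    case 0
    then show ?case by (simp add: add_pow_def nm_0)
  next
    case (Suc n)
    then show ?case using nm_add_rc[of "of_nat n" 1]
      by (simp add: add_pow_def nm_1 add.commute)
  qed
qed

lemma p_minimal_value:
  "\<exists>g\<in>carrier limG. limv (add_pow limK p \<one>\<^bsub>limK\<^esub>) = Some g \<and> oless limG \<one>\<^bsub>limG\<^esub> g \<and>
     (\<forall>h\<in>carrier limG. oless limG \<one>\<^bsub>limG\<^esub> h \<longrightarrow> ole limG g h)"
proof (intro bexI conjI ballI impI)
  show "limv (add_pow limK p \<one>\<^bsub>limK\<^esub>) = Some (value_code (rat_elem (of_nat p)))"
    using p_neq_0 by (simp only: add_pow_one limv_def ceq_rc_0 if_False)
  show "value_code (rat_elem (of_nat p)) \<in> carrier limG" using p_neq_0 by (simp add: ceq_rc_0)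
  have "\<not> cle (rat_elem (of_nat p)) c1"
    using not_cle_c1_iff cle_refl by blast
  then show "oless limG \<one>\<^bsub>limG\<^esub> (value_code (rat_elem (of_nat p)))"
    using cle_total by (auto simp: oless_def gn_eq_iff)
  fix h assume "h \<in> carrier limG" "oless limG \<one>\<^bsub>limG\<^esub> h"
  then have "\<not> cle h c1" by (auto simp: oless_def gn_eq_iff) (metis gn_eq_iff)
  then show "ole limG (value_code (rat_elem (of_nat p))) h" by (simp add: not_cle_c1_iff)
qed

section \<open>The residue field\<close>

definition vring where "vring = valuation_ring limK limG limv"
definition videal where "videal = valuation_ideal limK limG limv"

lemma limv_1: "Some \<one>\<^bsub>limG\<^esub> = limv c1" by (simp add: limv_def not_ceq_1_0)

lemma carrier_vring: "carrier vring = {x. norm_code x = x \<and> cle c1 x}"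
  by (simp add: vring_def valuation_ring_def limv_1 vle_limv del: limG_simps)

lemma vring_simps:
  "x \<otimes>\<^bsub>vring\<^esub> y = norm_code (cmul x y)" "x \<oplus>\<^bsub>vring\<^esub> y = norm_code (cadd x y)"
    "\<one>\<^bsub>vring\<^esub> = rat_elem 1" "\<zero>\<^bsub>vring\<^esub> = rat_elem 0"
  by (simp_all add: vring_def valuation_ring_def nm_1 nm_0)

lemma videal_eq: "videal = {x. norm_code x = x \<and> cle (rat_elem (of_nat p)) x}"
proof -
  have "limv c1 = limv x \<longleftrightarrow> cle c1 x \<and> cle x c1" for x
  proof (cases "ceq x c0")
    case True
    then have "\<not> cle x c1" using cle_trans[OF ceq_cle'[OF True]] ceq_0_iff not_ceq_1_0 by blast
    then show ?thesis using True by (simp add: limv_def not_ceq_1_0)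
  qed (simp add: limv_def not_ceq_1_0 gn_eq_iff)
  then have "videal = {x. norm_code x = x \<and> \<not> cle x c1}"
    using cle_total by (auto simp: videal_def valuation_ideal_def vless_def limv_1 vle_limv
        simp del: limG_simps)
  then show ?thesis by (simp add: not_cle_c1_iff)
qed

lemma videal_subset: "videal \<subseteq> carrier vring"
  using not_cle_c1_iff cle_total by (auto simp: videal_eq carrier_vring)

lemma cle_add: "cle z x \<Longrightarrow> cle z y \<Longrightarrow> cle z (cadd x y)"
  unfolding cle_def by (erule (1) eventually_elim2) (simp add: \<sigma>_simps val_le_add)

lemma cle_neg: "cle z x \<Longrightarrow> cle z (cmul cm1 x)"
  unfolding cle_def by (erule eventually_mono) (simp add: \<sigma>_simps val_le_minus)

lemma cle_mul_c1: "cle z x \<Longrightarrow> cle c1 y \<Longrightarrow> cle z (cmul x y)"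
proof -
  assume "cle z x" "cle c1 y"
  then have "cle (cmul z c1) (cmul x y)" using cle_mul cle_mul' cle_trans by meson
  moreover have "ceq z (cmul z c1)" by (simp add: ceq_def \<sigma>_simps)
  ultimately show ?thesis using ceq_cle cle_trans by blast
qed

lemma vring_ring: "ring vring"
proof -
  interpret K: cring limK by (rule limK_cring)
  have neg: "\<ominus>\<^bsub>limK\<^esub> x = norm_code (cmul cm1 x)" if "x \<in> carrier limK" for x
    using that by (intro K.minus_equality) (auto intro!: nm_cong simp: ceq_def \<sigma>_simps)
  have "subring (carrier vring) limK"
    by (rule K.subringI) (auto simp: carrier_vring neg cle_refl intro: cle_add cle_neg cle_mul_c1)
  from K.subring_is_ring[OF this] show ?thesis
    by (simp add: vring_def valuation_ring_def)
qed

lemma videal_ideal: "ideal videal vring"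
proof -
  interpret R: ring vring by (rule vring_ring)
  have neg: "\<ominus>\<^bsub>vring\<^esub> x = norm_code (cmul cm1 x)" if "x \<in> carrier vring" for x
    using that by (intro R.minus_equality)
      (auto intro!: nm_cong cle_neg simp: carrier_vring vring_simps nm_0[symmetric] ceq_def \<sigma>_simps)
  show ?thesis
  proof (rule idealI[OF vring_ring])
    show "subgroup videal (add_monoid vring)"
    proof (rule R.add.subgroupI)
      show "videal \<noteq> {}" by (auto simp: videal_eq cle_rc val_le_0 intro!: exI[of _ "rat_elem 0"])
      show "\<ominus>\<^bsub>vring\<^esub> a \<in> videal" if "a \<in> videal" for a
      proof -
        have "a \<in> carrier vring" using that videal_subset by blast
        then show ?thesis using that neg[of a] by (simp add: videal_eq cle_neg)
      qed
    qed (use videal_subset in \<open>auto simp: videal_eq vring_simps intro: cle_add\<close>)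
    fix a x assume *: "a \<in> videal" "x \<in> carrier vring"
    then show "a \<otimes>\<^bsub>vring\<^esub> x \<in> videal"
      by (auto simp: videal_eq carrier_vring vring_simps intro: cle_mul_c1)
    have "x \<otimes>\<^bsub>vring\<^esub> a = a \<otimes>\<^bsub>vring\<^esub> x" by (auto simp: vring_simps intro: nm_cong ceq_mul_commute)
    then show "x \<otimes>\<^bsub>vring\<^esub> a \<in> videal" using \<open>a \<otimes>\<^bsub>vring\<^esub> x \<in> videal\<close> by simp
  qed
qed

lemma residue_iso: "residue_field limK limG limv \<simeq> ZFact (int p)"
proof -
  interpret R: ring vring by (rule vring_ring)
  interpret I: ideal videal vring by (rule videal_ideal)
  let ?Q = "vring Quot videal"
  define h where "h = (\<lambda>n. videal +>\<^bsub>vring\<^esub> rat_elem (of_int n))"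
  have carr: "rat_elem (of_int n) \<in> carrier vring" for n
    by (simp add: carrier_vring cle_c1_iff, rule eventually_mono[OF \<sigma>_rc[of
      "of_int n"]], simp add: val_le_1_of_int)
  have "(\<lambda>n. rat_elem (of_int n)) \<in> ring_hom \<Z> vring"
    by (rule ring_hom_memI) (auto simp: carr vring_simps nm_add_rc nm_mul_rc)
  from ring_hom_trans[OF this I.rcos_ring_hom] have "h \<in> ring_hom \<Z> ?Q"
    by (simp add: h_def comp_def)
  then interpret h: ring_hom_ring \<Z> ?Q h
    by (intro ring_hom_ringI2) (simp_all add: int.ring_axioms I.quotient_is_ring)
  have h_0: "h n = videal \<longleftrightarrow> int p dvd n" for n
  proof -
    have "h n = videal \<longleftrightarrow> rat_elem (of_int n) \<in> videal"
      unfolding h_def using I.rcos_const_imp_mem[OF carr] R.a_rcos_zero[OF videal_ideal] by blast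
    then show ?thesis by (simp add: videal_eq cle_rc val_le_p_of_int)
  qed
  have zero: "\<zero>\<^bsub>?Q\<^esub> = videal" by (simp add: FactRing_def)
  have "n \<in> a_kernel \<Z> ?Q h \<longleftrightarrow> n \<in> Idl\<^bsub>\<Z>\<^esub> {int p}" for n
  proof -
    have "n \<in> a_kernel \<Z> ?Q h \<longleftrightarrow> int p dvd n" by (simp only: a_kernel_def' zero h_0) simp
    also have "\<dots> \<longleftrightarrow> n \<in> Idl\<^bsub>\<Z>\<^esub> {int p}"
      unfolding int_Idl dvd_def mem_Collect_eq by (simp add: mult.commute)
    finally show ?thesis .
  qed
  then have ker: "a_kernel \<Z> ?Q h = Idl\<^bsub>\<Z>\<^esub> {int p}" by blast
  have "h ` carrier \<Z> = carrier ?Q"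
  proof (intro equalityI subsetI)
    fix q assume "q \<in> carrier ?Q"
    then obtain x where x: "x \<in> carrier vring" "q = videal +>\<^bsub>vring\<^esub> x"
      by (auto simp: FactRing_def A_RCOSETS_def')
    \<comment> \<open>If no digit worked, each digit below \<open>p\<close> would fail at all late
      stages by stability; as they are finitely many, all would fail at one common stage, against
      \<open>residue_digit\<close>.\<close>
    obtain d where d: "cle (rat_elem (of_nat p)) (cadd x (rat_elem (- of_nat d)))"
    proof (rule ccontr)
      assume "\<not> thesis"
      then have "\<not> cle (rat_elem (of_nat p)) (cadd x (rat_elem (- of_nat d)))" for d using that
        by blast
      then have "\<not> \<not> cle (cadd x (rat_elem (- of_nat d))) c1" for d
        by (simp only: not_cle_c1_iff simp_thms)
      then have *: "\<forall>\<^sub>F j in sequentially. val_le p (\<sigma> (cadd x (rat_elem (- of_nat d))) j) 1" for d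
        by (simp add: cle_def \<sigma>_simps)
      have "\<forall>\<^sub>F j in sequentially. val_le p (\<sigma> x j - of_nat d) 1" for d
        by (rule eventually_elim2[OF *[of d] \<sigma>_rc[of "- of_nat d"]]) (simp add: \<sigma>_simps)
      then have "\<forall>\<^sub>F j in sequentially. \<forall>d\<in>{..<p}. val_le p (\<sigma> x j - of_nat d) 1"
        by (intro eventually_ball_finite) auto
      moreover have "\<forall>\<^sub>F j in sequentially. val_le p 1 (\<sigma> x j)"
        using x by (simp add: carrier_vring cle_c1_iff)
      ultimately have "\<forall>\<^sub>F j::nat in sequentially. False"
        by (rule eventually_elim2) (use residue_digit val_le_1_iff in blast)
      then show False by simp
    qed
    let ?y = "norm_code (cadd x (rat_elem (- of_nat d)))"
    have y: "?y \<in> videal" using d by (simp add: videal_eq)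
    have "ceq (cadd (cadd x (rat_elem (- of_nat d))) (rat_elem (of_nat d))) x"
      unfolding ceq_def by (rule eventually_elim2[OF \<sigma>_rc[of "- of_nat d"] \<sigma>_rc[of "of_nat d"]])
        (simp add: \<sigma>_simps)
    then have "x = ?y \<oplus>\<^bsub>vring\<^esub> rat_elem (of_int (int d))"
      using x nm_cong by (fastforce simp: vring_simps carrier_vring)
    then have "q = videal +>\<^bsub>vring\<^esub> (?y \<oplus>\<^bsub>vring\<^esub> rat_elem (of_int (int d)))"
      unfolding x(2) by (rule arg_cong)
    also have "\<dots> = (videal +>\<^bsub>vring\<^esub> ?y) \<oplus>\<^bsub>?Q\<^esub> h (int d)"
      unfolding h_def by (rule ring_hom_add[OF I.rcos_ring_hom _ carr])
        (use y videal_subset in blast)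
    also have "videal +>\<^bsub>vring\<^esub> ?y = \<zero>\<^bsub>?Q\<^esub>"
      using R.a_rcos_zero[OF videal_ideal y] by (simp add: zero)
    finally have "q = h (int d)" using h.S.l_zero[OF h.hom_closed[of "int d"]] by simp
    then show "q \<in> h ` carrier \<Z>" by simp
  qed (use h.hom_closed in auto)
  then have "ZFact (int p) \<simeq> ?Q" using h.FactRing_iso ker by (simp add: ZFact_def)
  then have "?Q \<simeq> ZFact (int p)"
    by (rule ring_iso_sym[rotated]) (rule cring.axioms(1)[OF ZFact_is_cring])
  then show ?thesis by (simp add: residue_field_def vring_def videal_def)
qed

theorem limK_formally_padic: "formally_padic p limK limG limv"
  unfolding formally_padic_def
  using limK_valued_field rat_embedding residue_iso p_minimal_value by blast

end

section \<open>Computable sequences generated by radicals of one element\<close>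

text \<open>This norm bounds the lowest nonzero coefficient, and being subadditive and
  submultiplicative it can be tracked through the arithmetic of fractions.\<close>

definition l1_norm :: "int poly \<Rightarrow> int" where "l1_norm P = sum_list (map abs (coeffs P))"

lemma l1_norm_0 [simp]: "l1_norm 0 = 0" and l1_norm_pCons: "l1_norm (pCons a P) = \<bar>a\<bar> + l1_norm P"
  by (auto simp: l1_norm_def cCons_def)

lemma l1_norm_1 [simp]: "l1_norm 1 = 1" and l1_norm_const: "l1_norm [:a:] = \<bar>a\<bar>"
  by (simp_all add: one_pCons l1_norm_pCons)

lemma l1_norm_nonneg: "l1_norm P \<ge> 0" unfolding l1_norm_def by (rule sum_list_nonneg) auto

lemma l1_norm_add: "l1_norm (P + Q) \<le> l1_norm P + l1_norm Q"
proof (induction P Q rule: poly_induct2)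
  case (pCons a P b Q)
  then show ?case using abs_triangle_ineq[of a b] by (simp add: l1_norm_pCons)
qed simp

lemma l1_norm_smult: "l1_norm (smult a P) = \<bar>a\<bar> * l1_norm P"
  by (induction P) (simp_all add: l1_norm_pCons abs_mult algebra_simps)

lemma l1_norm_mult: "l1_norm (P * Q) \<le> l1_norm P * l1_norm Q"
proof (induction P)
  case (pCons a P)
  have "l1_norm (pCons a P * Q) \<le> l1_norm (smult a Q) + l1_norm (pCons 0 (P * Q))"
    by (simp add: l1_norm_add)
  also have "\<dots> \<le> (\<bar>a\<bar> + l1_norm P) * l1_norm Q" using pCons
    by (simp add: l1_norm_pCons l1_norm_smult algebra_simps)
  finally show ?case by (simp add: l1_norm_pCons)
qed simp

lemma l1_norm_monom: "l1_norm (monom a n) = \<bar>a\<bar>"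
  by (induction n) (simp_all add: monom_0 monom_Suc l1_norm_pCons)

context prime_valuation
begin

text \<open>Comparing the orders at \<open>p\<^sup>k\<close> of two polynomials amounts to comparing their pairs \<open>(i, m)\<close>
  lexicographically, independently of \<open>k\<close>.\<close>

lemma poly_valuation:
  assumes "A \<noteq> 0"
  obtains i m where "\<And>k. l1_norm A < int p ^ k \<Longrightarrow> poly A (int p ^ k) \<noteq> 0 \<and>
    multiplicity (int p) (poly A (int p ^ k)) = i * k + m \<and> m < k"
proof -
  have "\<exists>i m. \<forall>k. l1_norm A < int p ^ k \<longrightarrow> poly A (int p ^ k) \<noteq> 0 \<and>
    multiplicity (int p) (poly A (int p ^ k)) = i * k + m \<and> m < k"
    using assms
  proof (induction A)
    case (pCons a B)
    have pfst: "1 < int p" using prime_gt_1_nat[OF prime_p] by simp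
    show ?case
    \<comment> \<open>Each vanishing low coefficient contributes a factor \<open>p ^ k\<close>, that
      is, \<open>k\<close> to the order; so \<open>i\<close> counts them.\<close>
    proof (cases "a = 0")
      case True
      then obtain i m where im: "\<forall>k. l1_norm B < int p ^ k \<longrightarrow> poly B (int p ^ k) \<noteq> 0 \<and>
          multiplicity (int p) (poly B (int p ^ k)) = i * k + m \<and> m < k"
        using pCons by auto
      have "multiplicity (int p) (int p ^ k) = k" for k
        using prime_int_p pfst by
          (intro multiplicity_prime_elem_times_other multiplicity_same_power) auto
      then show ?thesis using im pfst True
        by (intro exI[of _ "Suc i"] exI[of _ m]) (auto simp: l1_norm_pCons mult_mult)
    next
      case False
      \<comment> \<open>The constant coefficient has order below \<open>k\<close> because its
        absolute value is less than \<open>p ^ k\<close>, while the rest is divisible by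
        \<open>p ^ k\<close>; so it alone determines the order.\<close>
      let ?m = "multiplicity (int p) a"
      have "poly (pCons a B) (int p ^ k) \<noteq> 0 \<and>
          multiplicity (int p) (poly (pCons a B) (int p ^ k)) = ?m \<and> ?m < k"
        if k: "l1_norm (pCons a B) < int p ^ k" for k
      proof -
        have "int p ^ ?m \<le> \<bar>a\<bar>"
          using False multiplicity_dvd[of "int p" a] by (intro zdvd_imp_le) auto
        also have "\<dots> < int p ^ k" using k l1_norm_nonneg[of B] by (simp add: l1_norm_pCons)
        finally have m: "?m < k" using pfst power_less_imp_less_exp by blast
        then have "int p ^ Suc ?m dvd int p ^ k * poly B (int p ^ k)"
          by (intro dvd_mult2 le_imp_power_dvd) simp
        moreover have "\<not> int p ^ Suc ?m dvd a"
          using False pfst by (subst power_dvd_iff_le_multiplicity) auto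
        ultimately have 1: "\<not> int p ^ Suc ?m dvd poly (pCons a B) (int p ^ k)"
          by (simp add: dvd_add_left_iff)
        have "int p ^ ?m dvd int p ^ k * poly B (int p ^ k)"
          using m by (intro dvd_mult2 le_imp_power_dvd) simp
        then have "int p ^ ?m dvd poly (pCons a B) (int p ^ k)"
          using multiplicity_dvd[of "int p" a] by simp
        then have "multiplicity (int p) (poly (pCons a B) (int p ^ k)) = ?m"
          using 1 by (rule multiplicity_eqI)
        then show ?thesis using 1 m by auto
      qed
      then show ?thesis by (intro exI[of _ 0] exI[of _ ?m]) simp
    qed
  qed simp
  then show thesis using that by blast
qed

lemma val_le_of_int:
  "val_le p (of_int x) (of_int y) \<longleftrightarrow> y = 0 \<or> x \<noteq> 0 \<and> multiplicity (int p) x \<le> multiplicity (int p) y"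
  by (auto simp: val_le_def padic_order_of_int)

lemma lex_le_iff:
  fixes i m i' m' k :: nat
  assumes "m < k" "m' < k"
  shows "i * k + m \<le> i' * k + m' \<longleftrightarrow> i < i' \<or> i = i' \<and> m \<le> m'"
proof (cases i i' rule: linorder_cases)
  case less
  then have "Suc i * k \<le> i' * k" by (intro mult_le_mono1) simp
  then show ?thesis using less assms by simp
next
  case greater
  then have "Suc i' * k \<le> i * k" by (intro mult_le_mono1) simp
  then show ?thesis using greater assms by simp
qed simp

text \<open>The pairs from \<open>poly_valuation\<close> do not depend on the exponent. The norm
  bounds also keep nonzero polynomials from vanishing at these points, which settles the cases with
  a zero polynomial.\<close>

lemma poly_val_le_stable:
  assumes "l1_norm A < int p ^ k" "l1_norm A < int p ^ k'" "l1_norm B < int p ^ k"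
    "l1_norm B < int p ^ k'"
  shows "val_le p (of_int (poly A (int p ^ k))) (of_int (poly B (int p ^ k))) \<longleftrightarrow>
         val_le p (of_int (poly A (int p ^ k'))) (of_int (poly B (int p ^ k')))"
proof (cases "A = 0 \<or> B = 0")
  case True
  show ?thesis
  proof (cases "B = 0")
    case False
    then obtain i m where "\<And>k. l1_norm B < int p ^ k \<Longrightarrow> poly B (int p ^ k) \<noteq> 0 \<and>
      multiplicity (int p) (poly B (int p ^ k)) = i * k + m \<and> m < k"
      using poly_valuation by metis
    then show ?thesis using assms True False by (simp add: val_le_0_iff)
  qed (simp add: val_le_0)
next
  case False
  then obtain i m where A: "\<And>k. l1_norm A < int p ^ k \<Longrightarrow> poly A (int p ^ k) \<noteq> 0 \<and>
      multiplicity (int p) (poly A (int p ^ k)) = i * k + m \<and> m < k"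
    using poly_valuation by metis
  obtain i' m' where B: "\<And>k. l1_norm B < int p ^ k \<Longrightarrow> poly B (int p ^ k) \<noteq> 0 \<and>
      multiplicity (int p) (poly B (int p ^ k)) = i' * k + m' \<and> m' < k"
    using poly_valuation False by metis
  show ?thesis
    using A[OF assms(1)] A[OF assms(2)] B[OF assms(3)] B[OF assms(4)]
    by (simp add: val_le_of_int lex_le_iff)
qed

end

section \<open>Pairwise coprime moduli and arithmetic of fractions\<close>

definition fermat :: "nat \<Rightarrow> nat" where "fermat e = 2 ^ (2 ^ e) + 1"

text \<open>Goldbach's identity \<open>fermat (Suc n) - 2 = fermat n * (fermat n - 2)\<close>,
  iterated. A common divisor of two Fermat numbers then divides 2, and both are odd.\<close>

lemma fermat_less: "m < n \<Longrightarrow> \<exists>k. fermat n = fermat m * k + 2"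
proof (induction n)
  case (Suc n)
  have gt: "2 \<le> fermat n" using one_le_power[of 2 "2 ^ n"] by (simp add: fermat_def)
  define x :: nat where "x = 2 ^ (2 ^ n)"
  have "1 \<le> x" by (simp add: x_def)
  then have "x * x + 1 = (x + 1) * (x - 1) + 2" by (simp add: algebra_simps)
  then have F: "fermat (Suc n) = fermat n * (fermat n - 2) + 2"
    by (simp add: fermat_def x_def[symmetric] power_mult mult.commute[of 2] power2_eq_square)
  show ?case
  proof (cases "m = n")
    case False
    then obtain k where "fermat n = fermat m * k + 2" using Suc by auto
    then have "fermat n - 2 = fermat m * k" by simp
    then show ?thesis using F by (intro exI[of _ "k * fermat n"]) (simp add: ac_simps)
  qed (use F in blast)
qed simp

lemma coprime_fermat: "m \<noteq> n \<Longrightarrow> coprime (fermat m) (fermat n)"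
proof -
  have *: "coprime (fermat m) (fermat n)" if mn: "m < n" for m n
  proof -
    obtain k where "fermat n = fermat m * k + 2" using fermat_less[OF mn] by blast
    moreover have "coprime (fermat m) 2" by (simp add: fermat_def)
    ultimately show ?thesis
      by (metis coprime_iff_gcd_eq_1 gcd_add_mult mult.commute)
  qed
  assume "m \<noteq> n"
  then show ?thesis using *[of m n] *[of n m] by (cases "m < n") (auto simp: coprime_commute)
qed

text \<open>The triple \<open>(x, y, z)\<close> stands for the rational number \<open>(x - y) / z\<close>.\<close>

abbreviation tr :: "nat \<Rightarrow> nat \<Rightarrow> nat \<Rightarrow> nat" where "tr x y z \<equiv> pair x (pair y z)"
abbreviation t0 :: "nat \<Rightarrow> nat" where "t0 s \<equiv> pfst s"
abbreviation t1 :: "nat \<Rightarrow> nat" where "t1 s \<equiv> pfst (psnd s)"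
abbreviation t2 :: "nat \<Rightarrow> nat" where "t2 s \<equiv> psnd (psnd s)"

definition tadd where
  "tadd s t = tr (t0 s * t2 t + t0 t * t2 s) (t1 s * t2 t + t1 t * t2 s) (t2 s * t2 t)"
definition tmul where
  "tmul s t = tr (t0 s * t0 t + t1 s * t1 t) (t0 s * t1 t + t1 s * t0 t) (t2 s * t2 t)"
text \<open>Denominators are natural numbers, so the sign moves to the numerator. Zero is sent to 0
  / 1, which matches \<open>inverse 0 = 0\<close> and keeps the denominator nonzero.\<close>

definition tinv where
  "tinv s = (if t1 s < t0 s then tr (t2 s) 0 (t0 s - t1 s)
     else if t0 s < t1 s then tr 0 (t2 s) (t1 s - t0 s) else tr 0 0 1)"

definition triple_rat :: "nat \<Rightarrow> rat"
  where "triple_rat s = (of_nat (t0 s) - of_nat (t1 s)) / of_nat (t2 s)"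

lemma triple_rat_tadd: "t2 s \<noteq> 0 \<Longrightarrow> t2 t \<noteq> 0 \<Longrightarrow> triple_rat (tadd s t) = triple_rat s + triple_rat t"
  by (simp add: triple_rat_def tadd_def field_simps)
lemma triple_rat_tmul: "triple_rat (tmul s t) = triple_rat s * triple_rat t"
  by (simp add: triple_rat_def tmul_def field_simps)
lemma triple_rat_tinv: "triple_rat (tinv s) = inverse (triple_rat s)"
  by (auto simp: triple_rat_def tinv_def field_simps)
lemma t2_nonzero: "t2 s \<noteq> 0 \<Longrightarrow> t2 t \<noteq> 0 \<Longrightarrow> t2 (tadd s t) \<noteq> 0"
  "t2 s \<noteq> 0 \<Longrightarrow> t2 t \<noteq> 0 \<Longrightarrow> t2 (tmul s t) \<noteq> 0" "t2 s \<noteq> 0 \<Longrightarrow> t2 (tinv s) \<noteq> 0"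
  by (auto simp: tadd_def tmul_def tinv_def)

text \<open>A nonzero remainder excludes the code 0, the only one with \<open>c div 5 = c\<close>;
  this gives termination of the evaluation of trees.\<close>

lemma arg_less: "c mod 5 \<noteq> 0 \<Longrightarrow> pfst (c div 5) < c" "c mod 5 \<noteq> 0 \<Longrightarrow> psnd (c div 5) < c"
  "c mod 5 \<noteq> 0 \<Longrightarrow> c div 5 < c"
  using pfst_psnd_le(1)[of "c div 5"] pfst_psnd_le(2)[of "c div 5"]
    by (auto intro: gr0I le_less_trans div_less_dividend)

text \<open>A number \<open>d\<close> with \<open>V d\<close> is a requirement: the residue of the value of \<open>t\<close> modulo \<open>fermat
  (a d)\<close> must be \<open>b d\<close>.\<close>

locale construction = prime_valuation +
  fixes V :: "nat \<Rightarrow> bool" and a b :: "nat \<Rightarrow> nat"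
  assumes rec_pred_V: "rec_pred 1 (\<lambda>e. V (hd e))" and rec_a: "rec_fun 1 (\<lambda>e. a (hd e))"
    and rec_b: "rec_fun 1 (\<lambda>e. b (hd e))"
    and b_le: "b d \<le> 1" and inj_a: "inj_on a {d. V d}"
begin

section \<open>Exponents that meet the requirements\<close>

definition modulus :: "nat \<Rightarrow> nat" where "modulus d = fermat (a d)"

lemma modulus_gt: "2 < modulus d"
proof -
  have "(2::nat) ^ 1 \<le> 2 ^ (2 ^ a d)" by (rule power_increasing) auto
  then show ?thesis by (simp add: modulus_def fermat_def)
qed

lemma coprime_modulus: "V d \<Longrightarrow> V d' \<Longrightarrow> d \<noteq> d' \<Longrightarrow> coprime (modulus d) (modulus d')"
  using inj_a coprime_fermat unfolding modulus_def by (metis inj_onD mem_Collect_eq)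

text \<open>\<open>mod_prod n\<close> is the product of the moduli of the requirements below \<open>n\<close>, and \<open>t_exp j\<close> is
  the \<open>p\<close>-adic order of \<open>t\<close> at stage \<open>j\<close>. The lower bound in \<open>next_exp\<close> exceeds what is needed
  to read off the order of a polynomial in \<open>p\<^sup>x\<close>, \<open>x = (t_exp j - t_exp n) / mod_prod n\<close>, from
  its lowest coefficient, for all polynomials that arise from codes up to \<open>n\<close>.\<close>

primrec mod_prod :: "nat \<Rightarrow> nat" where
  "mod_prod 0 = 1"
| "mod_prod (Suc j) = (if V j then modulus j else 1) * mod_prod j"

lemma mod_prod_pos: "mod_prod j > 0" using modulus_gt
  by (induction j) (auto intro: less_trans[of 0 2])

lemma coprime_mod_prod: "V d \<Longrightarrow> n \<le> d \<Longrightarrow> coprime (modulus d) (mod_prod n)"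
  by (induction n) (auto simp: coprime_modulus)

lemma modulus_dvd_mod_prod: "V d \<Longrightarrow> d < n \<Longrightarrow> modulus d dvd mod_prod n"
  by (induction n) (auto simp: less_Suc_eq)

definition next_exp :: "nat \<Rightarrow> nat \<Rightarrow> nat \<Rightarrow> bool" where
  "next_exp j x m \<longleftrightarrow> x + mod_prod j * Suc ((x + 1) * (6 * j + 2)) \<le> m \<and>
     (\<forall>d<Suc j. V d \<longrightarrow> m mod modulus d = b d)"

primrec t_exp :: "nat \<Rightarrow> nat" where
  "t_exp 0 = 0"
| "t_exp (Suc j) = (LEAST m. next_exp j (t_exp j) m)"

text \<open>The Chinese remainder theorem provides the residues; adding a multiple of
  \<open>mod_prod (Suc j)\<close> makes the exponent as large as required without changing
  them.\<close>

lemma next_exp_exists: "\<exists>m. next_exp j x m"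
proof -
  define A where "A = {d. d < Suc j \<and> V d}"
  have "finite A" by (simp add: A_def)
  then obtain y where y: "\<forall>d\<in>A. [y = b d] (mod modulus d)"
    using chinese_remainder_nat[of A modulus b] coprime_modulus by (auto simp: A_def)
  define B where "B = x + mod_prod j * Suc ((x + 1) * (6 * j + 2))"
  have "(y + B * mod_prod (Suc j)) mod modulus d = b d" if d: "d < Suc j" "V d" for d
  proof -
    obtain k where k: "mod_prod (Suc j) = modulus d * k" using modulus_dvd_mod_prod[OF d(2,1)]
      by (auto simp: dvd_def)
    have "(y + B * mod_prod (Suc j)) mod modulus d = (y + modulus d * (B * k)) mod modulus d"
      unfolding k by (simp only: ac_simps)
    also have "\<dots> = y mod modulus d" by simp
    also have "\<dots> = b d mod modulus d" using y d by (auto simp: A_def cong_def)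
    also have "\<dots> = b d" using b_le[of d] modulus_gt[of d] by simp
    finally show ?thesis .
  qed
  moreover have "B \<le> y + B * mod_prod (Suc j)"
    using mod_prod_pos[of "Suc j"] mult_le_mono2[of 1 "mod_prod (Suc j)" B] by linarith
  ultimately have "next_exp j x (y + B * mod_prod (Suc j))" unfolding next_exp_def B_def by blast
  then show ?thesis by blast
qed

lemma next_exp_t_exp: "next_exp j (t_exp j) (t_exp (Suc j))"
  using LeastI_ex[OF next_exp_exists] by simp

lemma t_exp_mod: "d < j \<Longrightarrow> V d \<Longrightarrow> t_exp j mod modulus d = b d"
  using next_exp_t_exp[of "j - 1"] by (cases j) (auto simp: next_exp_def simp del: t_exp.simps)

lemma t_exp_growth: "n < j \<Longrightarrow> t_exp n + mod_prod n * Suc ((t_exp n + 1) * (6 * n + 2)) \<le> t_exp j"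
proof (induction j)
  case (Suc j)
  have "t_exp j \<le> t_exp (Suc j)" using next_exp_t_exp[of j]
    by (auto simp: next_exp_def simp del: t_exp.simps)
  then show ?case using Suc next_exp_t_exp[of n]
    by (cases "n = j") (auto simp: next_exp_def simp del: t_exp.simps)
qed simp

lemma t_exp_mono: "n \<le> j \<Longrightarrow> t_exp n \<le> t_exp j"
  using t_exp_growth[of n j] by (cases "n = j") auto

definition scale_exp :: "nat \<Rightarrow> nat \<Rightarrow> nat" where "scale_exp n j = (t_exp j - t_exp n) div mod_prod n"

text \<open>A requirement below \<open>n\<close> is met at stage \<open>n\<close> and at every later
  stage, so its modulus divides the difference of the two exponents; by coprimality so does the
  product of these moduli.\<close>

lemma t_exp_decomp: assumes "n \<le> j" shows "t_exp j = t_exp n + mod_prod n * scale_exp n j"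
proof -
  have "k \<le> n \<Longrightarrow> mod_prod k dvd t_exp j - t_exp n" for k
  proof (induction k)
    case (Suc k)
    then have mod_prod: "mod_prod k dvd t_exp j - t_exp n" by simp
    show ?case
    proof (cases "V k")
      case True
      then have "t_exp n mod modulus k = t_exp j mod modulus k"
        using t_exp_mod[of k] Suc.prems assms by simp
      then have "modulus k dvd t_exp j - t_exp n" using t_exp_mono[OF assms]
        by (metis mod_eq_dvd_iff_nat)
      then show ?thesis using divides_mult[OF _ mod_prod coprime_mod_prod[OF True]] True by simp
    qed (use mod_prod in simp)
  qed simp
  then show ?thesis using t_exp_mono[OF assms] by (simp add: scale_exp_def)
qed

lemma scale_exp_gt: "n < j \<Longrightarrow> (t_exp n + 1) * (6 * n + 2) < scale_exp n j"
  using t_exp_growth[of n j] mod_prod_pos[of n] unfolding scale_exp_def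
  by (subst Suc_le_eq[symmetric], subst less_eq_div_iff_mult_less_eq) (auto simp: mult.commute)

text \<open>Index \<open>0\<close> is \<open>t\<close> itself and index \<open>Suc d\<close> the root adjoined for the requirement \<open>d\<close>.
  Before stage \<open>Suc d\<close> the division is not exact, which does not matter for eventual equality.\<close>

definition gen_exp :: "nat \<Rightarrow> nat \<Rightarrow> nat" where
  "gen_exp i j =
    (if i = 0 then t_exp j
     else if V (i - 1) then (t_exp j - b (i - 1)) div modulus (i - 1) else 0)"

text \<open>Since \<open>t_exp\<close> grows in multiples of \<open>mod_prod n\<close>, which
  \<open>modulus d\<close> divides for a requirement \<open>d < n\<close>, the exponent of the root
  grows linearly in \<open>scale_exp n j\<close> too, with slope \<open>mod_prod n\<close> divided
  by \<open>modulus d\<close>.\<close>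

lemma gen_exp_decomp: assumes "i \<le> n" obtains \<beta>
  where "\<And>j. n \<le> j \<Longrightarrow> gen_exp i j = gen_exp i n + \<beta> * scale_exp n j"
proof (cases "i = 0 \<or> \<not> V (i - 1)")
  case True
  then show ?thesis using that[of "if i = 0 then mod_prod n else 0"] t_exp_decomp
    by (auto simp: gen_exp_def)
next
  case False
  define d where "d = i - 1"
  have d: "V d" "d < n" "i = Suc d" using False assms by (auto simp: d_def)
  obtain \<beta> where \<beta>: "mod_prod n = modulus d * \<beta>" using modulus_dvd_mod_prod[OF d(1,2)]
    by (auto simp: dvd_def)
  \<comment> \<open>Without this the truncated subtraction of \<open>b d\<close> would lose
    information.\<close>
  have "b d \<le> t_exp n" using t_exp_mod[OF d(2,1)] mod_less_eq_dividend by metis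
  then have *: "t_exp j - b d = (t_exp n - b d) + modulus d * (\<beta> * scale_exp n j)" if "n \<le> j" for j
    using t_exp_decomp[OF that] \<beta> by simp
  have "gen_exp i j = gen_exp i n + \<beta> * scale_exp n j" if "n \<le> j" for j
  proof -
    have "(t_exp j - b d) div modulus d = \<beta> * scale_exp n j + (t_exp n - b d) div modulus d"
      unfolding *[OF that] using modulus_gt[of d] by (intro div_mult_self2) simp
    then show ?thesis using d by (simp add: gen_exp_def)
  qed
  then show thesis by (rule that)
qed

lemma gen_exp_le: "gen_exp i n \<le> t_exp n"
  using order.trans[OF div_le_dividend diff_le_self, of "t_exp n" "b (i - 1)" "modulus (i - 1)"]
  by (simp add: gen_exp_def)

text \<open>Codes of field elements are syntax trees with leaves \<open>-1\<close> and the generators; the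
  remainder modulo \<open>5\<close> selects the node type.\<close>

function tree_val :: "nat \<Rightarrow> nat \<Rightarrow> nat" where
  "tree_val c j =
    (if c mod 5 = 0 then tr 0 1 1
     else if c mod 5 = 1 then tr (p ^ gen_exp (c div 5) j) 0 1
     else if c mod 5 = 2 then tadd (tree_val (pfst (c div 5)) j) (tree_val (psnd (c div 5)) j)
     else if c mod 5 = 3 then tmul (tree_val (pfst (c div 5)) j) (tree_val (psnd (c div 5)) j)
     else tinv (tree_val (c div 5) j))"
  by pat_completeness auto
termination by (relation "measure fst") (use arg_less in auto)

declare tree_val.simps [simp del]

definition \<sigma> where "\<sigma> c j = triple_rat (tree_val c j)"
definition cgen :: "nat \<Rightarrow> nat" where "cgen i = 5 * i + 1"
definition cadd where "cadd x y = 5 * pair x y + 2"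
definition cmul where "cmul x y = 5 * pair x y + 3"
definition cinv :: "nat \<Rightarrow> nat" where "cinv x = 5 * x + 4"

lemma code_cases:
  obtains "c = 5 * (c div 5)" "c mod 5 = 0" | i where "c = cgen i" | x y where "c = cadd x y"
  | x y where "c = cmul x y" | x where "c = cinv x"
proof -
  have c: "c = 5 * (c div 5) + c mod 5" by simp
  have "c mod 5 < 5" by simp
  then consider "c mod 5 = 0" | "c mod 5 = 1" | "c mod 5 = 2" | "c mod 5 = 3" | "c mod 5 = 4"
    by linarith
  then show thesis
  proof cases
    case 1 then show ?thesis using that(1) c by simp
  next
    case 2 then show ?thesis using that(2) c by (simp add: cgen_def)
  next
    case 3 then show ?thesis using that(3)[of "pfst (c div 5)" "psnd (c div 5)"] c
      by (simp add: cadd_def)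
  next
    case 4 then show ?thesis using that(4)[of "pfst (c div 5)" "psnd (c div 5)"] c
      by (simp add: cmul_def)
  next
    case 5 then show ?thesis using that(5) c by (simp add: cinv_def)
  qed
qed

lemma code_sel:
  "cgen i mod 5 = 1" "cgen i div 5 = i" "cadd x y mod 5 = 2" "cadd x y div 5 = pair x y"
  "cmul x y mod 5 = 3" "cmul x y div 5 = pair x y" "cinv x mod 5 = 4" "cinv x div 5 = x"
  unfolding cgen_def cadd_def cmul_def cinv_def by presburger+

lemma tree_val_simps:
  "c mod 5 = 0 \<Longrightarrow> tree_val c j = tr 0 1 1" "tree_val (cgen i) j = tr (p ^ gen_exp i j) 0 1"
  "tree_val (cadd x y) j = tadd (tree_val x j) (tree_val y j)" "tree_val (cmul x y) j =
    tmul (tree_val x j) (tree_val y j)"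
  "tree_val (cinv x) j = tinv (tree_val x j)"
  by (subst tree_val.simps, simp add: code_sel)+

lemma less_code: "i < cgen i" "x < cadd x y" "y < cadd x y" "x < cmul x y" "y < cmul x y"
  "x < cinv x"
  using le_prod_encode_1[of x y] le_prod_encode_2[of y x]
  by (auto simp: cgen_def cadd_def cmul_def cinv_def)

lemma t2_tree_val: "t2 (tree_val c j) \<noteq> 0"
proof (induction c rule: less_induct)
  case (less c)
  show ?case
    by (cases c rule: code_cases) (use less less_code in \<open>auto simp: tree_val_simps t2_nonzero\<close>)
qed

lemma \<sigma>_eval:
  "c mod 5 = 0 \<Longrightarrow> \<sigma> c j = - 1" "\<sigma> (cgen i) j = of_nat p ^ gen_exp i j"
  "\<sigma> (cadd x y) j = \<sigma> x j + \<sigma> y j" "\<sigma> (cmul x y) j = \<sigma> x j * \<sigma> y j"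
  "\<sigma> (cinv x) j = inverse (\<sigma> x j)"
  unfolding \<sigma>_def tree_val_simps
  by (simp_all add: tree_val_simps triple_rat_tadd triple_rat_tmul triple_rat_tinv t2_tree_val)
    (simp_all add: triple_rat_def)

end

lemma computable_setI: "rec_pred 1 (\<lambda>e. hd e \<in> A) \<Longrightarrow> computable_set A"
proof -
  assume "rec_pred 1 (\<lambda>e. hd e \<in> A)"
  then obtain r where r: "\<And>e. length e = 1 \<Longrightarrow> reval r e (if hd e \<in> A then 1 else 0)"
    unfolding rec_pred_def rec_fun_def by blast
  have "reval r [x] (if x \<in> A then 1 else 0)" for x using r[of "[x]"] by simp
  then show ?thesis unfolding computable_set_def by blast
qed

lemma computable_funI: "rec_fun 1 (\<lambda>e. f (hd e)) \<Longrightarrow> computable_fun A f"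
proof -
  assume "rec_fun 1 (\<lambda>e. f (hd e))"
  then obtain r where r: "\<And>e. length e = 1 \<Longrightarrow> reval r e (f (hd e))"
    unfolding rec_fun_def by blast
  have "reval r [x] (f x)" for x using r[of "[x]"] by simp
  then show ?thesis unfolding computable_fun_def by blast
qed

lemma computable_opI: "rec_fun 2 (\<lambda>e. f (hd e) (hd (tl e))) \<Longrightarrow> computable_op A f"
proof -
  assume "rec_fun 2 (\<lambda>e. f (hd e) (hd (tl e)))"
  then obtain r where r: "\<And>e. length e = 2 \<Longrightarrow> reval r e (f (hd e) (hd (tl e)))"
    unfolding rec_fun_def by blast
  have "reval r [x, y] (f x y)" for x y using r[of "[x, y]"] by simp
  then show ?thesis unfolding computable_op_def by blast
qed

lemma computable_relI: "rec_pred 2 (\<lambda>e. R (hd e) (hd (tl e))) \<Longrightarrow> computable_rel A R"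
  unfolding computable_rel_def rec_pred_def by (rule computable_opI)

section \<open>Decidability of the eventual comparison\<close>

context construction
begin

text \<open>The base dominates the coefficients \<open>p ^ gen_exp i n\<close> of the generators and
  is at least 2. With exponent linear in the code, a node whose arguments have sum below
  \<open>c\<close> can absorb both heights and the factor 2 from adding two products.\<close>

definition height :: "nat \<Rightarrow> nat \<Rightarrow> int" where "height n c = (2 * int p ^ t_exp n) ^ (3 * c + 1)"

lemma base_gt_1: "1 < 2 * int p ^ t_exp n"
proof -
  have "1 \<le> int p ^ t_exp n" using prime_gt_0_nat[OF prime_p] by (intro one_le_power) simp
  then show ?thesis by simp
qed

lemma height_mono: "x \<le> y \<Longrightarrow> height n x \<le> height n y"
  unfolding height_def using base_gt_1[of n] by (intro power_increasing) auto

lemma height_pos: "0 < height n x"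
  unfolding height_def using base_gt_1[of n] by (intro zero_less_power) linarith

lemma height_prod: assumes "x + y < c" shows "2 * (height n x * height n y) \<le> height n c"
proof -
  define C where "C = 2 * int p ^ t_exp n"
  have C: "2 \<le> C" using base_gt_1[of n] by (simp add: C_def)
  have h: "height n z = C ^ (3 * z + 1)" for z by (simp only: height_def C_def)
  have "2 * (height n x * height n y) = 2 * C ^ (3 * (x + y) + 2)"
    unfolding h power_add[symmetric] by (simp add: algebra_simps)
  moreover have "2 * C ^ (3 * (x + y) + 2) \<le> C * C ^ (3 * (x + y) + 2)"
    using C by (intro mult_right_mono) auto
  moreover have "C * C ^ (3 * (x + y) + 2) = C ^ (3 * (x + y) + 3)"
    unfolding power_Suc[symmetric] by (simp add: eval_nat_numeral)
  moreover have "C ^ (3 * (x + y) + 3) \<le> height n c"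
    unfolding h using assms C by (intro power_increasing) auto
  ultimately show ?thesis by linarith
qed

text \<open>The pairing bounds each argument separately, so the sum is at most twice the pair; the
  factor 5 in the codes leaves room for that.\<close>

lemma sum_less_code: "x + y < cadd x y" "x + y < cmul x y"
proof -
  have "x + y \<le> 2 * pair x y" using le_prod_encode_1[of x y] le_prod_encode_2[of y x] by simp
  then show "x + y < cadd x y" "x + y < cmul x y" by (auto simp: cadd_def cmul_def)
qed

text \<open>From stage \<open>n\<close> on, all generators with index up to \<open>n\<close> are monomials in the common
  uniformiser \<open>p ^ scale_exp n j\<close>, so that every tree up to \<open>n\<close> becomes a rational function of
  it.\<close>

definition represents :: "nat \<Rightarrow> nat \<Rightarrow> int poly \<Rightarrow> int poly \<Rightarrow> bool" where
  "represents n c P Q \<longleftrightarrow> Q \<noteq> 0 \<and> l1_norm P \<le> height n c \<and> l1_norm Q \<le> height n c \<and>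
     (\<forall>j\<ge>n. height n c < int p ^ scale_exp n j \<longrightarrow>
        \<sigma> c j = of_int (poly P (int p ^ scale_exp n j)) / of_int (poly Q (int p ^ scale_exp n j)))"

lemma poly_nonzero: "A \<noteq> 0 \<Longrightarrow> l1_norm A < int p ^ k \<Longrightarrow> poly A (int p ^ k) \<noteq> 0"
  using poly_valuation by metis

lemma representsD:
  assumes "represents n c P Q" "n \<le> j" "height n c < int p ^ scale_exp n j"
  shows "\<sigma> c j = of_int (poly P (int p ^ scale_exp n j)) / of_int (poly Q (int p ^ scale_exp n j))"
    "poly Q (int p ^ scale_exp n j) \<noteq> 0" "P \<noteq> 0 \<Longrightarrow> poly P (int p ^ scale_exp n j) \<noteq> 0"
  using assms poly_nonzero[of Q "scale_exp n j"] poly_nonzero[of P "scale_exp n j"]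
    by (auto simp: represents_def)

lemma l1_norm_mult_le:
  assumes "l1_norm A \<le> x" "l1_norm B \<le> y" shows "l1_norm (A * B) \<le> x * y" "l1_norm (B * A) \<le> x * y"
proof -
  have "l1_norm A * l1_norm B \<le> x * y"
    using assms l1_norm_nonneg[of A] l1_norm_nonneg[of B] by (intro mult_mono) linarith+
  then show "l1_norm (A * B) \<le> x * y" "l1_norm (B * A) \<le> x * y"
    using l1_norm_mult[of A B] by (simp_all add: mult.commute)
qed

lemma represents_l1:
  assumes "represents n c P Q" shows "l1_norm P \<le> height n c" "l1_norm Q \<le> height n c"
  using assms by (simp_all add: represents_def)

lemma represents_exists: "c \<le> n \<Longrightarrow> \<exists>P Q. represents n c P Q"
proof (induction c rule: less_induct)
  case (less c)
  have const: "1 \<le> height n x" for x using height_pos[of n x] by simp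
  show ?case
  proof (cases c rule: code_cases)
    case 1
    then show ?thesis
      using const by (intro exI[of _ "[:-1:]"] exI[of _ 1])
        (simp add: represents_def l1_norm_const \<sigma>_eval)
  next
    case (2 i)
    have "i \<le> n" using less.prems less_code(1)[of i] 2 by simp
    then obtain \<beta> where \<beta>: "\<And>j. n \<le> j \<Longrightarrow> gen_exp i j = gen_exp i n + \<beta> * scale_exp n j"
      using gen_exp_decomp by blast
    \<comment> \<open>The generator becomes a monomial of degree \<open>\<beta>\<close> with
      coefficient \<open>p ^ gen_exp i n\<close>, whose norm has to stay below the height.\<close>
    have "int p ^ gen_exp i n \<le> int p ^ t_exp n"
      using gen_exp_le prime_gt_0_nat[OF prime_p] by (intro power_increasing) auto
    also have "\<dots> \<le> (2 * int p ^ t_exp n) ^ 1" by simp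
    also have "\<dots> \<le> height n c"
      unfolding height_def using base_gt_1[of n] by (intro power_increasing) auto
    finally have "l1_norm (monom (int p ^ gen_exp i n) \<beta>) \<le> height n c" by (simp add: l1_norm_monom)
    moreover have "\<sigma> c j = of_int (poly (monom (int p ^ gen_exp i n) \<beta>) (int p ^ scale_exp n j))"
      if "n \<le> j" for j
    proof -
      have "(int p ^ scale_exp n j) ^ \<beta> = int p ^ (\<beta> * scale_exp n j)"
        by (subst mult.commute) (rule power_mult[symmetric])
      then show ?thesis using \<beta>[OF that] by (simp add: 2 \<sigma>_eval poly_monom power_add)
    qed
    ultimately have "represents n c (monom (int p ^ gen_exp i n) \<beta>) 1"
      using const unfolding represents_def by simp
    then show ?thesis by blast
  next
    case (3 x y)
    obtain P Q R S where *: "represents n x P Q" "represents n y R S"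
      using less.IH[of x] less.IH[of y] less.prems less_code 3 by (metis le_trans less_imp_le)
    have le: "height n x \<le> height n c" "height n y \<le> height n c"
      using height_mono less_code 3 by (metis less_imp_le)+
    have prods: "l1_norm (P * S) \<le> height n x * height n y"
      "l1_norm (R * Q) \<le> height n x * height n y"
      "l1_norm (Q * S) \<le> height n x * height n y"
      by (intro l1_norm_mult_le represents_l1[OF *(1)] represents_l1[OF *(2)])+
    have b: "2 * (height n x * height n y) \<le> height n c" using height_prod sum_less_code 3 by metis
    have "l1_norm (P * S + R * Q) \<le> height n c" using l1_norm_add[of "P * S" "R * Q"] prods b
      by linarith
    moreover have "l1_norm (Q * S) \<le> height n c"
      using prods b mult_pos_pos[OF height_pos height_pos, of n x n y] by linarith
    ultimately show ?thesis
      using * le representsD[OF *(1)] representsD[OF *(2)]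
      by (intro exI[of _ "P * S + R * Q"] exI[of _ "Q * S"])
         (auto simp: represents_def 3 \<sigma>_eval add_divide_distrib)
  next
    case (4 x y)
    obtain P Q R S where *: "represents n x P Q" "represents n y R S"
      using less.IH[of x] less.IH[of y] less.prems less_code 4 by (metis le_trans less_imp_le)
    have le: "height n x \<le> height n c" "height n y \<le> height n c"
      using height_mono less_code 4 by (metis less_imp_le)+
    have prods: "l1_norm (P * R) \<le> height n x * height n y"
      "l1_norm (Q * S) \<le> height n x * height n y"
      by (intro l1_norm_mult_le represents_l1[OF *(1)] represents_l1[OF *(2)])+
    have "2 * (height n x * height n y) \<le> height n c" using height_prod sum_less_code 4 by metis
    then have "l1_norm (P * R) \<le> height n c" "l1_norm (Q * S) \<le> height n c"
      using prods mult_pos_pos[OF height_pos height_pos, of n x n y] by linarith+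
    then show ?thesis
      using * le representsD[OF *(1)] representsD[OF *(2)]
      by (intro exI[of _ "P * R"] exI[of _ "Q * S"]) (auto simp: represents_def 4 \<sigma>_eval)
  next
    case (5 x)
    obtain P Q where *: "represents n x P Q"
      using less.IH[of x] less.prems less_code 5 by (metis le_trans less_imp_le)
    have le: "height n x \<le> height n c"
      using height_mono less_code 5 by (metis less_imp_le)
    show ?thesis
    \<comment> \<open>Numerator and denominator may be exchanged only if the former is not the zero
      polynomial; the inverse of zero is zero.\<close>
    proof (cases "P = 0")
      case True
      then show ?thesis using * le const representsD[OF *]
        by (intro exI[of _ 0] exI[of _ 1]) (auto simp: represents_def 5 \<sigma>_eval)
    next
      case False
      then show ?thesis using * le representsD[OF *]
        by (intro exI[of _ Q] exI[of _ P]) (auto simp: represents_def 5 \<sigma>_eval)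
    qed
  qed
qed

text \<open>This is the origin of the bound in \<open>next_exp\<close>: the exponents
  \<open>3 * x + 1\<close> and \<open>3 * y + 1\<close> of two heights add up to at most
  \<open>6 * n + 2\<close>, and their base \<open>2 * p ^ t_exp n\<close> is at most
  \<open>p ^ (t_exp n + 1)\<close>.\<close>

lemma height_less_power:
  assumes "x \<le> n" "y \<le> n" "n < j" shows "height n x * height n y < int p ^ scale_exp n j"
proof -
  define C where "C = 2 * int p ^ t_exp n"
  have C: "2 \<le> C" using base_gt_1[of n] by (simp add: C_def)
  have h: "height n z = C ^ (3 * z + 1)" for z by (simp only: height_def C_def)
  have p: "2 \<le> int p" using prime_ge_2_nat[OF prime_p] by simp
  have "height n x * height n y = C ^ (3 * (x + y) + 2)"
    unfolding h power_add[symmetric] by (simp add: algebra_simps)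
  moreover have "C ^ (3 * (x + y) + 2) \<le> C ^ (6 * n + 2)"
    using assms C by (intro power_increasing) auto
  moreover have "C ^ (6 * n + 2) \<le> (int p ^ (t_exp n + 1)) ^ (6 * n + 2)"
    using p C by (intro power_mono) (auto simp: C_def)
  moreover have "(int p ^ (t_exp n + 1)) ^ (6 * n + 2) = int p ^ ((t_exp n + 1) * (6 * n + 2))"
    by (rule power_mult[symmetric])
  moreover have "int p ^ ((t_exp n + 1) * (6 * n + 2)) < int p ^ scale_exp n j"
    using scale_exp_gt[OF assms(3)] p by (intro power_strict_increasing) auto
  ultimately show ?thesis by linarith
qed

lemma ple_\<sigma>_stable:
  assumes "x \<le> n" "y \<le> n" "n < j" "n < j'"
  shows "val_le p (\<sigma> x j) (\<sigma> y j) \<longleftrightarrow> val_le p (\<sigma> x j') (\<sigma> y j')"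
proof -
  obtain P Q R S where *: "represents n x P Q" "represents n y R S"
    using represents_exists assms by metis
  have red: "val_le p (\<sigma> x j) (\<sigma> y j) \<longleftrightarrow>
      val_le p (of_int (poly (P * S) (int p ^ scale_exp n j))) (of_int (poly (R * Q)
        (int p ^ scale_exp n j)))"
    if "n < j" for j
  proof -
    have lt: "height n x * height n y < int p ^ scale_exp n j" using height_less_power assms that
      by blast
    have "height n x \<le> height n x * height n y" "height n y \<le> height n x * height n y"
      using height_pos[of n x] height_pos[of n y]
      by (simp_all add: mult_le_cancel_left1 mult_le_cancel_right1)
    then have "height n x < int p ^ scale_exp n j" "height n y < int p ^ scale_exp n j" using lt
      by linarith+
    note r = representsD[OF *(1) _ this(1)] representsD[OF *(2) _ this(2)]
    \<comment> \<open>Multiplying by both denominators leaves integer polynomials whose norms are at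
      most the product of the two heights.\<close>
    let ?z = "of_int (poly Q (int p ^ scale_exp n j)) * of_int (poly S (int p ^ scale_exp n j)) ::
      rat"
    have "?z \<noteq> 0" using r that by simp
    then have "val_le p (\<sigma> x j) (\<sigma> y j) \<longleftrightarrow> val_le p (\<sigma> x j * ?z) (\<sigma> y j * ?z)"
      by (rule val_le_mult_iff[symmetric])
    also have "\<sigma> x j * ?z = of_int (poly (P * S) (int p ^ scale_exp n j))" using r that by simp
    also have "\<sigma> y j * ?z = of_int (poly (R * Q) (int p ^ scale_exp n j))" using r that by simp
    finally show ?thesis .
  qed
  have l: "l1_norm (P * S) \<le> height n x * height n y" "l1_norm (R * Q) \<le> height n x * height n y"
    by (intro l1_norm_mult_le represents_l1[OF *(1)] represents_l1[OF *(2)])+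
  have "l1_norm (P * S) < int p ^ scale_exp n j" "l1_norm (R * Q) < int p ^ scale_exp n j"
    if "n < j" for j
    using l height_less_power[OF assms(1,2) that] by linarith+
  then show ?thesis unfolding red[OF assms(3)] red[OF assms(4)]
    using assms(3,4) by (intro poly_val_le_stable) auto
qed

lemma eventually_ple_\<sigma>:
  assumes "val_le p (\<sigma> x (Suc (x + y))) (\<sigma> y (Suc (x + y))) \<longleftrightarrow> B"
  shows "\<forall>\<^sub>F j in sequentially. val_le p (\<sigma> x j) (\<sigma> y j) \<longleftrightarrow> B"
  unfolding eventually_sequentially
  using ple_\<sigma>_stable[of x "x + y" y "Suc (x + y)"] assms by (intro exI[of _ "Suc (x + y)"]) auto

text \<open>The number 0 is divisible by 5, hence a leaf with value -1, and serves as
  \<open>cm1\<close>.\<close>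

sublocale limit_field p \<sigma> cadd cmul cinv 0
proof (unfold_locales, goal_cases)
  case (5 x y)
  then show ?case using eventually_ple_\<sigma>[of x y]
    by (cases "val_le p (\<sigma> x (Suc (x + y))) (\<sigma> y (Suc (x + y)))") auto
qed (simp_all add: \<sigma>_eval)

text \<open>\<open>x + y\<close> bounds both codes, so the comparison no longer changes after that
  stage and a single evaluation decides it.\<close>

lemma cle_iff: "cle x y \<longleftrightarrow> val_le p (\<sigma> x (Suc (x + y))) (\<sigma> y (Suc (x + y)))"
  using eventually_ple_\<sigma>[of x y True] eventually_ple_\<sigma>[of x y False] not_cle[of x y]
  by (auto simp: cle_def)

section \<open>Computability of the constructed field\<close>

lemma rec_modulus [rec_intro]: "rec_fun n A \<Longrightarrow> rec_fun n (\<lambda>e. modulus (A e))"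
  unfolding modulus_def fermat_def by (intro rec_intro rec_lift1[where f = a, OF rec_a])

lemma rec_pred_V' [rec_intro]: "rec_fun n A \<Longrightarrow> rec_pred n (\<lambda>e. V (A e))"
  by (rule rec_pred_lift1[where f = V, OF rec_pred_V])

lemma rec_b' [rec_intro]: "rec_fun n A \<Longrightarrow> rec_fun n (\<lambda>e. b (A e))"
  by (rule rec_lift1[where f = b, OF rec_b])

lemma rec_mod_prod [rec_intro]: assumes "rec_fun n A" shows "rec_fun n (\<lambda>e. mod_prod (A e))"
proof (rule rec_lift1[where f = mod_prod, OF _ assms])
  have "rec_fun (Suc 0) (\<lambda>e. mod_prod (hd e))"
    by (rule rec_primrec[where F = "\<lambda>_. 1" and G = "\<lambda>k y xs. (if V k then modulus k else 1) * y"
          and f = "\<lambda>k xs. mod_prod k"])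
       (auto intro!: rec_intro)
  then show "rec_fun 1 (\<lambda>e. mod_prod (hd e))" by simp
qed

lemma rec_pred_next_exp: "rec_pred 3 (\<lambda>e. next_exp (hd e) (hd (tl e)) (hd (tl (tl e))))"
  unfolding next_exp_def by (intro rec_intro; simp)

lemma rec_t_exp [rec_intro]: assumes "rec_fun n A" shows "rec_fun n (\<lambda>e. t_exp (A e))"
proof (rule rec_lift1[where f = t_exp, OF _ assms])
  have "rec_fun (Suc 0) (\<lambda>e. t_exp (hd e))"
  proof (rule rec_primrec[where F = "\<lambda>_. 0" and G = "\<lambda>k y xs. LEAST m. next_exp k y m"
        and f = "\<lambda>k xs. t_exp k"])
    show "rec_fun (Suc (Suc 0)) (\<lambda>e. LEAST m. next_exp (hd e) (hd (tl e)) m)"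
      by (intro rec_Least rec_pred_lift3[where f = next_exp, OF rec_pred_next_exp] rec_var
        next_exp_exists) simp_all
  qed (auto intro!: rec_intro)
  then show "rec_fun 1 (\<lambda>e. t_exp (hd e))" by simp
qed

lemma rec_gen_exp [rec_intro]: "rec_fun n A \<Longrightarrow> rec_fun n B \<Longrightarrow> rec_fun n (\<lambda>e. gen_exp (A e) (B e))"
  unfolding gen_exp_def by (intro rec_intro)

lemma rec_tadd [rec_intro]: "rec_fun n A \<Longrightarrow> rec_fun n B \<Longrightarrow> rec_fun n (\<lambda>e. tadd (A e) (B e))"
  unfolding tadd_def by (intro rec_intro)

lemma rec_tmul [rec_intro]: "rec_fun n A \<Longrightarrow> rec_fun n B \<Longrightarrow> rec_fun n (\<lambda>e. tmul (A e) (B e))"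
  unfolding tmul_def by (intro rec_intro)

lemma rec_tinv [rec_intro]: "rec_fun n A \<Longrightarrow> rec_fun n (\<lambda>e. tinv (A e))"
  unfolding tinv_def by (intro rec_intro)

lemma rec_tree_val [rec_intro]: assumes "rec_fun n A" "rec_fun n B"
  shows "rec_fun n (\<lambda>e. tree_val (A e) (B e))"
proof (rule rec_lift2[where f = tree_val, OF _ assms])
  define look where "look = (\<lambda>c h i. seq_nth (c - 1 - i) h)"
  define G where "G = (\<lambda>c h j. if c mod 5 = 0 then tr 0 1 1
     else if c mod 5 = 1 then tr (p ^ gen_exp (c div 5) j) 0 1
     else if c mod 5 = 2 then tadd (look c h (pfst (c div 5))) (look c h (psnd (c div 5)))
     else if c mod 5 = 3 then tmul (look c h (pfst (c div 5))) (look c h (psnd (c div 5)))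
     else tinv (look c h (c div 5)))"
  show "rec_fun 2 (\<lambda>e. tree_val (hd e) (hd (tl e)))"
  proof (rule rec_course_of_values[where F = tree_val and G = G])
    show "rec_fun 3 (\<lambda>e. G (hd e) (hd (tl e)) (hd (tl (tl e))))"
      unfolding G_def look_def by (intro rec_intro; simp)
    fix c j h assume *: "\<And>i. i < c \<Longrightarrow> seq_nth (c - 1 - i) h = tree_val i j"
    have "look c h i = tree_val i j" if "i < c" for i using *[OF that] by (simp only: look_def)
    then show "tree_val c j = G c h j"
      by (subst tree_val.simps) (simp add: G_def arg_less)
  qed
qed

text \<open>The fractions are cross-multiplied. A sum of two truncated differences is an absolute
  value, and orders are compared through divisibility by powers of \<open>p\<close>; the bound on
  \<open>k\<close> is harmless because \<open>k < p ^ k\<close>, and a divisor of a positive number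
  does not exceed it.\<close>

definition triple_le :: "nat \<Rightarrow> nat \<Rightarrow> bool" where
  "triple_le s t \<longleftrightarrow> ((t0 t - t1 t) + (t1 t - t0 t)) * t2 s = 0 \<or>
     ((t0 s - t1 s) + (t1 s - t0 s)) * t2 t \<noteq> 0 \<and>
     (\<forall>k<((t0 s - t1 s) + (t1 s - t0 s)) * t2 t.
        p ^ k dvd ((t0 s - t1 s) + (t1 s - t0 s)) * t2 t \<longrightarrow>
        p ^ k dvd ((t0 t - t1 t) + (t1 t - t0 t)) * t2 s)"

lemma val_le_of_int_nat:
  "val_le p (of_int x) (of_int y) \<longleftrightarrow> nat \<bar>y\<bar> = 0 \<or>
     nat \<bar>x\<bar> \<noteq> 0 \<and> (\<forall>k<nat \<bar>x\<bar>. p ^ k dvd nat \<bar>x\<bar> \<longrightarrow> p ^ k dvd nat \<bar>y\<bar>)"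
proof (cases "x = 0 \<or> y = 0")
  case False
  have dvd: "p ^ k dvd nat \<bar>z\<bar> \<longleftrightarrow> k \<le> multiplicity (int p) z" if "z \<noteq> 0" for k z
  proof -
    have "p ^ k dvd nat \<bar>z\<bar> \<longleftrightarrow> int p ^ k dvd z" by (subst of_nat_dvd_iff[symmetric,
      where 'a = int]) simp
    moreover have "\<not> is_unit (int p)" using prime_int_p not_prime_unit by blast
    ultimately show ?thesis using that power_dvd_iff_le_multiplicity by blast
  qed
  have "k < nat \<bar>x\<bar>" if "p ^ k dvd nat \<bar>x\<bar>" for k
  proof -
    have "k < p ^ k" using prime_gt_1_nat[OF prime_p] by (simp add: power_gt_expt)
    also have "\<dots> \<le> nat \<bar>x\<bar>" using that False by (intro dvd_imp_le) auto
    finally show ?thesis .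
  qed
  then have "(\<forall>k<nat \<bar>x\<bar>. p ^ k dvd nat \<bar>x\<bar> \<longrightarrow> p ^ k dvd nat \<bar>y\<bar>) \<longleftrightarrow>
      (\<forall>k. p ^ k dvd nat \<bar>x\<bar> \<longrightarrow> p ^ k dvd nat \<bar>y\<bar>)" by blast
  also have "\<dots> \<longleftrightarrow> multiplicity (int p) x \<le> multiplicity (int p) y"
  proof -
    have nz: "x \<noteq> 0" "y \<noteq> 0" using False by auto
    show ?thesis unfolding dvd[OF nz(1)] dvd[OF nz(2)] by (meson order_refl order_trans)
  qed
  finally show ?thesis using False by (simp add: val_le_of_int)
qed (auto simp: val_le_of_int)

lemma val_le_triple_rat: assumes "t2 s \<noteq> 0" "t2 t \<noteq> 0"
  shows "val_le p (triple_rat s) (triple_rat t) \<longleftrightarrow> triple_le s t"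
proof -
  define x y where "x = (int (t0 s) - int (t1 s)) * int (t2 t)"
    and "y = (int (t0 t) - int (t1 t)) * int (t2 s)"
  have "of_nat (t2 s) * of_nat (t2 t) \<noteq> (0::rat)" using assms by simp
  then have "val_le p (triple_rat s) (triple_rat t) \<longleftrightarrow>
      val_le p (triple_rat s * (of_nat (t2 s) * of_nat (t2 t))) (triple_rat t * (of_nat
        (t2 s) * of_nat (t2 t)))"
    by (rule val_le_mult_iff[symmetric])
  also have "triple_rat s * (of_nat (t2 s) * of_nat (t2 t)) = of_int x"
    using assms by (simp add: triple_rat_def x_def)
  also have "triple_rat t * (of_nat (t2 s) * of_nat (t2 t)) = of_int y"
    using assms by (simp add: triple_rat_def y_def)
  finally have "val_le p (triple_rat s) (triple_rat t) \<longleftrightarrow> val_le p (of_int x) (of_int y)" .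
  moreover have abs: "nat \<bar>int m - int n\<bar> = (m - n) + (n - m)" for m n by linarith
  have "nat \<bar>x\<bar> = ((t0 s - t1 s) + (t1 s - t0 s)) * t2 t"
    "nat \<bar>y\<bar> = ((t0 t - t1 t) + (t1 t - t0 t)) * t2 s"
    unfolding x_def y_def nat_abs_mult_distrib abs by simp_all
  ultimately show ?thesis unfolding triple_le_def val_le_of_int_nat by simp
qed

lemma rec_pred_triple_le: "rec_pred 2 (\<lambda>e. triple_le (hd e) (hd (tl e)))"
  unfolding triple_le_def by (intro rec_intro; simp)

lemma rec_code [rec_intro]:
  "rec_fun n A \<Longrightarrow> rec_fun n B \<Longrightarrow> rec_fun n (\<lambda>e. cadd (A e) (B e))"
  "rec_fun n A \<Longrightarrow> rec_fun n B \<Longrightarrow> rec_fun n (\<lambda>e. cmul (A e) (B e))"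
  unfolding cadd_def cmul_def by (intro rec_intro; simp)+

lemma rec_pred_cle [rec_intro]: "rec_fun n A \<Longrightarrow> rec_fun n B \<Longrightarrow> rec_pred n (\<lambda>e. cle (A e) (B e))"
  unfolding cle_iff \<sigma>_def val_le_triple_rat[OF t2_tree_val t2_tree_val]
  by (intro rec_intro rec_pred_lift2[where f = triple_le, OF rec_pred_triple_le])

text \<open>With 0 as the code of -1, the right side tests whether the difference of
  \<open>x\<close> and \<open>y\<close> vanishes, so equality reduces to comparison.\<close>

lemma ceq_iff_cle: "ceq x y \<longleftrightarrow> cle c0 (cadd x (cmul 0 y))"
  unfolding ceq_0_iff[symmetric] by (simp add: ceq_def \<sigma>_simps)

lemma rec_pred_ceq [rec_intro]: "rec_fun n A \<Longrightarrow> rec_fun n B \<Longrightarrow> rec_pred n (\<lambda>e. ceq (A e) (B e))"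
  unfolding ceq_iff_cle by (intro rec_intro)

lemma rec_nm [rec_intro]: assumes "rec_fun n A" shows "rec_fun n (\<lambda>e. norm_code (A e))"
proof (rule rec_lift1[where f = norm_code, OF _ assms])
  have ex: "\<exists>y. ceq y x" for x using ceq_refl by blast
  show "rec_fun 1 (\<lambda>e. norm_code (hd e))" unfolding norm_code_def
    by (intro rec_Least rec_pred_ceq rec_var ex) simp_all
qed

lemma rec_gn [rec_intro]: assumes "rec_fun n A" shows "rec_fun n (\<lambda>e. value_code (A e))"
proof (rule rec_lift1[where f = value_code, OF _ assms])
  have ex: "\<exists>y. cle y x \<and> cle x y" for x using cle_refl by blast
  show "rec_fun 1 (\<lambda>e. value_code (hd e))" unfolding value_code_def
    by (intro rec_Least rec_pred_and rec_pred_cle rec_var ex) simp_all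
qed

theorem computable_limK: "computable_valued_field limK limG limv"
  unfolding computable_valued_field_def computable_ogroup_def
proof (intro conjI limK_valued_field limG_oag)
  show "computable_set (carrier limK)"
    by (rule computable_setI) (simp only: limK_simps, intro rec_intro; simp)
  show "computable_op (carrier limK) (add limK)"
    by (rule computable_opI) (simp only: limK_simps, intro rec_intro; simp)
  show "computable_op (carrier limK) (monoid.mult limK)"
    by (rule computable_opI) (simp only: limK_simps, intro rec_intro; simp)
  show "computable_set (carrier limG)"
    by (rule computable_setI) (simp only: limG_simps, intro rec_intro; simp)
  show "computable_op (carrier limG) (monoid.mult limG)"
    by (rule computable_opI) (simp only: limG_simps, intro rec_intro; simp)
  show "computable_rel (carrier limG) (ole limG)"
    by (rule computable_relI) (simp only: limG_simps, intro rec_intro; simp)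
  have "(\<lambda>x. code_value (limv x)) = (\<lambda>x. if ceq x c0 then 0 else Suc (value_code x))"
    by (auto simp: code_value_def limv_def)
  then show "computable_fun (carrier limK) (\<lambda>x. code_value (limv x))"
    by (simp only:, intro computable_funI) (intro rec_intro; simp)
qed

section \<open>Values of \<open>t\<close>, of \<open>p\<close> and of the roots\<close>

primrec cpow :: "nat \<Rightarrow> nat \<Rightarrow> nat" where
  "cpow x 0 = c1"
| "cpow x (Suc n) = cmul (cpow x n) x"

lemma \<sigma>_cpow: "\<sigma> (cpow x n) j = \<sigma> x j ^ n"
  by (induction n) (simp_all add: \<sigma>_simps)

lemma gn_pow: "value_code x [^]\<^bsub>limG\<^esub> n = value_code (cpow x n)"
  by (induction n) (simp_all add: nat_pow_def)

definition value_t where "value_t = value_code (cgen 0)"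
definition value_p where "value_p = value_code (rat_elem (of_nat p))"
definition value_s where "value_s d = value_code (cgen (Suc d))"

lemma vals_carrier: "value_t \<in> carrier limG" "value_p \<in> carrier limG" "value_s d \<in> carrier limG"
  using p_neq_0 by (auto simp: value_t_def value_p_def value_s_def ceq_rc_0 not_ceq_0 \<sigma>_eval)

text \<open>From stage \<open>Suc d\<close> on the division in \<open>gen_exp\<close> is exact, so
  the identity holds between the sequences there and passes to their values.\<close>

lemma value_t_decomp:
  assumes "V d" shows "value_t = value_p [^]\<^bsub>limG\<^esub> b d \<otimes>\<^bsub>limG\<^esub> value_s d [^]\<^bsub>limG\<^esub> modulus d"
proof -
  have "ceq (cgen 0) (cmul (cpow (rat_elem (of_nat p)) (b d)) (cpow (cgen (Suc d)) (modulus d)))"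
    unfolding ceq_def
  proof (rule eventually_elim2[OF \<sigma>_rc[of "of_nat p"] eventually_gt_at_top[of d]])
    fix j assume rat_elem: "\<sigma> (rat_elem (of_nat p)) j = of_nat p" and "d < j"
    have "t_exp j mod modulus d = b d" using t_exp_mod[OF \<open>d < j\<close> assms] .
    then have "t_exp j = b d + ((t_exp j - b d) div modulus d) * modulus d"
      by (metis add.commute div_mult_mod_eq minus_mod_eq_div_mult minus_mod_eq_mult_div
          nonzero_mult_div_cancel_left mult_eq_0_iff div_by_0 mult_zero_right)
    then have "gen_exp 0 j = b d + gen_exp (Suc d) j * modulus d" using assms
      by (simp add: gen_exp_def)
    then show "\<sigma> (cgen 0) j =
      \<sigma> (cmul (cpow (rat_elem (of_nat p)) (b d)) (cpow (cgen (Suc d)) (modulus d))) j"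
      by (simp add: \<sigma>_eval \<sigma>_cpow rat_elem power_add power_mult)
  qed
  from gn_cong[OF this] show ?thesis
    by (simp add: value_t_def value_p_def value_s_def gn_pow)
qed

lemma limv_p: "limv (add_pow limK p \<one>\<^bsub>limK\<^esub>) = Some value_p"
  using p_neq_0 by (simp only: add_pow_one limv_def ceq_rc_0 value_p_def if_False)

end

section \<open>Residues in groups elementarily equivalent to the integers\<close>

definition f_or :: "(nat \<Rightarrow> ogform) \<Rightarrow> nat \<Rightarrow> ogform" where
  "f_or \<phi> n = FNot (rec_nat (FEq TZero TZero) (\<lambda>k \<psi>. FAnd \<psi> (FNot (\<phi> k))) n)"

lemma fsat_f_or: "fsat G e (f_or \<phi> n) \<longleftrightarrow> (\<exists>k<n. fsat G e (\<phi> k))"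
  unfolding f_or_def by (induction n) (auto simp: less_Suc_eq)

lemma ffree_f_or: "ffree (f_or \<phi> n) = (\<Union>k<n. ffree (\<phi> k))"
  unfolding f_or_def by (induction n) (auto simp: less_Suc_eq)

definition t_pow :: "nat \<Rightarrow> ogterm \<Rightarrow> ogterm" where
  "t_pow n t = rec_nat TZero (\<lambda>_ s. TPlus s t) n"

lemma tval_t_pow: "tval G e (t_pow n t) = tval G e t [^]\<^bsub>G\<^esub> n"
  unfolding t_pow_def by (induction n) (simp_all add: nat_pow_def)

lemma tvars_t_pow: "tvars (t_pow n t) \<subseteq> tvars t"
  unfolding t_pow_def by (induction n) auto

definition least_positive :: "('a, 'm) ogroup_scheme \<Rightarrow> 'a \<Rightarrow> bool" where
  "least_positive G g \<longleftrightarrow> g \<in> carrier G \<and> oless G \<one>\<^bsub>G\<^esub> g \<and>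
     (\<forall>h\<in>carrier G. oless G \<one>\<^bsub>G\<^esub> h \<longrightarrow> ole G g h)"

text \<open>Variable \<open>0\<close> ranges over the least positive elements, and the element assigned to variable \<open>1\<close>
  is congruent modulo \<open>n\<close> to \<open>k\<close> times the least positive element, for some \<open>k < n\<close>.\<close>

definition residues_form :: "nat \<Rightarrow> ogform" where
  "residues_form n = FAll 0 (FAll 1 (FNot (FAnd
     (FAnd (FAnd (FLe TZero (TVar 0)) (FNot (FEq TZero (TVar 0))))
       (FAll 2 (FNot (FAnd (FAnd (FLe TZero (TVar 2)) (FNot (FEq TZero (TVar 2))))
          (FNot (FLe (TVar 0) (TVar 2)))))))
     (FNot (f_or (\<lambda>k. FNot (FAll 2 (FNot (FEq (TVar 1)
        (TPlus (t_pow k (TVar 0)) (t_pow n (TVar 2))))))) n)))))"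

lemma fsat_residues_form:
  "fsat G e (residues_form n) \<longleftrightarrow>
     (\<forall>g\<in>carrier G. \<forall>x\<in>carrier G. least_positive G g \<longrightarrow>
        (\<exists>k<n. \<exists>y\<in>carrier G. x = g [^]\<^bsub>G\<^esub> k \<otimes>\<^bsub>G\<^esub> y [^]\<^bsub>G\<^esub> n))"
  unfolding residues_form_def
  by (simp add: fsat_f_or tval_t_pow least_positive_def oless_def) blast

lemma ffree_residues_form: "ffree (residues_form n) = {}"
proof -
  have "tvars (t_pow k (TVar i)) \<subseteq> {i}" for k i using tvars_t_pow[of k "TVar i"] by simp
  then show ?thesis by (simp add: residues_form_def ffree_f_or) blast
qed

lemma int_ogroup_pow: "x [^]\<^bsub>int_ogroup\<^esub> (n::nat) = int n * x"
  by (induction n) (simp_all add: nat_pow_def int_ogroup_def algebra_simps)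

lemma fsat_int_residues_form: assumes "n > 0" shows "fsat int_ogroup e (residues_form n)"
  unfolding fsat_residues_form
proof (intro ballI impI)
  fix g x assume g: "least_positive int_ogroup g"
  have "0 < g" "\<And>h. 0 < h \<Longrightarrow> g \<le> h"
    using g by (auto simp: least_positive_def oless_def int_ogroup_def)
  from this(1) this(2)[of 1] have "g = 1" by simp
  have "nat (x mod int n) < n" using assms by (simp add: nat_less_iff)
  moreover have "x = int (nat (x mod int n)) * g + int n * (x div int n)" using assms \<open>g = 1\<close>
    by simp
  ultimately show "\<exists>k<n. \<exists>y\<in>carrier int_ogroup. x =
    g [^]\<^bsub>int_ogroup\<^esub> k \<otimes>\<^bsub>int_ogroup\<^esub> y [^]\<^bsub>int_ogroup\<^esub> n"
    unfolding int_ogroup_pow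
    by (intro exI[of _ "nat (x mod int n)"] conjI bexI[of _ "x div int n"])
      (simp_all add: int_ogroup_def)
qed

lemma elem_equiv_residues:
  fixes n :: nat
  assumes "elem_equiv G int_ogroup" "n > 0" "least_positive G g" "x \<in> carrier G"
  shows "\<exists>k<n. \<exists>y\<in>carrier G. x = g [^]\<^bsub>G\<^esub> k \<otimes>\<^bsub>G\<^esub> y [^]\<^bsub>G\<^esub> n"
proof -
  have "fsat G (\<lambda>_. \<one>\<^bsub>G\<^esub>) (residues_form n)"
    using assms(1,2) ffree_residues_form fsat_int_residues_form unfolding elem_equiv_def by blast
  then show ?thesis using assms(3,4) unfolding fsat_residues_form by (auto simp: least_positive_def)
qed

section \<open>Uniqueness of residues\<close>

context ordered_abelian_group
begin

lemma pow_mono: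
  fixes n :: nat
  assumes "x \<in> carrier G" "y \<in> carrier G" "ole G x y"
  shows "ole G (x [^] n) (y [^] n)"
proof (induction n)
  case (Suc n)
  have "ole G (x [^] n \<otimes> x) (y [^] n \<otimes> x)" using assms Suc by (intro ole_mult) auto
  moreover have "ole G (x \<otimes> y [^] n) (y \<otimes> y [^] n)" using assms by (intro ole_mult) auto
  ultimately show ?case
    using assms ole_trans[of "x [^] n \<otimes> x" "y [^] n \<otimes> x" "y [^] n \<otimes> y"]
    by (simp add: m_comm[of x "y [^] n"] m_comm[of y "y [^] n"])
qed (simp add: ole_refl)

lemma ole_cancel:
  assumes "a \<in> carrier G" "b \<in> carrier G" "c \<in> carrier G" "ole G (a \<otimes> c) (b \<otimes> c)" shows "ole G a b"
  using ole_mult[of "a \<otimes> c" "b \<otimes> c" "inv c"] assms by (simp add: m_assoc)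

lemma pow_strict:
  fixes m n :: nat
  assumes g: "g \<in> carrier G" "oless G \<one> g" and mn: "m < n"
  shows "\<not> ole G (g [^] n) (g [^] m)"
proof
  assume le: "ole G (g [^] n) (g [^] m)"
  obtain k where n: "n = Suc (k + m)" using mn less_iff_Suc_add by (metis add.commute)
  have "ole G (\<one> [^] Suc k) (g [^] k \<otimes> g)"
    using pow_mono[of \<one> g "Suc k"] g by (simp add: oless_def)
  moreover have "g [^] n = (g [^] k \<otimes> g) \<otimes> g [^] m"
    using g by (simp add: n nat_pow_mult[symmetric] m_assoc m_comm[of g "g [^] m"])
  then have "ole G (g [^] k \<otimes> g) \<one>"
    using le g ole_cancel[of "g [^] k \<otimes> g" \<one> "g [^] m"] by simp
  moreover have "ole G g (g [^] k \<otimes> g)"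
    using pow_mono[of \<one> g k] ole_mult[of \<one> "g [^] k" g] g by (simp add: oless_def)
  ultimately have "ole G g \<one>" using g ole_trans[of g "g [^] k \<otimes> g" \<one>] by simp
  then show False using g ole_antisym[of g \<one>] by (auto simp: oless_def)
qed

text \<open>If \<open>k < k'\<close>, the quotient \<open>z\<close> of \<open>y\<close> and
  \<open>y'\<close> satisfies \<open>z ^ n = g ^ (k' - k)\<close>, so it is positive and therefore
  at least \<open>g\<close>. Then \<open>g ^ n\<close> is at most \<open>g ^ (k' - k)\<close>,
  although \<open>k' - k < n\<close>.\<close>

lemma residue_unique:
  fixes k k' n :: nat
  assumes g: "least_positive G g" and y: "y \<in> carrier G" "y' \<in> carrier G"
    and k: "k < n" "k' < n" and eq: "g [^] k \<otimes> y [^] n = g [^] k' \<otimes> y' [^] n"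
  shows "k = k'"
proof -
  have gc: "g \<in> carrier G" "oless G \<one> g" using g by (auto simp: least_positive_def)
  have *: False if that: "y \<in> carrier G" "y' \<in> carrier G" "k < k'" "k' < n"
    "g [^] k \<otimes> y [^] n = g [^] k' \<otimes> y' [^] n" for y y' and k k' :: nat
  proof -
    define z where "z = y \<otimes> inv y'"
    have z: "z \<in> carrier G" using that by (simp add: z_def)
    obtain d where d: "k' = k + d" "d > 0" using less_imp_add_positive[OF \<open>k < k'\<close>] by auto
    have "y [^] n = (z \<otimes> y') [^] n" using that by (simp add: z_def m_assoc)
    also have "\<dots> = z [^] n \<otimes> y' [^] n" using that z by (simp add: nat_pow_distrib)
    finally have "g [^] k \<otimes> (z [^] n \<otimes> y' [^] n) = g [^] k \<otimes> (g [^] d \<otimes> y' [^] n)"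
      using that gc by (simp add: d nat_pow_mult[symmetric] m_assoc)
    then have zn: "z [^] n = g [^] d" using that gc z by simp
    have "\<not> ole G (g [^] d) (g [^] (0::nat))" by (rule pow_strict[OF gc d(2)])
    then have "\<not> ole G z \<one>" using pow_mono[of z \<one> n] z zn by auto
    then have "oless G \<one> z" using ole_total[of z \<one>] ole_refl[of \<one>] z by (auto simp: oless_def)
    then have "ole G g z" using g z by (auto simp: least_positive_def)
    then have "ole G (g [^] n) (g [^] d)" using pow_mono[of g z n] gc z zn by simp
    moreover have "d < n" using that d by simp
    ultimately show False using pow_strict[OF gc] by blast
  qed
  show ?thesis
    using *[OF y, of k k'] *[OF y(2,1), of k' k] eq k by (cases k k' rule: linorder_cases) auto
qed

end

section \<open>Computing residues by search\<close>

lemma rec_pred_mem: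
  assumes "computable_set A" "rec_fun n F" shows "rec_pred n (\<lambda>e. F e \<in> A)"
proof (rule rec_pred_lift1[where f = "\<lambda>x. x \<in> A", OF _ assms(2)])
  obtain s where s: "\<And>x. reval s [x] (if x \<in> A then 1 else 0)"
    using assms(1) unfolding computable_set_def by blast
  have "reval s xs (if hd xs \<in> A then 1 else 0)" if "length xs = 1" for xs
    using s[of "hd xs"] that by (cases xs) auto
  then show "rec_pred 1 (\<lambda>e. hd e \<in> A)" unfolding rec_pred_def rec_fun_def by blast
qed

text \<open>\<open>computable_op\<close> promises convergence on \<open>A\<close> only, while
  \<open>rec_fun\<close> demands it everywhere; arguments outside \<open>A\<close> are replaced by
  \<open>x0\<close> before the program runs.\<close>

lemma rec_total_op:
  assumes A: "computable_set A" and f: "computable_op A f" and x0: "x0 \<in> A"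
  shows "rec_fun 2 (\<lambda>e. f (if hd e \<in> A then hd e else x0) (if hd (tl e) \<in> A then hd (tl e) else
    x0))"
proof -
  obtain r where r: "\<And>x y. x \<in> A \<Longrightarrow> y \<in> A \<Longrightarrow> reval r [x, y] (f x y)"
    using f unfolding computable_op_def by blast
  have "rec_fun 2 (\<lambda>e. if hd e \<in> A then hd e else x0)"
    "rec_fun 2 (\<lambda>e. if hd (tl e) \<in> A then hd (tl e) else x0)"
    by (intro rec_intro rec_pred_mem A; simp)+
  then obtain s t where s: "\<And>e. length e = 2 \<Longrightarrow> reval s e (if hd e \<in> A then hd e else x0)"
    and t: "\<And>e. length e = 2 \<Longrightarrow> reval t e (if hd (tl e) \<in> A then hd (tl e) else x0)"
    unfolding rec_fun_def by blast
  have "reval (Comp r [s, t]) e (f (if hd e \<in> A then hd e else x0) (if hd (tl e) \<in> A then hd (tl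
    e) else x0))"
    if "length e = 2" for e
    by (rule reval.Comp[where ys = "[if hd e \<in> A then hd e else x0,
      if hd (tl e) \<in> A then hd (tl e) else x0]"])
       (use s[OF that] t[OF that] r x0 in auto)
  then show ?thesis unfolding rec_fun_def by blast
qed

lemma residues_computable:
  fixes G :: "nat ogroup"
  assumes G: "computable_ogroup G" and Z: "elem_equiv G int_ogroup" and g: "least_positive G g"
    and x: "x \<in> carrier G" and m: "rec_fun 1 (\<lambda>e. m (hd e))" "\<And>i. m i > 0"
  obtains h where "rec_fun 1 (\<lambda>e. h (hd e))" "\<And>i. h i < m i"
    "\<And>i. \<exists>y\<in>carrier G. x = g [^]\<^bsub>G\<^esub> h i \<otimes>\<^bsub>G\<^esub> y [^]\<^bsub>G\<^esub> m i"
proof -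
  interpret ordered_abelian_group G using G by (simp add: computable_ogroup_def)
  have A: "computable_set (carrier G)" and mul: "computable_op (carrier G) (monoid.mult G)"
    using G by (simp_all add: computable_ogroup_def)
  have gc: "g \<in> carrier G" using g by (simp add: least_positive_def)
  define f where "f = (\<lambda>y z. (if y \<in> carrier G then y else \<one>\<^bsub>G\<^esub>) \<otimes>\<^bsub>G\<^esub> (if z \<in> carrier G then z
    else \<one>\<^bsub>G\<^esub>))"
  have rec_f: "rec_fun n F \<Longrightarrow> rec_fun n H \<Longrightarrow> rec_fun n (\<lambda>e. f (F e) (H e))" for n F H
    using rec_lift2[where f = f] rec_total_op[OF A mul one_closed] unfolding f_def by blast
  define P where "P = (\<lambda>n y. rec_nat \<one>\<^bsub>G\<^esub> (\<lambda>_ z. f z y) n)"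
  have P: "P n y = y [^]\<^bsub>G\<^esub> n" if "y \<in> carrier G" for n y
    using that by (induction n) (simp_all add: P_def f_def)
  have rec_P: "rec_fun n F \<Longrightarrow> rec_fun n H \<Longrightarrow> rec_fun n (\<lambda>e. P (F e) (H e))" for n F H
  proof (rule rec_lift2[where f = P])
    have "rec_fun (Suc 1) (\<lambda>e. P (hd e) (hd (tl e)))"
      by (rule rec_primrec[where F = "\<lambda>_. \<one>\<^bsub>G\<^esub>" and G = "\<lambda>k y xs. f y (hd xs)"
        and f = "\<lambda>k xs. P k (hd xs)"])
         (auto intro!: rec_intro rec_f simp: P_def)
    then show "rec_fun 2 (\<lambda>e. P (hd e) (hd (tl e)))" by (simp add: numeral_2_eq_2)
  qed
  \<comment> \<open>\<open>j\<close> codes a candidate residue together with a witness for the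
    congruence; elementary equivalence to the integers guarantees that the search over
    \<open>j\<close> ends.\<close>
  define ok where "ok = (\<lambda>j i. pfst j < m i \<and> psnd j \<in> carrier G \<and> x =
    f (P (pfst j) g) (P (m i) (psnd j)))"
  have ex: "\<exists>j. ok j i" for i
  proof -
    obtain k y where "k < m i" "y \<in> carrier G" "x = g [^]\<^bsub>G\<^esub> k \<otimes>\<^bsub>G\<^esub> y [^]\<^bsub>G\<^esub> m i"
      using elem_equiv_residues[OF Z m(2) g x] by blast
    then show ?thesis using gc by (intro exI[of _ "pair k y"]) (simp add: ok_def P f_def)
  qed
  define h where "h = (\<lambda>i. pfst (LEAST j. ok j i))"
  have ok: "ok (LEAST j. ok j i) i" for i by (rule LeastI_ex[OF ex])
  show thesis
  proof (rule that[of h])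
    show "rec_fun 1 (\<lambda>e. h (hd e))" unfolding h_def
      by (intro rec_p1 rec_Least ex) (unfold ok_def, intro rec_intro rec_f rec_P rec_pred_mem A
        rec_lift1[where f = m, OF m(1)]; simp)
    have ok_dest: "pfst j < m i \<and> (\<exists>y\<in>carrier G. x = g [^]\<^bsub>G\<^esub> pfst j \<otimes>\<^bsub>G\<^esub> y [^]\<^bsub>G\<^esub> m i)"
      if "ok j i" for i j
      using that gc by (auto simp: ok_def P f_def intro!: bexI[of _ "psnd j"])
    show "h i < m i" for i using ok_dest[OF ok[of i]] by (simp add: h_def)
    show "\<exists>y\<in>carrier G. x = g [^]\<^bsub>G\<^esub> h i \<otimes>\<^bsub>G\<^esub> y [^]\<^bsub>G\<^esub> m i" for i
      using ok_dest[OF ok[of i]] by (simp add: h_def)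
  qed
qed

section \<open>Closures of the constructed field\<close>

lemma ring_hom_add_pow_one:
  assumes "ring K" "ring L" "f \<in> ring_hom K L"
  shows "f (add_pow K (n::nat) \<one>\<^bsub>K\<^esub>) = add_pow L n \<one>\<^bsub>L\<^esub>"
proof -
  interpret K: ring K by fact
  interpret L: ring L by fact
  show ?thesis
  proof (induction n)
    case 0
    then show ?case using ring_hom_zero[OF assms(3,1,2)] by (simp add: add_pow_def)
  next
    case (Suc n)
    then show ?case
      using ring_hom_add[OF assms(3), of "add_pow K n \<one>\<^bsub>K\<^esub>" "\<one>\<^bsub>K\<^esub>"] ring_hom_one[OF assms(3)]
        by simp
  qed
qed

context construction
begin

lemma no_computable_closure:
  fixes L :: "nat ring" and \<Delta> :: "nat ogroup"
  assumes diag: "\<And>h. rec_fun 1 (\<lambda>e. h (hd e)) \<Longrightarrow> \<exists>d. V d \<and> b d \<noteq> h (a d)"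
    and L: "computable_valued_field L \<Delta> w" and cl: "padic_closure p limK limG limv L \<Delta> w f"
  shows False
proof -
  have "valued_field L \<Delta> w" using L by (simp add: computable_valued_field_def)
  then interpret L: valued_field L \<Delta> w .
  interpret H: ordered_abelian_group limG by (rule limG_oag)
  from cl have closed: "formally_padic p L \<Delta> w" "elem_equiv \<Delta> int_ogroup"
    and emb: "vf_embedding limK limG limv L \<Delta> w f"
    by (simp_all add: padic_closure_def padically_closed_def)
  from emb obtain g where f: "f \<in> ring_hom limK L" and g: "g \<in> hom limG \<Delta>"
    and w: "\<And>x. x \<in> carrier limK \<Longrightarrow> w (f x) = map_option g (limv x)"
    unfolding vf_embedding_def by blast
  have carr: "g x \<in> carrier \<Delta>" if "x \<in> carrier limG" for x using g that by (rule hom_in_carrier)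
  have pow: "g (x [^]\<^bsub>limG\<^esub> (n::nat)) = g x [^]\<^bsub>\<Delta>\<^esub> n" if "x \<in> carrier limG" for x n
  proof -
    interpret group_hom limG \<Delta> g by unfold_locales (rule g)
    show ?thesis using that by (rule hom_nat_pow)
  qed
  interpret K: cring limK by (rule limK_cring)
  obtain \<pi> where \<pi>: "w (add_pow L p \<one>\<^bsub>L\<^esub>) = Some \<pi>" "least_positive \<Delta> \<pi>"
    using closed(1) unfolding formally_padic_def least_positive_def by blast
  \<comment> \<open>An embedding respects \<open>p\<close> times one, so the least positive element
    of \<open>\<Delta>\<close> is the image of the value of \<open>p\<close>, and residues in
    \<open>\<Delta>\<close> refer to the same unit as those in the constructed field.\<close>
  have "w (f (add_pow limK p \<one>\<^bsub>limK\<^esub>)) = map_option g (Some value_p)"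
    unfolding limv_p[symmetric] by (rule w) (rule K.add.nat_pow_closed, rule K.one_closed)
  then have "\<pi> = g value_p"
    using \<pi>(1) ring_hom_add_pow_one[OF K.ring_axioms L.K.ring_axioms f, of p] by simp
  then have lp: "least_positive \<Delta> (g value_p)" using \<pi>(2) by simp
  \<comment> \<open>The search runs over all indices \<open>i\<close>, not only over arguments of
    requirements, so that \<open>h\<close> is total and the diagonal property applies to it.\<close>
  have "rec_fun 1 (\<lambda>e. fermat (hd e))" unfolding fermat_def by (intro rec_intro; simp)
  moreover have "fermat i > 0" for i by (simp add: fermat_def)
  moreover have "computable_ogroup \<Delta>" using L by (simp add: computable_valued_field_def)
  ultimately obtain h where h: "rec_fun 1 (\<lambda>e. h (hd e))" "\<And>i. h i < fermat i"
    "\<And>i. \<exists>y\<in>carrier \<Delta>. g value_t = g value_p [^]\<^bsub>\<Delta>\<^esub> h i \<otimes>\<^bsub>\<Delta>\<^esub> y [^]\<^bsub>\<Delta>\<^esub> fermat i"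
    using residues_computable[OF _ closed(2) lp carr[OF vals_carrier(1)], of fermat] by metis
  obtain d where d: "V d" "b d \<noteq> h (a d)" using diag[OF h(1)] by blast
  obtain y where y: "y \<in> carrier \<Delta>"
    "g value_t = g value_p [^]\<^bsub>\<Delta>\<^esub> h (a d) \<otimes>\<^bsub>\<Delta>\<^esub> y [^]\<^bsub>\<Delta>\<^esub> modulus d"
    using h(3)[of "a d"] by (auto simp: modulus_def)
  \<comment> \<open>The image of the adjoined root exhibits the residue \<open>b d\<close> for the
    modulus at which the search found \<open>h (a d)\<close>; uniqueness makes them equal.\<close>
  have "g value_t = g value_p [^]\<^bsub>\<Delta>\<^esub> b d \<otimes>\<^bsub>\<Delta>\<^esub> g (value_s d) [^]\<^bsub>\<Delta>\<^esub> modulus d"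
    unfolding value_t_decomp[OF d(1)] using vals_carrier
      by (simp only: hom_mult[OF g] H.nat_pow_closed pow)
  moreover have "b d < modulus d" using b_le[of d] modulus_gt[of d] by simp
  moreover have "h (a d) < modulus d" using h(2)[of "a d"] by (simp add: modulus_def)
  ultimately have "b d = h (a d)"
    using L.G.residue_unique[OF lp carr[OF vals_carrier(3)[of d]] y(1)] y(2) by metis
  then show False using d(2) by simp
qed

end

theorem theorem1p3:
  fixes p :: nat
  assumes "Factorial_Ring.prime p"
  shows "\<exists>(K :: nat ring) (\<Gamma> :: nat ogroup) v.
    computable_valued_field K \<Gamma> v \<and> formally_padic p K \<Gamma> v \<and>
    \<not> (\<exists>(L :: nat ring) (\<Delta> :: nat ogroup) w f.
          computable_valued_field L \<Delta> w \<and> padic_closure p K \<Gamma> v L \<Delta> w f)"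
proof -
  obtain V a b where Vab: "rec_pred 1 (\<lambda>e. V (hd e))" "rec_fun 1 (\<lambda>e. a (hd e))"
    "rec_fun 1 (\<lambda>e. b (hd e))"
      "\<And>d. b d \<le> 1" "inj_on a {d. V d}"
    and diag: "\<And>h. rec_fun 1 (\<lambda>e. h (hd e)) \<Longrightarrow> \<exists>d. V d \<and> b d \<noteq> h (a d)"
    using diagonal_requirements by metis
  interpret construction p V a b by unfold_locales (use assms Vab in auto)
  show ?thesis
    using computable_limK limK_formally_padic no_computable_closure[OF diag] by blast
qed

end
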